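(* Let $G=A*B$, where each of $A,B$ is either an Artin-Tits group or a Coxeter group (each given with its finite standard generating set). Then $G$ is a Shephard group (with generating set the disjoint union of the standard generating sets of $A$ and $B$), and the standard coset incidence system $\Gamma=(G,(G_i)_{i\in I})$ associated to $G$ is a flag-transitive, residually connected and firm geometry.
   Context: Notation: $(ab)_m$ is the alternating word $aba\cdots$ with $m$ factors. Coxeter groups: $\langle r_1,\dots,r_n\mid (r_ir_j)^{m_{i,j}}=1\rangle$ with $m_{i,i}=1$, $m_{i,j}=m_{j,i}\in\{2,3,\dots\}\cup\{\infty\}$ for $i\ne j$. Artin-Tits groups: $\langle a_1,\dots,a_n\mid (a_ia_j)_{m_{i,j}}=(a_ja_i)_{m_{i,j}}\ (i\neq j)\rangle$ (no relation if $m_{i,j}=\infty$). Shephard group: let $\mathcal G$ be a finite undirected graph, loops allowed, with each edge labeled in $\{3,4,\dots\}\cup\{\infty\}$, write $m_{a,b}$ for the label of the edge $(a,b)$ and $m_a$ for the label of the loop at $a$, and assume it is properly labeled ($m_a=m_b$ whenever $m_{a,b}$ is odd; either both or neither have loops). The Shephard group $A(\mathcal G)$ is generated by the vertices subject to: $a^{m_a}=1$ if $a$ has a loop with $m_a\ne\infty$ (no order relation if $m_a=\infty$); $a^2=1$ if $a$ has no loop; $(ab)_{m_{a,b}}=(ba)_{m_{a,b}}$ for each proper edge with $m_{a,b}\neq\infty$; $ab=ba$ for distinct vertices not joined by an edge. Standard coset incidence system of a Shephard group with generators $a_1,\dots,a_n$: $(G,(G_i)_{i\in I})$ with $I=\{1,\dots,n\}$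 and $G_i=\langle a_j\mid j\in I\setminus\{i\}\rangle$. A coset incidence system $(G,(G_i)_{i\in I})$ denotes the incidence system whose elements of type $i$ are the left cosets $gG_i$ (cosets of different types are different elements), two elements being incident iff they intersect. A flag is a set of pairwise incident elements; a chamber is a flag of type $I$ (containing an element of each type); the corank of $F$ is $|I|-|F|$. The system is a geometry if every maximal flag is a chamber. The residue of $F$ consists of all elements incident to every element of $F$ and not in $F$, and has rank $|I|-|F|$. Residually connected: every residue of rank at least two (including that of the empty flag) has connected incidence graph. Firm: every residue of a flag of corank one has at least two elements. Flag-transitive: $G$, acting by left multiplication, is transitive on the flags of type $J$ for each $J\subseteq I$. *)

theory Defs
  imports "HOL-Algebra.Generated_Groups" "HOL-Algebra.Group_Action" "HOL-Library.Extended_Nat"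
begin

section \<open>Groups given by generators and relations\<close>

text \<open>
  A word over \<open>V\<close> is a list of signed letters: \<open>(x, True)\<close> stands for the generator \<open>x\<close> and
  \<open>(x, False)\<close> for its formal inverse. A relation \<open>u = v\<close> is the pair \<open>(u, v)\<close>.
\<close>

type_synonym 'x word = "('x \<times> bool) list"

definition words :: "'x set \<Rightarrow> 'x word set"
  where "words V = lists (V \<times> UNIV)"

abbreviation letter :: "'x \<Rightarrow> 'x \<times> bool"
  where "letter x \<equiv> (x, True)"

inductive_set word_cong :: "'x set \<Rightarrow> ('x word \<times> 'x word) set \<Rightarrow> ('x word \<times> 'x word) set"
  for V :: "'x set" and R :: "('x word \<times> 'x word) set"
where
  refl: "w \<in> words V \<Longrightarrow> (w, w) \<in> word_cong V R"
| sym: "(u, v) \<in> word_cong V R \<Longrightarrow> (v, u) \<in> word_cong V R"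
| trans: "(u, v) \<in> word_cong V R \<Longrightarrow> (v, w) \<in> word_cong V R \<Longrightarrow> (u, w) \<in> word_cong V R"
| append: "(u, u') \<in> word_cong V R \<Longrightarrow> (v, v') \<in> word_cong V R \<Longrightarrow>
    (u @ v, u' @ v') \<in> word_cong V R"
| cancel: "x \<in> V \<Longrightarrow> ([(x, e), (x, \<not> e)], []) \<in> word_cong V R"
| rel: "(u, v) \<in> R \<Longrightarrow> u \<in> words V \<Longrightarrow> v \<in> words V \<Longrightarrow> (u, v) \<in> word_cong V R"

definition word_class :: "'x set \<Rightarrow> ('x word \<times> 'x word) set \<Rightarrow> 'x word \<Rightarrow> 'x word set"
  where "word_class V R w = word_cong V R `` {w}"

definition presented_group :: "'x set \<Rightarrow> ('x word \<times> 'x word) set \<Rightarrow> 'x word set monoid"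
  where "presented_group V R =
    \<lparr>carrier = words V // word_cong V R,
     mult = (\<lambda>C D. \<Union>u\<in>C. \<Union>v\<in>D. word_class V R (u @ v)),
     one = word_class V R []\<rparr>"

text \<open>
  \<open>has_presentation G V s R\<close>: the group \<open>G\<close>, with the family of generators \<open>s x\<close> (\<open>x \<in> V\<close>), has
  the presentation \<open>\<langle>V | R\<rangle>\<close>.
\<close>

definition has_presentation ::
    "'g monoid \<Rightarrow> 'x set \<Rightarrow> ('x \<Rightarrow> 'g) \<Rightarrow> ('x word \<times> 'x word) set \<Rightarrow> bool"
  where "has_presentation G V s R \<longleftrightarrow> group G \<and>
    (\<exists>h \<in> iso (presented_group V R) G. \<forall>x\<in>V. h (word_class V R [letter x]) = s x)"

text \<open>\<open>alternating a b m\<close> is the word \<open>aba\<dots>\<close> with \<open>m\<close> factors.\<close>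

fun alternating :: "'x \<Rightarrow> 'x \<Rightarrow> nat \<Rightarrow> 'x word"
  where
    "alternating a b 0 = []"
  | "alternating a b (Suc m) = letter a # alternating b a m"

section \<open>Coxeter, Artin-Tits and Shephard groups\<close>

definition coxeter_matrix :: "'x set \<Rightarrow> ('x \<Rightarrow> 'x \<Rightarrow> enat) \<Rightarrow> bool"
  where "coxeter_matrix X m \<longleftrightarrow>
    (\<forall>i\<in>X. m i i = 1) \<and> (\<forall>i\<in>X. \<forall>j\<in>X. i \<noteq> j \<longrightarrow> m i j = m j i \<and> 2 \<le> m i j)"

definition coxeter_relations ::
    "'x set \<Rightarrow> ('x \<Rightarrow> 'x \<Rightarrow> enat) \<Rightarrow> ('x word \<times> 'x word) set"
  where "coxeter_relations X m =
    {(concat (replicate k [letter i, letter j]), []) | i j k.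
       i \<in> X \<and> j \<in> X \<and> m i j = enat k}"

definition artin_tits_relations ::
    "'x set \<Rightarrow> ('x \<Rightarrow> 'x \<Rightarrow> enat) \<Rightarrow> ('x word \<times> 'x word) set"
  where "artin_tits_relations X m =
    {(alternating i j k, alternating j i k) | i j k.
       i \<in> X \<and> j \<in> X \<and> i \<noteq> j \<and> m i j = enat k}"

text \<open>
  The following predicates express that \<open>G\<close> is a group of the given kind whose standard generating
  set is the finite family \<open>s i\<close>, \<open>i \<in> X\<close>.
\<close>

definition is_coxeter_group :: "'g monoid \<Rightarrow> 'x set \<Rightarrow> ('x \<Rightarrow> 'g) \<Rightarrow> bool"
  where "is_coxeter_group G X s \<longleftrightarrow> finite X \<and>
    (\<exists>m. coxeter_matrix X m \<and> has_presentation G X s (coxeter_relations X m))"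

definition is_artin_tits_group :: "'g monoid \<Rightarrow> 'x set \<Rightarrow> ('x \<Rightarrow> 'g) \<Rightarrow> bool"
  where "is_artin_tits_group G X s \<longleftrightarrow> finite X \<and>
    (\<exists>m. coxeter_matrix X m \<and> has_presentation G X s (artin_tits_relations X m))"

text \<open>
  A labelled graph with vertex set \<open>V\<close> is given by its partial labelling \<open>E\<close>: \<open>E a b = None\<close> if
  there is no edge between \<open>a\<close> and \<open>b\<close>, and \<open>E a b = Some m\<close> if there is one with label \<open>m\<close>. The
  loop at \<open>a\<close> is the case \<open>a = b\<close>; hence \<open>E a a = E b b\<close> says that \<open>a\<close> and \<open>b\<close> either both have no
  loop or both have loops, with the same label.
\<close>

definition shephard_graph :: "'v set \<Rightarrow> ('v \<Rightarrow> 'v \<Rightarrow> enat option) \<Rightarrow> bool"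
  where "shephard_graph V E \<longleftrightarrow> finite V \<and>
    (\<forall>a\<in>V. \<forall>b\<in>V. E a b = E b a) \<and>
    (\<forall>a\<in>V. \<forall>b\<in>V. \<forall>m. E a b = Some m \<longrightarrow> 3 \<le> m) \<and>
    (\<forall>a\<in>V. \<forall>b\<in>V. \<forall>k. a \<noteq> b \<and> E a b = Some (enat k) \<and> odd k \<longrightarrow> E a a = E b b)"

definition shephard_relations ::
    "'v set \<Rightarrow> ('v \<Rightarrow> 'v \<Rightarrow> enat option) \<Rightarrow> ('v word \<times> 'v word) set"
  where "shephard_relations V E =
    {(replicate k (letter a), []) | a k. a \<in> V \<and> E a a = Some (enat k)} \<union>
    {([letter a, letter a], []) | a. a \<in> V \<and> E a a = None} \<union>
    {(alternating a b k, alternating b a k) | a b k.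
       a \<in> V \<and> b \<in> V \<and> a \<noteq> b \<and> E a b = Some (enat k)} \<union>
    {([letter a, letter b], [letter b, letter a]) | a b.
       a \<in> V \<and> b \<in> V \<and> a \<noteq> b \<and> E a b = None}"

definition is_shephard_group :: "'g monoid \<Rightarrow> 'v set \<Rightarrow> ('v \<Rightarrow> 'g) \<Rightarrow> bool"
  where "is_shephard_group G V s \<longleftrightarrow>
    (\<exists>E. shephard_graph V E \<and> has_presentation G V s (shephard_relations V E))"

section \<open>Free products\<close>

text \<open>
  The free product \<open>A * B\<close>: words in the elements of \<open>A\<close> and \<open>B\<close>, where adjacent letters from the
  same factor may be multiplied.
\<close>

definition free_product_relations ::
    "'g monoid \<Rightarrow> 'h monoid \<Rightarrow> (('g + 'h) word \<times> ('g + 'h) word) set"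
  where "free_product_relations A B =
    {([letter (Inl x), letter (Inl y)], [letter (Inl (x \<otimes>\<^bsub>A\<^esub> y))]) | x y.
       x \<in> carrier A \<and> y \<in> carrier A} \<union>
    {([letter (Inr x), letter (Inr y)], [letter (Inr (x \<otimes>\<^bsub>B\<^esub> y))]) | x y.
       x \<in> carrier B \<and> y \<in> carrier B}"

definition free_product :: "'g monoid \<Rightarrow> 'h monoid \<Rightarrow> ('g + 'h) word set monoid"
  where "free_product A B =
    presented_group (carrier A <+> carrier B) (free_product_relations A B)"

definition free_product_inl :: "'g monoid \<Rightarrow> 'h monoid \<Rightarrow> 'g \<Rightarrow> ('g + 'h) word set"
  where "free_product_inl A B x =
    word_class (carrier A <+> carrier B) (free_product_relations A B) [letter (Inl x)]"

definition free_product_inr :: "'g monoid \<Rightarrow> 'h monoid \<Rightarrow> 'h \<Rightarrow> ('g + 'h) word set"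
  where "free_product_inr A B x =
    word_class (carrier A <+> carrier B) (free_product_relations A B) [letter (Inr x)]"

text \<open>The disjoint union of a family in \<open>A\<close> and a family in \<open>B\<close>, as a family in \<open>A * B\<close>.\<close>

definition free_product_family ::
    "'g monoid \<Rightarrow> 'h monoid \<Rightarrow> ('a \<Rightarrow> 'g) \<Rightarrow> ('b \<Rightarrow> 'h) \<Rightarrow> 'a + 'b \<Rightarrow> ('g + 'h) word set"
  where "free_product_family A B s t =
    case_sum (\<lambda>i. free_product_inl A B (s i)) (\<lambda>j. free_product_inr A B (t j))"

section \<open>Incidence systems\<close>

record ('e, 'i) incidence_structure =
  elements :: "'e set"
  incident :: "'e \<Rightarrow> 'e \<Rightarrow> bool"
  type_of :: "'e \<Rightarrow> 'i"
  types :: "'i set"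

definition incidence_system :: "('e, 'i) incidence_structure \<Rightarrow> bool"
  where "incidence_system \<Gamma> \<longleftrightarrow>
    type_of \<Gamma> ` elements \<Gamma> \<subseteq> types \<Gamma> \<and>
    (\<forall>x \<in> elements \<Gamma>. incident \<Gamma> x x) \<and>
    (\<forall>x \<in> elements \<Gamma>. \<forall>y \<in> elements \<Gamma>. incident \<Gamma> x y \<longrightarrow> incident \<Gamma> y x) \<and>
    (\<forall>x \<in> elements \<Gamma>. \<forall>y \<in> elements \<Gamma>.
       incident \<Gamma> x y \<and> type_of \<Gamma> x = type_of \<Gamma> y \<longrightarrow> x = y)"

definition flag :: "('e, 'i) incidence_structure \<Rightarrow> 'e set \<Rightarrow> bool"
  where "flag \<Gamma> F \<longleftrightarrow> F \<subseteq> elements \<Gamma> \<and> (\<forall>x\<in>F. \<forall>y\<in>F. incident \<Gamma> x y)"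

definition flag_type :: "('e, 'i) incidence_structure \<Rightarrow> 'e set \<Rightarrow> 'i set"
  where "flag_type \<Gamma> F = type_of \<Gamma> ` F"

definition chamber :: "('e, 'i) incidence_structure \<Rightarrow> 'e set \<Rightarrow> bool"
  where "chamber \<Gamma> F \<longleftrightarrow> flag \<Gamma> F \<and> flag_type \<Gamma> F = types \<Gamma>"

definition maximal_flag :: "('e, 'i) incidence_structure \<Rightarrow> 'e set \<Rightarrow> bool"
  where "maximal_flag \<Gamma> F \<longleftrightarrow> flag \<Gamma> F \<and> (\<forall>F'. flag \<Gamma> F' \<and> F \<subseteq> F' \<longrightarrow> F' = F)"

text \<open>
  Used for finite type sets only. Distinct elements of a flag of an incidence system have distinct
  types, so the subtraction is not truncated.
\<close>

definition corank :: "('e, 'i) incidence_structure \<Rightarrow> 'e set \<Rightarrow> nat"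
  where "corank \<Gamma> F = card (types \<Gamma>) - card F"

definition residue :: "('e, 'i) incidence_structure \<Rightarrow> 'e set \<Rightarrow> 'e set"
  where "residue \<Gamma> F = {x \<in> elements \<Gamma>. x \<notin> F \<and> (\<forall>y\<in>F. incident \<Gamma> x y)}"

definition connected_incidence_graph :: "('e, 'i) incidence_structure \<Rightarrow> 'e set \<Rightarrow> bool"
  where "connected_incidence_graph \<Gamma> S \<longleftrightarrow>
    (\<forall>x\<in>S. \<forall>y\<in>S. (x, y) \<in> {(u, v). u \<in> S \<and> v \<in> S \<and> incident \<Gamma> u v}\<^sup>*)"

definition geometry :: "('e, 'i) incidence_structure \<Rightarrow> bool"
  where "geometry \<Gamma> \<longleftrightarrow> incidence_system \<Gamma> \<and> (\<forall>F. maximal_flag \<Gamma> F \<longrightarrow> chamber \<Gamma> F)"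

definition residually_connected :: "('e, 'i) incidence_structure \<Rightarrow> bool"
  where "residually_connected \<Gamma> \<longleftrightarrow>
    (\<forall>F. flag \<Gamma> F \<and> 2 \<le> corank \<Gamma> F \<longrightarrow> connected_incidence_graph \<Gamma> (residue \<Gamma> F))"

definition firm :: "('e, 'i) incidence_structure \<Rightarrow> bool"
  where "firm \<Gamma> \<longleftrightarrow>
    (\<forall>F. flag \<Gamma> F \<and> corank \<Gamma> F = 1 \<longrightarrow> (\<exists>x \<in> residue \<Gamma> F. \<exists>y \<in> residue \<Gamma> F. x \<noteq> y))"

definition flags_of_type :: "('e, 'i) incidence_structure \<Rightarrow> 'i set \<Rightarrow> 'e set set"
  where "flags_of_type \<Gamma> J = {F. flag \<Gamma> F \<and> flag_type \<Gamma> F = J}"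

text \<open>The action on flags is restricted to the flags since group actions of the library are.\<close>

definition flag_transitive ::
    "'g monoid \<Rightarrow> ('g \<Rightarrow> 'e \<Rightarrow> 'e) \<Rightarrow> ('e, 'i) incidence_structure \<Rightarrow> bool"
  where "flag_transitive G act \<Gamma> \<longleftrightarrow>
    (\<forall>J \<subseteq> types \<Gamma>.
       transitive_action G (flags_of_type \<Gamma> J) (\<lambda>g. \<lambda>F \<in> flags_of_type \<Gamma> J. act g ` F))"

section \<open>Coset incidence systems\<close>

text \<open>Cosets are tagged with their type, so that cosets of different types are different.\<close>

definition coset_incidence_system ::
    "'g monoid \<Rightarrow> 'i set \<Rightarrow> ('i \<Rightarrow> 'g set) \<Rightarrow> ('i \<times> 'g set, 'i) incidence_structure"
  where "coset_incidence_system G I H =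
    \<lparr>elements = {(i, g <#\<^bsub>G\<^esub> H i) | i g. i \<in> I \<and> g \<in> carrier G},
     incident = (\<lambda>x y. snd x \<inter> snd y \<noteq> {}),
     type_of = fst,
     types = I\<rparr>"

definition left_multiplication :: "'g monoid \<Rightarrow> 'g \<Rightarrow> 'i \<times> 'g set \<Rightarrow> 'i \<times> 'g set"
  where "left_multiplication G g x = (fst x, g <#\<^bsub>G\<^esub> snd x)"

definition standard_coset_system ::
    "'g monoid \<Rightarrow> 'i set \<Rightarrow> ('i \<Rightarrow> 'g) \<Rightarrow> ('i \<times> 'g set, 'i) incidence_structure"
  where "standard_coset_system G I s =
    coset_incidence_system G I (\<lambda>i. generate G (s ` (I - {i})))"

end

(*
  An Artin-Tits group, a Coxeter group, and any free product of such groups has a presentation with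
  generating set V, braid relations, and the relations q^2 = 1 for q in a set Q of generators that is
  closed under odd labels; for the free product the labels between the two factors are infinite. Let
  P be such a group, W the Coxeter group with the same labels, and write P_J for the subgroup
  generated by J. Two properties of the subgroups P_J suffice: x_i is not in P_J for i not in J, and
  P_J \<inter> P_K P_L \<subseteq> P_{J \<inter> K} P_{J \<inter> L}. The second one yields, by induction, a common element of
  pairwise intersecting cosets, so flags are described by a single group element, and the geometric
  properties become statements about the subgroups P_J.

  For W the first property follows from the geometric representation, and the second from the
  inversion sets N(w), which satisfy the cocycle rule N(vw) = N(v) + v N(w) v^{-1}. To pass from W to
  P, the retraction of Blufstein and Paris from P onto P_J is used: it is the identity on P_J, maps
  P_K into P_{J \<inter> K}, and is multiplicative on elements with trivial image in W.
*)

theory Submission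
  imports Defs Complex_Main
begin

section \<open>Groups given by generators and relations\<close>

text \<open>An Artin-Tits group offers neither reflections nor an exchange condition, so every
  argument with walls takes place in \<open>W\<close>. A factorisation found in \<open>W\<close>
  lifts to \<open>P\<close> only up to the kernel of the map from \<open>P\<close> to
  \<open>W\<close>. Correcting \<open>y\<close> and \<open>z\<close> by lifts of the factors, and by
  a lift of an element over \<open>K \<inter> L\<close> inserted between them, makes both of them
  elements of that kernel. A gallery reading a word for a kernel element returns to its start, which
  is why the retraction is multiplicative there. The retraction is a map on words, and the main work
  is that it respects the relations of \<open>P\<close>. In a residue of rank two there is either at
  most one wall of \<open>J\<close>, and the two sides of a braid relation give the same word, or
  there are two, both at the current chamber, and the braid relation is copied into \<open>J\<close>
  with the same label. The relation \<open>q^2 = 1\<close> survives because a blocked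
  \<open>q\<close> outputs a generator conjugate to it in \<open>W\<close>; closure of
  \<open>Q\<close> under odd labels puts that generator into \<open>Q\<close>. The geometric
  representation has a second task besides independence: it gives the exact order of
  \<open>s i \<otimes> s j\<close>, through which labels are compared.\<close>

lemma words_simps [simp]:
  "[] \<in> words V"
  "a # w \<in> words V \<longleftrightarrow> fst a \<in> V \<and> w \<in> words V"
  "u @ v \<in> words V \<longleftrightarrow> u \<in> words V \<and> v \<in> words V"
  by (cases a; auto simp: words_def)+

lemma words_mono: "J \<subseteq> K \<Longrightarrow> words J \<subseteq> words K"
  unfolding words_def by (rule lists_mono) auto

lemma words_Int: "words (J \<inter> K) = words J \<inter> words K"
  by (auto simp: words_def)

definition inverse_word :: "'x word \<Rightarrow> 'x word"
  where "inverse_word w = rev (map (\<lambda>(x, e). (x, \<not> e)) w)"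

lemma inverse_word_simps [simp]:
  "inverse_word [] = []"
  "inverse_word (a # w) = inverse_word w @ [(fst a, \<not> snd a)]"
  by (auto simp: inverse_word_def split: prod.split)

lemma inverse_word_in_words [simp]: "inverse_word w \<in> words V \<longleftrightarrow> w \<in> words V"
  by (induction w) auto

primrec word_eval :: "('g, 'k) monoid_scheme \<Rightarrow> ('x \<Rightarrow> 'g) \<Rightarrow> 'x word \<Rightarrow> 'g"
  where
    "word_eval G f [] = \<one>\<^bsub>G\<^esub>"
  | "word_eval G f (a # w) =
      (if snd a then f (fst a) else inv\<^bsub>G\<^esub> (f (fst a))) \<otimes>\<^bsub>G\<^esub> word_eval G f w"

lemma word_eval_cong:
  "w \<in> words V \<Longrightarrow> (\<And>x. x \<in> V \<Longrightarrow> f x = g x) \<Longrightarrow> word_eval G f w = word_eval G g w"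
  by (induction w) auto

lemma word_eval_map: "word_eval G f (map (map_prod h id) w) = word_eval G (f \<circ> h) w"
  by (induction w) auto

definition relations_hold ::
    "('g, 'k) monoid_scheme \<Rightarrow> 'x set \<Rightarrow> ('x \<Rightarrow> 'g) \<Rightarrow> ('x word \<times> 'x word) set \<Rightarrow> bool"
  where "relations_hold G V f R \<longleftrightarrow>
    (\<forall>(u, v) \<in> R. u \<in> words V \<longrightarrow> v \<in> words V \<longrightarrow> word_eval G f u = word_eval G f v)"

lemma relations_hold_Un [simp]:
  "relations_hold G V f (R \<union> S) \<longleftrightarrow> relations_hold G V f R \<and> relations_hold G V f S"
  by (auto simp: relations_hold_def)

lemma word_cong_words: "(u, v) \<in> word_cong V R \<Longrightarrow> u \<in> words V \<and> v \<in> words V"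
  by (induction rule: word_cong.induct) auto

lemma word_cong_inverse_word:
  "w \<in> words V \<Longrightarrow> (inverse_word w @ w, []) \<in> word_cong V R"
proof (induction w)
  case Nil
  then show ?case by (auto intro: word_cong.refl)
next
  case (Cons a w)
  have c: "([(fst a, \<not> snd a), a], []) \<in> word_cong V R"
    using word_cong.cancel[of "fst a" V "\<not> snd a" R] Cons.prems by simp
  have "(inverse_word w @ [(fst a, \<not> snd a), a] @ w, inverse_word w @ [] @ w) \<in> word_cong V R"
    using Cons.prems c by (intro word_cong.append word_cong.refl) auto
  then show ?case
    using Cons word_cong.trans by fastforce
qed

lemma equiv_word_cong: "equiv (words V) (word_cong V R)"
proof (rule equivI)
  show "word_cong V R \<subseteq> words V \<times> words V"
    using word_cong_words by auto
qed (auto intro: word_cong.intros simp: refl_on_def sym_def trans_def)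

lemma word_class_eq_iff:
  "u \<in> words V \<Longrightarrow> v \<in> words V \<Longrightarrow>
    word_class V R u = word_class V R v \<longleftrightarrow> (u, v) \<in> word_cong V R"
  unfolding word_class_def by (rule eq_equiv_class_iff[OF equiv_word_cong])

context group
begin

lemma word_eval_closed [simp]:
  "f \<in> V \<rightarrow> carrier G \<Longrightarrow> w \<in> words V \<Longrightarrow> word_eval G f w \<in> carrier G"
  by (induction w) auto

lemma word_eval_append:
  "f \<in> V \<rightarrow> carrier G \<Longrightarrow> u \<in> words V \<Longrightarrow> v \<in> words V \<Longrightarrow>
    word_eval G f (u @ v) = word_eval G f u \<otimes> word_eval G f v"
  by (induction u) (auto simp: m_assoc Pi_iff)

lemma word_eval_inverse_word:
  "f \<in> V \<rightarrow> carrier G \<Longrightarrow> w \<in> words V \<Longrightarrow>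
    word_eval G f (inverse_word w) = inv (word_eval G f w)"
  by (induction w) (auto simp: word_eval_append inv_mult_group Pi_iff)

lemma word_eval_word_cong:
  assumes f: "f \<in> V \<rightarrow> carrier G" and R: "relations_hold G V f R"
    and uv: "(u, v) \<in> word_cong V R"
  shows "word_eval G f u = word_eval G f v"
  using uv
proof (induction rule: word_cong.induct)
  case (append u u' v v')
  then show ?case
    using f word_cong_words by (metis word_eval_append)
next
  case (cancel x e)
  then show ?case using f by (auto simp: Pi_iff)
next
  case (rel u v)
  then show ?case using R by (auto simp: relations_hold_def)
qed auto

lemma generate_eq_word_eval:
  assumes f: "f \<in> J \<rightarrow> carrier G"
  shows "generate G (f ` J) = word_eval G f ` words J"
proof (intro subset_antisym subsetI)
  fix g assume "g \<in> generate G (f ` J)"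
  then show "g \<in> word_eval G f ` words J"
  proof induction
    case one
    then show ?case by (intro image_eqI[where x = "[]"]) auto
  next
    case (incl h)
    then obtain x where "x \<in> J" "h = f x" by auto
    then show ?case using f by (intro image_eqI[where x = "[(x, True)]"]) (auto simp: Pi_iff)
  next
    case (inv h)
    then obtain x where "x \<in> J" "h = f x" by auto
    then show ?case using f by (intro image_eqI[where x = "[(x, False)]"]) (auto simp: Pi_iff)
  next
    case (eng h1 h2)
    then obtain u v where "u \<in> words J" "v \<in> words J" "h1 = word_eval G f u" "h2 = word_eval G f v"
      by auto
    then show ?case
      using f by (intro image_eqI[where x = "u @ v"]) (auto simp: word_eval_append)
  qed
next
  fix g assume "g \<in> word_eval G f ` words J"
  then obtain w where w: "w \<in> words J" "g = word_eval G f w" by auto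
  have "word_eval G f w \<in> generate G (f ` J)"
    using w(1) by (induction w) (auto intro: generate.intros)
  then show "g \<in> generate G (f ` J)" using w by simp
qed

end

section \<open>The group of word classes\<close>

context
  fixes V :: "'x set" and R :: "('x word \<times> 'x word) set"
begin

lemma carrier_presented_group:
  "carrier (presented_group V R) = word_class V R ` words V"
  by (auto simp: presented_group_def quotient_def word_class_def)

lemma one_presented_group: "\<one>\<^bsub>presented_group V R\<^esub> = word_class V R []"
  by (simp add: presented_group_def)

lemma mult_presented_group:
  assumes "u \<in> words V" "v \<in> words V"
  shows "word_class V R u \<otimes>\<^bsub>presented_group V R\<^esub> word_class V R v = word_class V R (u @ v)"
proof -
  have "word_class V R (u' @ v') = word_class V R (u @ v)"
    if "u' \<in> word_class V R u" "v' \<in> word_class V R v" for u' v'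
  proof -
    have "(u @ v, u' @ v') \<in> word_cong V R"
      using that by (auto simp: word_class_def intro: word_cong.append)
    then show ?thesis
      using word_cong_words word_class_eq_iff by metis
  qed
  moreover have "u \<in> word_class V R u" "v \<in> word_class V R v"
    using assms by (auto simp: word_class_def intro: word_cong.refl)
  ultimately have "(\<Union>u'\<in>word_class V R u. \<Union>v'\<in>word_class V R v. word_class V R (u' @ v')) =
      word_class V R (u @ v)"
    by blast
  then show ?thesis by (simp add: presented_group_def)
qed

lemma group_presented_group: "group (presented_group V R)"
proof (rule groupI)
  fix x assume "x \<in> carrier (presented_group V R)"
  then obtain w where "w \<in> words V" "x = word_class V R w"
    by (auto simp: carrier_presented_group)
  then show "\<exists>y\<in>carrier (presented_group V R). y \<otimes>\<^bsub>presented_group V R\<^esub> x = \<one>\<^bsub>presented_group V R\<^esub>"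
    by (intro bexI[where x = "word_class V R (inverse_word w)"])
      (auto simp: carrier_presented_group one_presented_group mult_presented_group
        word_class_eq_iff word_cong_inverse_word)
qed (auto simp: carrier_presented_group one_presented_group mult_presented_group)

lemma word_eval_presented_group:
  assumes "w \<in> words V"
  shows "word_eval (presented_group V R) (\<lambda>x. word_class V R [letter x]) w = word_class V R w"
  using assms
proof (induction w)
  case Nil
  then show ?case by (simp add: one_presented_group)
next
  case (Cons a w)
  interpret group "presented_group V R" by (rule group_presented_group)
  obtain x e where a: "a = (x, e)" by force
  have x: "x \<in> V" using Cons.prems a by simp
  have "inv\<^bsub>presented_group V R\<^esub> word_class V R [letter x] = word_class V R [(x, False)]"
    using x word_cong.cancel[of x V False R]
    by (intro inv_equality)
      (auto simp: mult_presented_group one_presented_group carrier_presented_group word_class_eq_iff)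
  then show ?case using Cons a x by (cases e) (auto simp: mult_presented_group)
qed

end

lemma relations_hold_presented_group:
  "relations_hold (presented_group V R) V (\<lambda>x. word_class V R [letter x]) R"
  by (auto simp: relations_hold_def word_eval_presented_group word_class_eq_iff intro: word_cong.rel)

lemma (in group_hom) hom_word_eval:
  "f \<in> V \<rightarrow> carrier G \<Longrightarrow> w \<in> words V \<Longrightarrow> h (word_eval G f w) = word_eval H (h \<circ> f) w"
  by (induction w) (auto simp: Pi_iff)

text \<open>A homomorphism from the word classes is fixed by its values on letters, so it has to be
  the evaluation of words. Its bijectivity then says that the generators exhaust \<open>G\<close>
  and that only congruent words agree.\<close>

proposition has_presentation_iff:
  "has_presentation G V r R \<longleftrightarrow> group G \<and> r \<in> V \<rightarrow> carrier G \<and>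
    carrier G = word_eval G r ` words V \<and>
    (\<forall>u \<in> words V. \<forall>v \<in> words V. word_eval G r u = word_eval G r v \<longleftrightarrow> (u, v) \<in> word_cong V R)"
    (is "?L \<longleftrightarrow> ?R")
proof -
  let ?P = "presented_group V R" and ?c = "\<lambda>x. word_class V R [letter x]"
  have c: "?c \<in> V \<rightarrow> carrier ?P" by (auto simp: carrier_presented_group)
  have ?R if ?L
  proof -
    from that obtain h where G: "group G" and h: "h \<in> iso ?P G" and hr: "\<forall>x\<in>V. h (?c x) = r x"
      by (auto simp: has_presentation_def)
    interpret group_hom ?P G h
      using h G group_presented_group by (auto simp: iso_def group_hom_def group_hom_axioms_def)
    have ev: "word_eval G r w = h (word_class V R w)" if w: "w \<in> words V" for w
    proof -
      have "word_eval G r w = word_eval G (h \<circ> ?c) w"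
        using w hr by (intro word_eval_cong[OF w]) auto
      also have "\<dots> = h (word_eval ?P ?c w)" using hom_word_eval[OF c w] by simp
      finally show ?thesis using w by (simp add: word_eval_presented_group)
    qed
    have bij: "bij_betw h (carrier ?P) (carrier G)" using h by (simp add: iso_def)
    have "r \<in> V \<rightarrow> carrier G" using hr c by (auto simp: Pi_iff simp flip: hr)
    moreover have "carrier G = word_eval G r ` words V"
      using bij ev by (auto simp: bij_betw_def carrier_presented_group image_image)
    moreover have "word_eval G r u = word_eval G r v \<longleftrightarrow> (u, v) \<in> word_cong V R"
      if "u \<in> words V" "v \<in> words V" for u v
    proof -
      have "inj_on h (carrier ?P)" using bij by (simp add: bij_betw_def)
      then have "h (word_class V R u) = h (word_class V R v) \<longleftrightarrow> word_class V R u = word_class V R v"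
        using that by (intro inj_on_eq_iff) (auto simp: carrier_presented_group)
      then show ?thesis using that ev by (simp add: word_class_eq_iff)
    qed
    ultimately show ?thesis using G by blast
  qed
  moreover have ?L if R: ?R
  proof -
    from R interpret G: group G by simp
    have r: "r \<in> V \<rightarrow> carrier G" and carrier_G: "carrier G = word_eval G r ` words V"
      and eq: "\<And>u v. u \<in> words V \<Longrightarrow> v \<in> words V \<Longrightarrow>
        word_eval G r u = word_eval G r v \<longleftrightarrow> (u, v) \<in> word_cong V R"
      using R by blast+
    \<comment> \<open>All words of a class have the same value by \<open>eq\<close>, so any
      representative will do.\<close>
    define h where "h C = word_eval G r (SOME w. w \<in> C)" for C
    have h: "h (word_class V R w) = word_eval G r w" if w: "w \<in> words V" for w
    proof -
      have "w \<in> word_class V R w" using w by (auto simp: word_class_def intro: word_cong.refl)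
      then have "(SOME w'. w' \<in> word_class V R w) \<in> word_class V R w" by (rule someI)
      then have "(w, SOME w'. w' \<in> word_class V R w) \<in> word_cong V R" by (simp add: word_class_def)
      from eq[OF w, THEN iffD2, OF _ this] word_cong_words[OF this] show ?thesis
        by (simp add: h_def)
    qed
    have "h \<in> hom ?P G"
      using r by (auto simp: hom_def carrier_presented_group mult_presented_group h G.word_eval_append)
    moreover have "bij_betw h (carrier ?P) (carrier G)"
      by (auto simp: bij_betw_def inj_on_def carrier_presented_group h image_image word_class_eq_iff
          carrier_G eq)
    moreover have "\<forall>x\<in>V. h (?c x) = r x" using r by (auto simp: h Pi_iff)
    ultimately show ?thesis using G.is_group unfolding has_presentation_def iso_def by blast
  qed
  ultimately show ?thesis by blast
qed

lemma has_presentationD: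
  assumes "has_presentation G V r R"
  shows "group G" and "r \<in> V \<rightarrow> carrier G" and "carrier G = word_eval G r ` words V"
    and "u \<in> words V \<Longrightarrow> v \<in> words V \<Longrightarrow>
      word_eval G r u = word_eval G r v \<longleftrightarrow> (u, v) \<in> word_cong V R"
  using assms unfolding has_presentation_iff by meson+

lemma has_presentation_presented_group:
  "has_presentation (presented_group V R) V (\<lambda>x. word_class V R [letter x]) R"
  by (auto simp: has_presentation_iff group_presented_group word_eval_presented_group
      word_class_eq_iff carrier_presented_group)

lemma has_presentation_relations_hold:
  assumes "has_presentation G V r R"
  shows "relations_hold G V r R"
  using has_presentationD(4)[OF assms] by (auto simp: relations_hold_def intro: word_cong.rel)

text \<open>If each of two systems of relations holds in the group presented by the other, the two
  congruences contain each other.\<close>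

lemma has_presentation_change_relations:
  assumes G: "has_presentation G V r R" and R': "relations_hold G V r R'"
    and R: "relations_hold (presented_group V R') V (\<lambda>x. word_class V R' [letter x]) R"
  shows "has_presentation G V r R'"
proof -
  interpret group G by (rule has_presentationD(1)[OF G])
  interpret P': group "presented_group V R'" by (rule group_presented_group)
  note r = has_presentationD(2)[OF G]
  have c: "(\<lambda>x. word_class V R' [letter x]) \<in> V \<rightarrow> carrier (presented_group V R')"
    by (auto simp: carrier_presented_group)
  have "(u, v) \<in> word_cong V R \<longleftrightarrow> (u, v) \<in> word_cong V R'" if "u \<in> words V" "v \<in> words V" for u v
  proof
    assume "(u, v) \<in> word_cong V R"
    from P'.word_eval_word_cong[OF c R this] show "(u, v) \<in> word_cong V R'"
      using that by (simp add: word_eval_presented_group word_class_eq_iff)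
  next
    assume "(u, v) \<in> word_cong V R'"
    from word_eval_word_cong[OF r R' this] show "(u, v) \<in> word_cong V R"
      using that by (simp add: has_presentationD(4)[OF G])
  qed
  then show ?thesis
    using has_presentationD[OF G] unfolding has_presentation_iff by metis
qed

text \<open>Von Dyck's theorem: congruent words have the same value in \<open>H\<close>, so an
  element may be mapped through any word representing it.\<close>

lemma has_presentation_hom:
  assumes G: "has_presentation G V r R" and H: "group H"
    and f: "f \<in> V \<rightarrow> carrier H" and R: "relations_hold H V f R"
  obtains h where "h \<in> hom G H" "\<And>w. w \<in> words V \<Longrightarrow> h (word_eval G r w) = word_eval H f w"
proof -
  interpret G: group G by (rule has_presentationD(1)[OF G])
  interpret H: group H by fact
  note r = has_presentationD(2)[OF G]
  define h where "h g = word_eval H f (SOME w. w \<in> words V \<and> word_eval G r w = g)" for g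
  have h: "h (word_eval G r w) = word_eval H f w" if w: "w \<in> words V" for w
  proof -
    define w' where "w' = (SOME w'. w' \<in> words V \<and> word_eval G r w' = word_eval G r w)"
    have "w' \<in> words V \<and> word_eval G r w' = word_eval G r w"
      unfolding w'_def by (rule someI[of "\<lambda>w'. w' \<in> words V \<and> word_eval G r w' = word_eval G r w" w])
        (simp add: w)
    then have "(w', w) \<in> word_cong V R" using has_presentationD(4)[OF G _ w] by blast
    then show ?thesis using H.word_eval_word_cong[OF f R] by (simp add: h_def w'_def)
  qed
  show ?thesis
  proof (rule that)
    show "h \<in> hom G H"
    proof (rule homI)
      fix x y assume "x \<in> carrier G" "y \<in> carrier G"
      then obtain u v where *: "u \<in> words V" "v \<in> words V" "x = word_eval G r u" "y = word_eval G r v"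
        unfolding has_presentationD(3)[OF G] by blast
      show "h x \<in> carrier H" using * h f by simp
      have "h (x \<otimes>\<^bsub>G\<^esub> y) = h (word_eval G r (u @ v))"
        using * G.word_eval_append[OF r] by simp
      also have "\<dots> = h x \<otimes>\<^bsub>H\<^esub> h y"
        using * H.word_eval_append[OF f] by (simp add: h)
      finally show "h (x \<otimes>\<^bsub>G\<^esub> y) = h x \<otimes>\<^bsub>H\<^esub> h y" .
    qed
  qed (rule h)
qed

section \<open>A common form of Artin-Tits and Coxeter presentations\<close>

definition square_relations :: "'x set \<Rightarrow> ('x word \<times> 'x word) set"
  where "square_relations Q = {([letter q, letter q], []) | q. q \<in> Q}"

text \<open>
  Artin-Tits groups (\<open>Q = {}\<close>), Coxeter groups (\<open>Q = V\<close>) and their free products are all of this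
  form, as long as \<open>Q\<close> is a union of classes of generators connected by odd labels.
\<close>

definition mixed_relations ::
    "'x set \<Rightarrow> ('x \<Rightarrow> 'x \<Rightarrow> enat) \<Rightarrow> 'x set \<Rightarrow> ('x word \<times> 'x word) set"
  where "mixed_relations V m Q = artin_tits_relations V m \<union> square_relations Q"

text \<open>The counterpart of proper labelling: a braid relation of odd length conjugates its two
  generators into each other, so a square relation at one forces it at the other.\<close>

definition odd_closed :: "'x set \<Rightarrow> ('x \<Rightarrow> 'x \<Rightarrow> enat) \<Rightarrow> 'x set \<Rightarrow> bool"
  where "odd_closed V m Q \<longleftrightarrow>
    (\<forall>i\<in>V. \<forall>j\<in>V. \<forall>k. i \<noteq> j \<and> m i j = enat k \<and> odd k \<longrightarrow> (i \<in> Q \<longleftrightarrow> j \<in> Q))"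

lemma alternating_in_words [simp]:
  "i \<in> V \<Longrightarrow> j \<in> V \<Longrightarrow> alternating i j n \<in> words V"
  by (induction n arbitrary: i j) auto

lemma map_alternating:
  "map (map_prod h id) (alternating i j n) = alternating (h i) (h j) n"
  by (induction n arbitrary: i j) auto

lemma relations_hold_artin_tits:
  "relations_hold G V f (artin_tits_relations V m) \<longleftrightarrow>
    (\<forall>i\<in>V. \<forall>j\<in>V. \<forall>k. i \<noteq> j \<longrightarrow> m i j = enat k \<longrightarrow>
      word_eval G f (alternating i j k) = word_eval G f (alternating j i k))"
  (is "?L \<longleftrightarrow> ?R")
proof (intro iffI ballI allI impI)
  fix i j k assume ?L "i \<in> V" "j \<in> V" "i \<noteq> j" "m i j = enat k"
  moreover from this have "(alternating i j k, alternating j i k) \<in> artin_tits_relations V m"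
    unfolding artin_tits_relations_def by blast
  ultimately show "word_eval G f (alternating i j k) = word_eval G f (alternating j i k)"
    unfolding relations_hold_def by fastforce
next
  assume ?R
  then show ?L by (auto simp: relations_hold_def artin_tits_relations_def)
qed

context group
begin

lemma relations_hold_square:
  assumes "f \<in> V \<rightarrow> carrier G" "Q \<subseteq> V"
  shows "relations_hold G V f (square_relations Q) \<longleftrightarrow> (\<forall>q\<in>Q. f q \<otimes> f q = \<one>)"
proof -
  have "word_eval G f [letter q, letter q] = f q \<otimes> f q" if "q \<in> Q" for q
    using assms that by (auto simp: Pi_iff)
  then show ?thesis
    using assms(2) by (fastforce simp: relations_hold_def square_relations_def)
qed

lemma word_eval_replicate:
  assumes "f i \<in> carrier G" "f j \<in> carrier G"
  shows "word_eval G f (concat (replicate k [letter i, letter j])) = (f i \<otimes> f j) [^] k"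
proof (induction k)
  case (Suc k)
  then show ?case
    using assms nat_pow_Suc2[of "f i \<otimes> f j" k] by (simp add: m_assoc del: nat_pow_Suc)
qed auto

text \<open>Peeling off the first letters \<open>i\<close> and \<open>j\<close> of the two words
  leaves the same quotient with \<open>i\<close> and \<open>j\<close> exchanged, enclosed between
  \<open>f i\<close> and the inverse of \<open>f j\<close>, which is \<open>f j\<close>.\<close>

lemma word_eval_alternating_mult_inv:
  assumes "f i \<in> carrier G" "f j \<in> carrier G" "f i \<otimes> f i = \<one>" "f j \<otimes> f j = \<one>"
  shows "word_eval G f (alternating i j k) \<otimes> inv (word_eval G f (alternating j i k)) =
    (f i \<otimes> f j) [^] k"
  using assms
proof (induction k arbitrary: i j)
  case (Suc k)
  have cl: "f \<in> {i, j} \<rightarrow> carrier G" using Suc.prems by auto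
  let ?u = "word_eval G f (alternating j i k)" and ?v = "word_eval G f (alternating i j k)"
  have uv: "?u \<in> carrier G" "?v \<in> carrier G"
    using cl by (auto intro: word_eval_closed)
  have inv: "inv (f j) = f j" using Suc.prems by (simp add: inv_equality)
  \<comment> \<open>Moves the outer \<open>f i\<close> to the right end, where it meets
    \<open>f j\<close> and completes one more factor.\<close>
  have comm: "f i \<otimes> (f j \<otimes> f i) [^] k = (f i \<otimes> f j) [^] k \<otimes> f i" for k :: nat
  proof (induction k)
    case (Suc k)
    have "f i \<otimes> (f j \<otimes> f i) [^] Suc k = (f i \<otimes> (f j \<otimes> f i) [^] k) \<otimes> (f j \<otimes> f i)"
      using Suc.prems \<open>f i \<in> carrier G\<close> \<open>f j \<in> carrier G\<close> by (simp add: m_assoc)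
    also have "\<dots> = (f i \<otimes> f j) [^] Suc k \<otimes> f i"
      unfolding Suc.IH using \<open>f i \<in> carrier G\<close> \<open>f j \<in> carrier G\<close> by (simp add: m_assoc)
    finally show ?case .
  qed (use Suc.prems in simp)
  have "word_eval G f (alternating i j (Suc k)) \<otimes> inv (word_eval G f (alternating j i (Suc k))) =
      f i \<otimes> (?u \<otimes> inv ?v) \<otimes> f j"
    using Suc.prems uv by (simp add: inv_mult_group inv m_assoc)
  also have "\<dots> = f i \<otimes> (f j \<otimes> f i) [^] k \<otimes> f j"
    using Suc by simp
  also have "\<dots> = (f i \<otimes> f j) [^] Suc k"
    using Suc.prems by (simp add: comm m_assoc)
  finally show ?case .
qed auto

lemma relations_hold_coxeter:
  assumes f: "f \<in> V \<rightarrow> carrier G"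
  shows "relations_hold G V f (coxeter_relations V m) \<longleftrightarrow>
    (\<forall>i\<in>V. \<forall>j\<in>V. \<forall>k. m i j = enat k \<longrightarrow> (f i \<otimes> f j) [^] k = \<one>)"
proof -
  have words: "concat (replicate k [letter i, letter j]) \<in> words V" if "i \<in> V" "j \<in> V" for i j k
    using that by (induction k) auto
  have "relations_hold G V f (coxeter_relations V m) \<longleftrightarrow>
    (\<forall>i\<in>V. \<forall>j\<in>V. \<forall>k. m i j = enat k \<longrightarrow>
      word_eval G f (concat (replicate k [letter i, letter j])) = \<one>)"
    (is "?L \<longleftrightarrow> ?R")
  proof (intro iffI ballI allI impI)
    fix i j k assume ?L "i \<in> V" "j \<in> V" "m i j = enat k"
    moreover from this have "(concat (replicate k [letter i, letter j]), []) \<in> coxeter_relations V m"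
      by (auto simp: coxeter_relations_def)
    ultimately show "word_eval G f (concat (replicate k [letter i, letter j])) = \<one>"
      using words by (fastforce simp: relations_hold_def)
  next
    assume ?R
    then show ?L by (auto simp: relations_hold_def coxeter_relations_def)
  qed
  then show ?thesis
    using f by (simp add: word_eval_replicate Pi_iff)
qed

text \<open>The diagonal label is 1, so the Coxeter relation for \<open>i = j\<close> is the square
  relation. Once the generators are involutions, the other powers are quotients of the two sides of
  braid relations.\<close>

lemma relations_hold_coxeter_iff:
  assumes f: "f \<in> V \<rightarrow> carrier G" and m: "coxeter_matrix V m"
  shows "relations_hold G V f (coxeter_relations V m) \<longleftrightarrow>
    relations_hold G V f (mixed_relations V m V)"
proof -
  have alt: "word_eval G f (alternating i j k) = word_eval G f (alternating j i k) \<longleftrightarrow>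
      (f i \<otimes> f j) [^] k = \<one>"
    if "i \<in> V" "j \<in> V" and sq: "\<forall>q\<in>V. f q \<otimes> f q = \<one>" for i j k
  proof -
    have "word_eval G f (alternating i j k) \<in> carrier G" "word_eval G f (alternating j i k) \<in> carrier G"
      using f that by (auto intro!: word_eval_closed)
    then have "word_eval G f (alternating i j k) = word_eval G f (alternating j i k) \<longleftrightarrow>
      word_eval G f (alternating i j k) \<otimes> inv (word_eval G f (alternating j i k)) = \<one>"
      by (metis inv_solve_right l_one one_closed)
    also have "\<dots> \<longleftrightarrow> (f i \<otimes> f j) [^] k = \<one>"
      using word_eval_alternating_mult_inv[of f i j k] that f by (auto simp: Pi_iff)
    finally show ?thesis .
  qed
  have one: "m i i = enat 1" if "i \<in> V" for i
    using that m by (auto simp: coxeter_matrix_def one_enat_def)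
  have diag: "(f i \<otimes> f i) [^] k = f i \<otimes> f i" if "i \<in> V" "m i i = enat k" for i k
  proof -
    have "f i \<in> carrier G" "k = 1" using that one f by (auto simp: Pi_iff)
    then show ?thesis by simp
  qed
  show ?thesis
    unfolding relations_hold_coxeter[OF f] mixed_relations_def relations_hold_Un relations_hold_artin_tits
      relations_hold_square[OF f order.refl]
  proof safe
    fix q assume *: "\<forall>i\<in>V. \<forall>j\<in>V. \<forall>k. m i j = enat k \<longrightarrow> (f i \<otimes> f j) [^] k = \<one>" and "q \<in> V"
    then have "(f q \<otimes> f q) [^] (1 :: nat) = \<one>" using one by blast
    then show "f q \<otimes> f q = \<one>" using diag[of q 1] one \<open>q \<in> V\<close> by simp
  next
    fix i j k
    assume *: "\<forall>i\<in>V. \<forall>j\<in>V. \<forall>k. m i j = enat k \<longrightarrow> (f i \<otimes> f j) [^] k = \<one>"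
      and ij: "i \<in> V" "j \<in> V" "m i j = enat k"
    have "\<forall>q\<in>V. f q \<otimes> f q = \<one>"
    proof
      fix q assume "q \<in> V"
      then have "(f q \<otimes> f q) [^] (1 :: nat) = \<one>" using one * by blast
      then show "f q \<otimes> f q = \<one>" using diag[of q 1] one \<open>q \<in> V\<close> by simp
    qed
    with alt[of i j k] * ij
    show "word_eval G f (alternating i j k) = word_eval G f (alternating j i k)" by blast
  next
    fix i j k
    assume "\<forall>i\<in>V. \<forall>j\<in>V. \<forall>k. i \<noteq> j \<longrightarrow> m i j = enat k \<longrightarrow>
        word_eval G f (alternating i j k) = word_eval G f (alternating j i k)"
      and "\<forall>q\<in>V. f q \<otimes> f q = \<one>" and "i \<in> V" "j \<in> V" "m i j = enat k"
    then show "(f i \<otimes> f j) [^] k = \<one>"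
      using alt[of i j k] diag[of i k] by (cases "i = j") auto
  qed
qed

end

lemma is_artin_tits_group_mixed:
  assumes "is_artin_tits_group A X s"
  obtains m where "finite X" "coxeter_matrix X m" "has_presentation A X s (mixed_relations X m {})"
  using assms by (auto simp: is_artin_tits_group_def mixed_relations_def square_relations_def)

lemma is_coxeter_group_mixed:
  assumes "is_coxeter_group A X s"
  obtains m where "finite X" "coxeter_matrix X m" "has_presentation A X s (mixed_relations X m X)"
proof -
  obtain m where m: "finite X" "coxeter_matrix X m"
    and A: "has_presentation A X s (coxeter_relations X m)"
    using assms by (auto simp: is_coxeter_group_def)
  interpret A: group A by (rule has_presentationD(1)[OF A])
  have "relations_hold A X s (mixed_relations X m X)"
    using A.relations_hold_coxeter_iff[OF has_presentationD(2)[OF A] m(2)]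
      has_presentation_relations_hold[OF A] by blast
  moreover have "relations_hold (presented_group X (mixed_relations X m X)) X
      (\<lambda>x. word_class X (mixed_relations X m X) [letter x]) (coxeter_relations X m)"
    using group.relations_hold_coxeter_iff[OF group_presented_group _ m(2)]
      has_presentationD(2)[OF has_presentation_presented_group[of X "mixed_relations X m X"]]
      relations_hold_presented_group
    by blast
  ultimately show ?thesis
    using has_presentation_change_relations[OF A] m that by blast
qed

lemma is_shephard_group_mixed:
  assumes V: "finite V" and m: "coxeter_matrix V m" and Q: "Q \<subseteq> V" "odd_closed V m Q"
    and G: "has_presentation G V r (mixed_relations V m Q)"
  shows "is_shephard_group G V r"
proof -
  \<comment> \<open>A Shephard graph encodes order two by a missing loop, absence of an order
    relation by a loop with label \<open>\<infinity>\<close>, and commutation by a missing edge.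
    Hence labels 2 become non-edges, and the labels that remain are at least 3.\<close>
  define E where "E i j = (if i = j then if i \<in> Q then None else Some \<infinity>
    else if m i j = 2 then None else Some (m i j))" for i j
  have ge3: "3 \<le> m i j" if "i \<in> V" "j \<in> V" "i \<noteq> j" "m i j \<noteq> 2" for i j
  proof -
    have "2 \<le> m i j" using m that by (auto simp: coxeter_matrix_def)
    then have "2 < m i j" using that(4) by simp
    then show ?thesis using ileI1 by fastforce
  qed
  have E_sym: "E a b = E b a" if "a \<in> V" "b \<in> V" for a b
  proof -
    have "a \<noteq> b \<Longrightarrow> m a b = m b a" using m that by (simp add: coxeter_matrix_def)
    then show ?thesis by (cases "a = b") (simp_all add: E_def)
  qed
  have E_ge3: "3 \<le> l" if "a \<in> V" "b \<in> V" "E a b = Some l" for a b l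
    using that ge3 by (auto simp: E_def split: if_splits)
  have E_odd: "E a a = E b b"
    if "a \<in> V" "b \<in> V" "a \<noteq> b" "E a b = Some (enat k)" "odd k" for a b k
  proof -
    have "m a b = enat k" using that(3,4) by (auto simp: E_def split: if_splits)
    then have "a \<in> Q \<longleftrightarrow> b \<in> Q" using Q(2) that unfolding odd_closed_def by blast
    then show ?thesis by (simp add: E_def)
  qed
  have "shephard_graph V E"
    unfolding shephard_graph_def using V E_sym E_ge3 E_odd by simp
  moreover have "shephard_relations V E = mixed_relations V m Q"
  proof -
    have two: "alternating a b 2 = [letter a, letter b]" for a b :: 'a
      by (simp add: numeral_2_eq_2)
    have e1: "{(replicate k (letter a), []) | a k. a \<in> V \<and> E a a = Some (enat k)} = {}"
      by (auto simp: E_def)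
    have e2: "{([letter a, letter a], []) | a. a \<in> V \<and> E a a = None} = square_relations Q"
      using Q(1) by (auto simp: E_def square_relations_def)
    have e3: "{(alternating a b k, alternating b a k) | a b k.
        a \<in> V \<and> b \<in> V \<and> a \<noteq> b \<and> E a b = Some (enat k)} \<union>
      {([letter a, letter b], [letter b, letter a]) | a b. a \<in> V \<and> b \<in> V \<and> a \<noteq> b \<and> E a b = None} =
      artin_tits_relations V m" (is "?S \<union> ?C = ?A")
    proof (rule subset_antisym)
      show "?S \<union> ?C \<subseteq> ?A"
      proof
        fix p assume "p \<in> ?S \<union> ?C"
        then show "p \<in> ?A"
        proof
          assume "p \<in> ?S"
          then obtain a b k where p: "p = (alternating a b k, alternating b a k)"
            "a \<in> V" "b \<in> V" "a \<noteq> b" "E a b = Some (enat k)" by blast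
          then have "m a b = enat k" by (auto simp: E_def split: if_splits)
          then show ?thesis using p unfolding artin_tits_relations_def by blast
        next
          assume "p \<in> ?C"
          then obtain a b where p: "p = ([letter a, letter b], [letter b, letter a])"
            "a \<in> V" "b \<in> V" "a \<noteq> b" "E a b = None" by blast
          then have "m a b = enat 2" by (auto simp: E_def numeral_eq_enat split: if_splits)
          moreover have "p = (alternating a b 2, alternating b a 2)" using p by (simp add: two)
          ultimately show ?thesis using p unfolding artin_tits_relations_def by blast
        qed
      qed
      show "?A \<subseteq> ?S \<union> ?C"
      proof
        fix p assume "p \<in> ?A"
        then obtain a b k where p: "p = (alternating a b k, alternating b a k)"
          "a \<in> V" "b \<in> V" "a \<noteq> b" "m a b = enat k"
          unfolding artin_tits_relations_def by blast
        show "p \<in> ?S \<union> ?C"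
        proof (cases "k = 2")
          case True
          then have "E a b = None" "p = ([letter a, letter b], [letter b, letter a])"
            using p by (simp_all add: E_def two numeral_eq_enat)
          then show ?thesis using p by blast
        next
          case False
          then have "E a b = Some (enat k)" using p by (simp add: E_def numeral_eq_enat)
          then show ?thesis using p by blast
        qed
      qed
    qed
    show ?thesis
      unfolding shephard_relations_def mixed_relations_def
      by (simp only: e1 e2 Un_assoc e3 Un_empty_left) (rule Un_commute)
  qed
  ultimately show ?thesis using G unfolding is_shephard_group_def by auto
qed

section \<open>Presentation of a free product\<close>

definition map_relations :: "('x \<Rightarrow> 'y) \<Rightarrow> ('x word \<times> 'x word) set \<Rightarrow> ('y word \<times> 'y word) set"
  where "map_relations h R =
    (\<lambda>(u, v). (map (map_prod h id) u, map (map_prod h id) v)) ` R"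

lemma map_in_words_Plus:
  "map (map_prod Inl id) u \<in> words (X <+> Y) \<longleftrightarrow> u \<in> words X"
  "map (map_prod Inr id) v \<in> words (X <+> Y) \<longleftrightarrow> v \<in> words Y"
proof -
  show "map (map_prod Inl id) u \<in> words (X <+> Y) \<longleftrightarrow> u \<in> words X" by (induction u) auto
  show "map (map_prod Inr id) v \<in> words (X <+> Y) \<longleftrightarrow> v \<in> words Y" by (induction v) auto
qed

lemma relations_hold_map_relations:
  "relations_hold G (X <+> Y) f (map_relations Inl R) \<longleftrightarrow> relations_hold G X (f \<circ> Inl) R"
  "relations_hold G (X <+> Y) f (map_relations Inr S) \<longleftrightarrow> relations_hold G Y (f \<circ> Inr) S"
  by (fastforce simp: relations_hold_def map_relations_def map_in_words_Plus word_eval_map)+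

lemma (in group_hom) relations_hold_hom:
  assumes "f \<in> V \<rightarrow> carrier G" "relations_hold G V f R"
  shows "relations_hold H V (h \<circ> f) R"
  using assms(2) by (auto simp: relations_hold_def simp flip: hom_word_eval[OF assms(1)])

lemma relations_hold_free_product:
  assumes "group H" "h \<in> hom A H" "k \<in> hom B H" "group A" "group B"
  shows "relations_hold H (carrier A <+> carrier B) (case_sum h k) (free_product_relations A B)"
proof -
  interpret H: group H by fact
  interpret h: group_hom A H h using assms by (simp add: group_hom_def group_hom_axioms_def)
  interpret k: group_hom B H k using assms by (simp add: group_hom_def group_hom_axioms_def)
  show ?thesis
    by (auto simp: relations_hold_def free_product_relations_def)
qed

text \<open>The relations of both factors hold in the free product. Conversely, the universal
  property gives a map back to the group presented by the joint relations, and since it sends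
  generators to generators, equal words in the free product are congruent.\<close>

proposition has_presentation_free_product:
  assumes A: "has_presentation A X s RA" and B: "has_presentation B Y t RB"
  shows "has_presentation (free_product A B) (X <+> Y) (free_product_family A B s t)
    (map_relations Inl RA \<union> map_relations Inr RB)" (is "has_presentation ?F ?I ?r ?R")
proof -
  interpret A: group A by (rule has_presentationD(1)[OF A])
  interpret B: group B by (rule has_presentationD(1)[OF B])
  note s = has_presentationD(2)[OF A] and t = has_presentationD(2)[OF B]
  let ?C = "carrier A <+> carrier B" and ?RF = "free_product_relations A B"
  let ?cF = "\<lambda>z. word_class ?C ?RF [letter z]"
  have F: "has_presentation ?F ?C ?cF ?RF"
    unfolding free_product_def by (rule has_presentation_presented_group)
  interpret F: group ?F by (rule has_presentationD(1)[OF F])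
  note cF = has_presentationD(2)[OF F]
  have hold: "relations_hold ?F ?C ?cF ?RF" by (rule has_presentation_relations_hold[OF F])
  have inl: "free_product_inl A B \<in> hom A ?F"
  proof (rule homI)
    fix x y assume xy: "x \<in> carrier A" "y \<in> carrier A"
    then have "([letter (Inl x), letter (Inl y)], [letter (Inl (x \<otimes>\<^bsub>A\<^esub> y))]) \<in> ?RF"
      by (auto simp: free_product_relations_def)
    then have "word_eval ?F ?cF [letter (Inl x), letter (Inl y)] =
        word_eval ?F ?cF [letter (Inl (x \<otimes>\<^bsub>A\<^esub> y))]"
      using hold xy unfolding relations_hold_def by fastforce
    moreover have "?cF (Inl z) \<in> carrier ?F" if "z \<in> carrier A" for z using cF that by auto
    ultimately show "free_product_inl A B (x \<otimes>\<^bsub>A\<^esub> y) =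
        free_product_inl A B x \<otimes>\<^bsub>?F\<^esub> free_product_inl A B y"
      using xy by (simp add: free_product_inl_def)
  qed (use cF in \<open>auto simp: free_product_inl_def\<close>)
  have inr: "free_product_inr A B \<in> hom B ?F"
  proof (rule homI)
    fix x y assume xy: "x \<in> carrier B" "y \<in> carrier B"
    then have "([letter (Inr x), letter (Inr y)], [letter (Inr (x \<otimes>\<^bsub>B\<^esub> y))]) \<in> ?RF"
      by (auto simp: free_product_relations_def)
    then have "word_eval ?F ?cF [letter (Inr x), letter (Inr y)] =
        word_eval ?F ?cF [letter (Inr (x \<otimes>\<^bsub>B\<^esub> y))]"
      using hold xy unfolding relations_hold_def by fastforce
    moreover have "?cF (Inr z) \<in> carrier ?F" if "z \<in> carrier B" for z using cF that by auto
    ultimately show "free_product_inr A B (x \<otimes>\<^bsub>B\<^esub> y) =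
        free_product_inr A B x \<otimes>\<^bsub>?F\<^esub> free_product_inr A B y"
      using xy by (simp add: free_product_inr_def)
  qed (use cF in \<open>auto simp: free_product_inr_def\<close>)
  interpret inl: group_hom A ?F "free_product_inl A B"
    using inl by (simp add: group_hom_def group_hom_axioms_def)
  interpret inr: group_hom B ?F "free_product_inr A B"
    using inr by (simp add: group_hom_def group_hom_axioms_def)
  have rl: "?r \<circ> Inl = free_product_inl A B \<circ> s" and rr: "?r \<circ> Inr = free_product_inr A B \<circ> t"
    by (auto simp: free_product_family_def)
  have r: "?r \<in> ?I \<rightarrow> carrier ?F"
    using s t by (auto simp: free_product_family_def Pi_iff)
  have R: "relations_hold ?F ?I ?r ?R"
    using inl.relations_hold_hom[OF s] has_presentation_relations_hold[OF A]
      inr.relations_hold_hom[OF t] has_presentation_relations_hold[OF B]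
    by (simp add: relations_hold_map_relations rl rr)
  \<comment> \<open>The free product is defined with all elements of \<open>A\<close> and
    \<open>B\<close> as letters; each such letter is a word in the images of \<open>s\<close> or
    \<open>t\<close>.\<close>
  have carrier_F: "carrier ?F = word_eval ?F ?r ` words ?I"
  proof -
    have sub: "subgroup (generate ?F (?r ` ?I)) ?F"
      using r by (intro F.generate_is_subgroup) auto
    have gen: "generate ?F (?r ` ?I) = word_eval ?F ?r ` words ?I"
      by (rule F.generate_eq_word_eval[OF r])
    have "?cF ` ?C \<subseteq> generate ?F (?r ` ?I)"
    proof safe
      fix x assume "x \<in> carrier A"
      then obtain u where u: "u \<in> words X" "x = word_eval A s u"
        unfolding has_presentationD(3)[OF A] by blast
      have "?cF (Inl x) = word_eval ?F ?r (map (map_prod Inl id) u)"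
        using inl.hom_word_eval[OF s u(1)] u(2) by (simp add: word_eval_map rl free_product_inl_def)
      then show "?cF (Inl x) \<in> generate ?F (?r ` ?I)"
        unfolding gen using u by (simp add: map_in_words_Plus)
    next
      fix x assume "x \<in> carrier B"
      then obtain u where u: "u \<in> words Y" "x = word_eval B t u"
        unfolding has_presentationD(3)[OF B] by blast
      have "?cF (Inr x) = word_eval ?F ?r (map (map_prod Inr id) u)"
        using inr.hom_word_eval[OF t u(1)] u(2) by (simp add: word_eval_map rr free_product_inr_def)
      then show "?cF (Inr x) \<in> generate ?F (?r ` ?I)"
        unfolding gen using u by (simp add: map_in_words_Plus)
    qed
    then have "generate ?F (?cF ` ?C) \<subseteq> generate ?F (?r ` ?I)"
      using sub by (rule F.generate_subgroup_incl)
    then have "carrier ?F \<subseteq> generate ?F (?r ` ?I)"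
      unfolding F.generate_eq_word_eval[OF cF] has_presentationD(3)[OF F, symmetric] .
    then show ?thesis
      using F.generate_incl[of "?r ` ?I"] r gen by blast
  qed
  \<comment> \<open>The map back is assembled in two stages: \<open>h\<close> and \<open>k\<close>
    from the presentations of the factors, then \<open>g\<close> from the defining presentation of
    the free product.\<close>
  let ?P = "presented_group ?I ?R" and ?c = "\<lambda>z. word_class ?I ?R [letter z]"
  have P: "has_presentation ?P ?I ?c ?R" by (rule has_presentation_presented_group)
  interpret P: group ?P by (rule has_presentationD(1)[OF P])
  note c = has_presentationD(2)[OF P]
  have holdP: "relations_hold ?P X (?c \<circ> Inl) RA" "relations_hold ?P Y (?c \<circ> Inr) RB"
    using has_presentation_relations_hold[OF P] by (simp_all add: relations_hold_map_relations)
  have cl: "?c \<circ> Inl \<in> X \<rightarrow> carrier ?P" "?c \<circ> Inr \<in> Y \<rightarrow> carrier ?P"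
    using c by auto
  obtain h where h: "h \<in> hom A ?P" "\<And>w. w \<in> words X \<Longrightarrow> h (word_eval A s w) = word_eval ?P (?c \<circ> Inl) w"
    using has_presentation_hom[OF A P.is_group cl(1) holdP(1)] by blast
  obtain k where k: "k \<in> hom B ?P" "\<And>w. w \<in> words Y \<Longrightarrow> k (word_eval B t w) = word_eval ?P (?c \<circ> Inr) w"
    using has_presentation_hom[OF B P.is_group cl(2) holdP(2)] by blast
  have hs: "h (s i) = ?c (Inl i)" if "i \<in> X" for i
    using h(2)[of "[letter i]"] that s cl(1) by (auto simp: Pi_iff)
  have kt: "k (t i) = ?c (Inr i)" if "i \<in> Y" for i
    using k(2)[of "[letter i]"] that t cl(2) by (auto simp: Pi_iff)
  have hk: "case_sum h k \<in> ?C \<rightarrow> carrier ?P"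
    using h(1) k(1) by (auto simp: hom_def Pi_iff)
  obtain g where g: "g \<in> hom ?F ?P" "\<And>w. w \<in> words ?C \<Longrightarrow> g (word_eval ?F ?cF w) = word_eval ?P (case_sum h k) w"
    using has_presentation_hom[OF F P.is_group hk
        relations_hold_free_product[OF P.is_group h(1) k(1) A.is_group B.is_group]] by blast
  interpret g: group_hom ?F ?P g
    using g(1) by (simp add: group_hom_def group_hom_axioms_def)
  have gr: "g (?r z) = ?c z" if "z \<in> ?I" for z
  proof -
    have g_cF: "g (?cF z') = case_sum h k z'" if "z' \<in> ?C" for z'
      using g(2)[of "[letter z']"] that cF hk by (auto simp: Pi_iff)
    have "g (free_product_inl A B x) = h x" if "x \<in> carrier A" for x
      using g_cF[of "Inl x"] that by (auto simp: free_product_inl_def)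
    moreover have "g (free_product_inr A B x) = k x" if "x \<in> carrier B" for x
      using g_cF[of "Inr x"] that by (auto simp: free_product_inr_def)
    ultimately show ?thesis
      using that s t hs kt by (auto simp: free_product_family_def Pi_iff)
  qed
  have "word_eval ?F ?r u = word_eval ?F ?r v \<longleftrightarrow> (u, v) \<in> word_cong ?I ?R"
    if "u \<in> words ?I" "v \<in> words ?I" for u v
  proof
    assume eq: "word_eval ?F ?r u = word_eval ?F ?r v"
    have "word_eval ?P ?c w = g (word_eval ?F ?r w)" if "w \<in> words ?I" for w
      unfolding g.hom_word_eval[OF r that] using gr by (intro word_eval_cong[OF that]) simp
    then have "word_eval ?P ?c u = word_eval ?P ?c v" using that eq by simp
    then show "(u, v) \<in> word_cong ?I ?R" using that has_presentationD(4)[OF P] by blast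
  qed (rule F.word_eval_word_cong[OF r R])
  then show ?thesis
    using F.is_group r carrier_F unfolding has_presentation_iff by blast
qed

section \<open>Labels and relations of a free product\<close>

fun sum_matrix :: "('a \<Rightarrow> 'a \<Rightarrow> enat) \<Rightarrow> ('b \<Rightarrow> 'b \<Rightarrow> enat) \<Rightarrow> 'a + 'b \<Rightarrow> 'a + 'b \<Rightarrow> enat"
  where
    "sum_matrix m n (Inl i) (Inl j) = m i j"
  | "sum_matrix m n (Inr i) (Inr j) = n i j"
  | "sum_matrix m n _ _ = \<infinity>"

lemma coxeter_matrix_sum:
  "coxeter_matrix X m \<Longrightarrow> coxeter_matrix Y n \<Longrightarrow> coxeter_matrix (X <+> Y) (sum_matrix m n)"
  by (auto simp: coxeter_matrix_def)

lemma odd_closed_sum: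
  "odd_closed X m Q \<Longrightarrow> odd_closed Y n Q' \<Longrightarrow> odd_closed (X <+> Y) (sum_matrix m n) (Q <+> Q')"
  by (fastforce simp: odd_closed_def)

lemma map_relations_mixed:
  "map_relations Inl (mixed_relations X m Q) \<union> map_relations Inr (mixed_relations Y n Q') =
    mixed_relations (X <+> Y) (sum_matrix m n) (Q <+> Q')"
proof -
  have "artin_tits_relations (X <+> Y) (sum_matrix m n) =
    map_relations Inl (artin_tits_relations X m) \<union> map_relations Inr (artin_tits_relations Y n)"
    (is "?L = ?R")
  proof (intro subset_antisym subsetI)
    fix p assume "p \<in> ?L"
    then show "p \<in> ?R"
      by (auto simp: artin_tits_relations_def map_relations_def image_iff map_alternating
          simp flip: map_alternating) (metis map_alternating)+
  next
    fix p assume "p \<in> ?R"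
    then show "p \<in> ?L"
      by (auto simp: artin_tits_relations_def map_relations_def map_alternating) 
        (metis InlI InrI sum.inject sum_matrix.simps)+
  qed
  moreover have "square_relations (Q <+> Q') =
    map_relations Inl (square_relations Q) \<union> map_relations Inr (square_relations Q')"
    by (force simp: square_relations_def map_relations_def)
  ultimately show ?thesis
    by (auto simp: mixed_relations_def map_relations_def)
qed

lemma artin_tits_or_coxeter_mixed:
  assumes "is_artin_tits_group A X s \<or> is_coxeter_group A X s"
  obtains m Q where "finite X" "coxeter_matrix X m" "Q \<subseteq> X" "odd_closed X m Q"
    "has_presentation A X s (mixed_relations X m Q)"
  using assms
proof
  assume "is_artin_tits_group A X s"
  then show ?thesis
    using that[where Q = "{}"] by (elim is_artin_tits_group_mixed) (auto simp: odd_closed_def)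
next
  assume "is_coxeter_group A X s"
  then show ?thesis
    using that[where Q = X] by (elim is_coxeter_group_mixed) (auto simp: odd_closed_def)
qed

section \<open>The geometric representation\<close>

definition bijections :: "('a \<Rightarrow> 'a) monoid"
  where "bijections = \<lparr>carrier = {f. bij f}, mult = (\<circ>), one = id\<rparr>"

lemma bijections_simps [simp]:
  "f \<in> carrier bijections \<longleftrightarrow> bij f" "f \<otimes>\<^bsub>bijections\<^esub> g = f \<circ> g" "\<one>\<^bsub>bijections\<^esub> = id"
  by (simp_all add: bijections_def)

lemma group_bijections: "group bijections"
proof (rule groupI)
  fix f :: "'a \<Rightarrow> 'a" assume "f \<in> carrier bijections"
  then show "\<exists>g\<in>carrier bijections. g \<otimes>\<^bsub>bijections\<^esub> f = \<one>\<^bsub>bijections\<^esub>"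
    by (intro bexI[where x = "inv_into UNIV f"]) (auto simp: bij_imp_bij_inv bij_is_inj)
qed (auto simp: bij_comp comp_assoc)

lemma bijections_pow: "f [^]\<^bsub>bijections\<^esub> (n :: nat) = f ^^ n"
proof (induction n)
  case (Suc n)
  then show ?case
    using funpow_Suc_right[of n f] by (simp add: nat_pow_def)
qed (simp add: nat_pow_def)

text \<open>The bilinear form of the Tits representation on simple roots. The diagonal label 1
  yields \<open>- cos pi = 1\<close>, and \<open>- 1\<close> is the limit of the finite values as
  the label grows.\<close>

definition coxeter_form :: "('x \<Rightarrow> 'x \<Rightarrow> enat) \<Rightarrow> 'x \<Rightarrow> 'x \<Rightarrow> real"
  where "coxeter_form m i j = (case m i j of enat k \<Rightarrow> - cos (pi / k) | \<infinity> \<Rightarrow> - 1)"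

text \<open>
  This is the dual of the usual geometric representation: \<open>f k\<close> is the value of a linear form at the
  simple root of \<open>k\<close>.
\<close>

definition simple_reflection :: "('x \<Rightarrow> 'x \<Rightarrow> enat) \<Rightarrow> 'x \<Rightarrow> ('x \<Rightarrow> real) \<Rightarrow> 'x \<Rightarrow> real"
  where "simple_reflection m i f = (\<lambda>k. f k - 2 * coxeter_form m i k * f i)"

context
  fixes V :: "'x set" and m :: "'x \<Rightarrow> 'x \<Rightarrow> enat"
  assumes m: "coxeter_matrix V m"
begin

lemma coxeter_form_diag: "i \<in> V \<Longrightarrow> coxeter_form m i i = 1"
  using m by (simp add: coxeter_matrix_def coxeter_form_def one_enat_def)

lemma coxeter_form_sym: "i \<in> V \<Longrightarrow> j \<in> V \<Longrightarrow> coxeter_form m i j = coxeter_form m j i"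
  using m by (cases "i = j") (simp_all add: coxeter_matrix_def coxeter_form_def)

lemma simple_reflection_involution:
  "i \<in> V \<Longrightarrow> simple_reflection m i (simple_reflection m i f) = f"
  by (auto simp: simple_reflection_def coxeter_form_diag algebra_simps)

lemma bij_simple_reflection: "i \<in> V \<Longrightarrow> bij (simple_reflection m i)"
  by (rule involuntory_imp_bij) (rule simple_reflection_involution)

lemma inv_simple_reflection:
  assumes "i \<in> V"
  shows "inv\<^bsub>bijections\<^esub> simple_reflection m i = simple_reflection m i"
  using assms by (intro group.inv_equality[OF group_bijections])
    (auto simp: bij_simple_reflection simple_reflection_involution)

text \<open>The coefficients of \<open>coxeter_form m i\<close> and \<open>coxeter_form m j\<close>
  are neighbouring values of a solution \<open>h\<close> of a linear recurrence of order two. Each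
  reflection replaces one of them by the next value on the far side of the other, so the product of
  both shifts the argument by \<open>2 * \<theta>\<close>.\<close>

lemma simple_reflection_rotation:
  assumes ij: "i \<in> V" "j \<in> V" and f': "f' i = 0" "f' j = 0"
    and h: "\<And>\<phi>. h (\<phi> + \<theta>) + h (\<phi> - \<theta>) = - 2 * coxeter_form m i j * h \<phi>"
  defines "F \<equiv> \<lambda>\<phi> k. f' k + 2 * coxeter_form m i k * h \<phi> + 2 * coxeter_form m j k * h (\<phi> + \<theta>)"
  shows "((simple_reflection m i \<circ> simple_reflection m j) ^^ n) (F \<phi>) = F (\<phi> - 2 * real n * \<theta>)"
proof (induction n arbitrary: \<phi>)
  case (Suc n)
  let ?b = "coxeter_form m i j"
  have b: "coxeter_form m j i = ?b" "coxeter_form m i i = 1" "coxeter_form m j j = 1"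
    using ij coxeter_form_sym coxeter_form_diag by auto
  have h1: "h (\<phi> + \<theta>) = - 2 * ?b * h \<phi> - h (\<phi> - \<theta>)" using h[of \<phi>] by linarith
  have h2: "h \<phi> = - 2 * ?b * h (\<phi> - \<theta>) - h (\<phi> - 2 * \<theta>)"
    using h[of "\<phi> - \<theta>"] by (simp add: algebra_simps)
  have "simple_reflection m j (F \<phi>) =
      (\<lambda>k. f' k + 2 * coxeter_form m i k * h \<phi> + 2 * coxeter_form m j k * h (\<phi> - \<theta>))" (is "_ = ?F'")
    by (rule ext) (simp add: simple_reflection_def F_def f' b h1 algebra_simps)
  moreover have "simple_reflection m i ?F' = F (\<phi> - 2 * \<theta>)"
  proof (rule ext)
    fix k
    have "\<phi> - 2 * \<theta> + \<theta> = \<phi> - \<theta>" by simp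
    then show "simple_reflection m i ?F' k = F (\<phi> - 2 * \<theta>) k"
      by (simp add: simple_reflection_def F_def f' b h2 algebra_simps)
  qed
  ultimately have "(simple_reflection m i \<circ> simple_reflection m j) (F \<phi>) = F (\<phi> - 2 * \<theta>)"
    by simp
  then show ?case
    using Suc.IH[of "\<phi> - 2 * \<theta>"] by (simp only: funpow_Suc_right comp_apply) (simp add: algebra_simps)
qed simp

lemma simple_reflection_order:
  assumes ij: "i \<in> V" "j \<in> V" "m i j = enat k"
  shows "(simple_reflection m i \<circ> simple_reflection m j) ^^ k = id"
proof (cases "i = j")
  case True
  then have "k = 1" using ij m by (auto simp: coxeter_matrix_def one_enat_def)
  then show ?thesis using True ij by (auto simp: simple_reflection_involution)
next
  case False
  define \<theta> where "\<theta> = pi / k"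
  have "2 \<le> m i j" using False ij(1,2) m unfolding coxeter_matrix_def by blast
  then have k: "2 \<le> k" using ij(3) by simp
  then have "0 < \<theta>" "\<theta> < pi" by (auto simp: \<theta>_def field_simps)
  then have sin: "sin \<theta> > 0" by (rule sin_gt_zero)
  have form: "coxeter_form m i j = - cos \<theta>" using ij(3) by (simp add: coxeter_form_def \<theta>_def)
  have b: "coxeter_form m j i = - cos \<theta>" "coxeter_form m i i = 1" "coxeter_form m j j = 1"
    using ij coxeter_form_sym[of i j] coxeter_form_diag form by auto
  show ?thesis
  proof (rule ext)
    fix f :: "'x \<Rightarrow> real"
    define c where "c = cos \<theta>"
    \<comment> \<open>The Gram matrix of the roots \<open>i\<close> and \<open>j\<close> has
      diagonal 1 and off-diagonal \<open>- c\<close>. Its determinant \<open>1 - c ^ 2\<close> is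
      nonzero, so Cramer's rule yields the coefficients \<open>l\<close> and \<open>n\<close> that
      leave \<open>f'\<close> vanishing at \<open>i\<close> and \<open>j\<close>.\<close>
    have det: "sin \<theta> ^ 2 = 1 - c ^ 2" by (simp add: c_def sin_squared_eq)
    have c1: "1 - c ^ 2 \<noteq> 0" using det sin by (metis less_irrefl zero_eq_power2)
    define l where "l = (f i + c * f j) / (2 * (1 - c ^ 2))"
    define n where "n = (f j + c * f i) / (2 * (1 - c ^ 2))"
    have "l - c * n = (f i - c ^ 2 * f i) / (2 * (1 - c ^ 2))"
      by (simp add: l_def n_def diff_divide_distrib add_divide_distrib algebra_simps power2_eq_square)
    also have "\<dots> = f i / 2" using c1 by (simp add: field_simps)
    finally have li: "2 * l - 2 * c * n = f i" by simp
    have "n - c * l = (f j - c ^ 2 * f j) / (2 * (1 - c ^ 2))"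
      by (simp add: l_def n_def diff_divide_distrib add_divide_distrib algebra_simps power2_eq_square)
    also have "\<dots> = f j / 2" using c1 by (simp add: field_simps)
    finally have nj: "2 * n - 2 * c * l = f j" by simp
    \<comment> \<open>The sinusoid with value \<open>l\<close> at 0 and \<open>n\<close> at
      \<open>\<theta>\<close>.\<close>
    define h where "h \<phi> = (n - l * c) / sin \<theta> * sin \<phi> + l * cos \<phi>" for \<phi>
    have h: "h (\<phi> + \<theta>) + h (\<phi> - \<theta>) = - 2 * coxeter_form m i j * h \<phi>" for \<phi>
      by (simp add: h_def form sin_add sin_diff cos_add cos_diff algebra_simps)
    have h0: "h 0 = l" "h \<theta> = n" using sin by (simp_all add: h_def c_def)
    define f' where "f' k = f k - 2 * coxeter_form m i k * l - 2 * coxeter_form m j k * n" for k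
    have f': "f' i = 0" "f' j = 0"
      using li nj by (simp_all add: f'_def form b c_def)
    \<comment> \<open>\<open>k\<close> rotations shift the argument by
      \<open>2 * k * \<theta> = 2 * pi\<close>.\<close>
    have per: "h (\<phi> - 2 * real k * \<theta>) = h \<phi>" for \<phi>
    proof -
      have eq: "\<phi> - 2 * real k * \<theta> = \<phi> - 2 * pi" using k by (simp add: \<theta>_def)
      show ?thesis unfolding h_def eq by (simp add: sin_diff cos_diff)
    qed
    have f: "f = (\<lambda>x. f' x + 2 * coxeter_form m i x * h 0 + 2 * coxeter_form m j x * h (0 + \<theta>))"
      by (simp add: f'_def h0)
    have "((simple_reflection m i \<circ> simple_reflection m j) ^^ k) f =
        (\<lambda>x. f' x + 2 * coxeter_form m i x * h (0 - 2 * real k * \<theta>) +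
          2 * coxeter_form m j x * h (0 - 2 * real k * \<theta> + \<theta>))"
      by (subst f) (rule simple_reflection_rotation[OF ij(1,2) f' h])
    also have "\<dots> = f"
    proof -
      have eq: "0 - 2 * real k * \<theta> + \<theta> = \<theta> - 2 * real k * \<theta>" by simp
      show ?thesis unfolding eq per by (simp add: f'_def h0)
    qed
    finally show "((simple_reflection m i \<circ> simple_reflection m j) ^^ k) f = id f" by simp
  qed
qed

text \<open>Only the values at \<open>i\<close> and \<open>j\<close> are followed, so a degenerate
  form is covered too. With the sign at \<open>i\<close> reversed they are consecutive terms of one
  recurrence, solved by \<open>sin\<close> for a finite label and by the identity for an infinite
  one.\<close>

lemma simple_reflection_coordinates:
  assumes ij: "i \<in> V" "j \<in> V"
    and g: "\<And>\<phi>. g (\<phi> + 2 * d) = - 2 * coxeter_form m i j * g (\<phi> + d) - g \<phi>"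
    and f: "f i = - g \<phi>" "f j = g (\<phi> + d)"
  shows "((simple_reflection m i \<circ> simple_reflection m j) ^^ n) f i = - g (\<phi> + 2 * real n * d) \<and>
    ((simple_reflection m i \<circ> simple_reflection m j) ^^ n) f j = g (\<phi> + 2 * real n * d + d)"
  using f
proof (induction n arbitrary: f \<phi>)
  case (Suc n)
  let ?b = "coxeter_form m i j"
  let ?f = "(simple_reflection m i \<circ> simple_reflection m j) f"
  have b: "coxeter_form m j i = ?b" "coxeter_form m i i = 1" "coxeter_form m j j = 1"
    using ij coxeter_form_sym coxeter_form_diag by auto
  have g1: "g (\<phi> + 2 * d) = - 2 * ?b * g (\<phi> + d) - g \<phi>"
    and g2: "g (\<phi> + 3 * d) = - 2 * ?b * g (\<phi> + 2 * d) - g (\<phi> + d)"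
    using g[of \<phi>] g[of "\<phi> + d"] by (simp_all add: algebra_simps)
  have "f i - 2 * ?b * f j = g (\<phi> + 2 * d)" using g1 Suc.prems by simp
  moreover have "?f i = - (f i - 2 * ?b * f j)" "?f j = - f j - 2 * ?b * (f i - 2 * ?b * f j)"
    by (simp_all add: simple_reflection_def b)
  ultimately have "?f i = - g (\<phi> + 2 * d)" "?f j = g (\<phi> + 2 * d + d)"
    using g2 Suc.prems by (simp_all add: algebra_simps)
  from Suc.IH[OF this] show ?case
    by (simp only: funpow_Suc_right comp_apply) (simp add: algebra_simps)
qed simp

lemma simple_reflection_order_dvd:
  assumes ij: "i \<in> V" "j \<in> V" "i \<noteq> j"
    and n: "(simple_reflection m i \<circ> simple_reflection m j) ^^ n = id" "n > 0"
  shows "\<exists>k. m i j = enat k \<and> k dvd n"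
proof (cases "m i j")
  case (enat k)
  define \<theta> where "\<theta> = pi / k"
  have "2 \<le> m i j" using ij m by (simp add: coxeter_matrix_def)
  then have k: "2 \<le> k" using enat by simp
  then have "0 < \<theta>" "\<theta> < pi" by (auto simp: \<theta>_def field_simps)
  then have sin: "sin \<theta> > 0" by (rule sin_gt_zero)
  have form: "coxeter_form m i j = - cos \<theta>" using enat by (simp add: coxeter_form_def \<theta>_def)
  have rec: "sin (\<phi> + 2 * \<theta>) = - 2 * coxeter_form m i j * sin (\<phi> + \<theta>) - sin \<phi>" for \<phi>
  proof -
    have "sin (\<phi> + \<theta> + \<theta>) + sin (\<phi> + \<theta> - \<theta>) = 2 * cos \<theta> * sin (\<phi> + \<theta>)"
      by (simp only: sin_add[of "\<phi> + \<theta>" \<theta>] sin_diff[of "\<phi> + \<theta>" \<theta>]) simp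
    then show ?thesis by (simp add: form algebra_simps)
  qed
  \<comment> \<open>Start at \<open>\<phi> = 0\<close> with \<open>g = sin\<close> and
    \<open>d = \<theta>\<close>: the values are \<open>- sin 0\<close> at \<open>i\<close> and
    \<open>sin \<theta>\<close> at \<open>j\<close>. If the power is the identity, the angle
    \<open>2 * n * \<theta>\<close> has to be a multiple of \<open>2 * pi\<close>.\<close>
  have "((simple_reflection m i \<circ> simple_reflection m j) ^^ n) ((\<lambda>_. 0)(j := sin \<theta>)) i =
      - sin (0 + 2 * real n * \<theta>) \<and>
    ((simple_reflection m i \<circ> simple_reflection m j) ^^ n) ((\<lambda>_. 0)(j := sin \<theta>)) j =
      sin (0 + 2 * real n * \<theta> + \<theta>)"
    using ij by (intro simple_reflection_coordinates rec) auto
  then have "sin (2 * real n * \<theta>) = 0" "sin (2 * real n * \<theta> + \<theta>) = sin \<theta>"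
    using n(1) ij(3) by auto
  then have "cos (2 * real n * \<theta>) * sin \<theta> = sin \<theta>" by (simp add: sin_add)
  then have "cos (2 * real n * \<theta>) = 1" using sin by simp
  then obtain z :: int where "2 * real n * \<theta> = of_int z * 2 * pi"
    using cos_one_2pi_int[of "2 * real n * \<theta>"] by auto
  then have "real n = of_int z * real k" using k by (simp add: \<theta>_def field_simps)
  then have "int n = z * int k" by (metis of_int_eq_iff of_int_mult of_int_of_nat_eq)
  then have "int k dvd int n" by simp
  then show ?thesis using enat by simp
next
  case infinity
  have form: "coxeter_form m i j = - 1" using infinity by (simp add: coxeter_form_def)
  \<comment> \<open>Here \<open>g\<close> is the identity and \<open>d = 1\<close>: the value at
    \<open>i\<close> drifts from 0 to \<open>- 2 * n\<close>, so the order is infinite.\<close>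
  have "((simple_reflection m i \<circ> simple_reflection m j) ^^ n) ((\<lambda>_. 0)(j := 1)) i =
      - (0 + 2 * real n * 1) \<and>
    ((simple_reflection m i \<circ> simple_reflection m j) ^^ n) ((\<lambda>_. 0)(j := 1)) j =
      0 + 2 * real n * 1 + 1"
    using ij by (intro simple_reflection_coordinates) (auto simp: form)
  then show ?thesis using n ij(3) by simp
qed

lemma relations_hold_simple_reflection:
  "relations_hold bijections V (simple_reflection m) (mixed_relations V m V)"
proof -
  interpret B: group "bijections :: (('x \<Rightarrow> real) \<Rightarrow> 'x \<Rightarrow> real) monoid" by (rule group_bijections)
  have f: "simple_reflection m \<in> V \<rightarrow> carrier bijections"
    by (simp add: bij_simple_reflection)
  show ?thesis
    unfolding B.relations_hold_coxeter_iff[OF f m, symmetric] B.relations_hold_coxeter[OF f]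
    by (simp add: bijections_pow simple_reflection_order)
qed

text \<open>The gain of the dual representation: the reflection of \<open>j\<close> changes
  \<open>f\<close> by a multiple of \<open>f j\<close>, so a form vanishing on the simple roots of
  \<open>J\<close> is fixed.\<close>

lemma word_eval_simple_reflection_fixes:
  assumes "w \<in> words J" "J \<subseteq> V" "\<And>j. j \<in> J \<Longrightarrow> f j = 0"
  shows "word_eval bijections (simple_reflection m) w f = f"
  using assms
proof (induction w)
  case (Cons a w)
  have "fst a \<in> V" "f (fst a) = 0" using Cons.prems by auto
  then have "(if snd a then simple_reflection m (fst a)
      else inv\<^bsub>bijections\<^esub> simple_reflection m (fst a)) f = f"
    by (auto simp: inv_simple_reflection) (auto simp: simple_reflection_def)
  then show ?case using Cons by simp
qed simp

end

section \<open>Inversions and parabolic subgroups of Coxeter groups\<close>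

context group
begin

text \<open>The side matters: \<open>conjugate g t\<close> is the reflection \<open>t\<close> as
  seen from the chamber \<open>g\<close>. The wall of \<open>t\<close> separates \<open>g\<close>
  from \<open>g \<otimes> s i\<close> exactly if \<open>conjugate g t = s i\<close>.\<close>

definition conjugate :: "'a \<Rightarrow> 'a \<Rightarrow> 'a"
  where "conjugate g t = inv g \<otimes> t \<otimes> g"

lemma conjugate_closed [simp]: "g \<in> carrier G \<Longrightarrow> t \<in> carrier G \<Longrightarrow> conjugate g t \<in> carrier G"
  by (simp add: conjugate_def)

lemma conjugate_one [simp]: "t \<in> carrier G \<Longrightarrow> conjugate \<one> t = t"
  by (simp add: conjugate_def)

lemma conjugate_mult:
  "g \<in> carrier G \<Longrightarrow> h \<in> carrier G \<Longrightarrow> t \<in> carrier G \<Longrightarrow> conjugate (g \<otimes> h) t = conjugate h (conjugate g t)"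
  by (simp add: conjugate_def inv_mult_group m_assoc)

lemma conjugate_conjugate_inv [simp]:
  "g \<in> carrier G \<Longrightarrow> t \<in> carrier G \<Longrightarrow> conjugate g (conjugate (inv g) t) = t"
  "g \<in> carrier G \<Longrightarrow> t \<in> carrier G \<Longrightarrow> conjugate (inv g) (conjugate g t) = t"
  by (simp_all flip: conjugate_mult)

lemma conjugate_eq_iff:
  assumes "g \<in> carrier G" "t \<in> carrier G" "u \<in> carrier G"
  shows "conjugate g t = u \<longleftrightarrow> t = conjugate (inv g) u"
  using assms conjugate_conjugate_inv by metis

lemma mult_conjugate: "g \<in> carrier G \<Longrightarrow> t \<in> carrier G \<Longrightarrow> g \<otimes> conjugate g t = t \<otimes> g"
  by (simp add: conjugate_def flip: m_assoc)

lemma conjugate_pow: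
  fixes n :: nat
  assumes "g \<in> carrier G" "t \<in> carrier G"
  shows "conjugate g (t [^] n) = conjugate g t [^] n"
proof (induction n)
  case (Suc n)
  have "conjugate g (t [^] n \<otimes> t) = conjugate g (t [^] n) \<otimes> conjugate g t"
    using assms by (simp add: conjugate_def m_assoc) (simp flip: m_assoc)
  then show ?case using Suc by simp
qed (use assms in \<open>simp add: conjugate_def\<close>)

end

section \<open>Counting wall crossings\<close>

lemma card_less_Suc_shift:
  "card {k. k < Suc n \<and> P k} = (if P 0 then 1 else 0) + card {k. k < n \<and> P (Suc k)}"
proof -
  have "{k. k < Suc n \<and> P k} = (if P 0 then {0} else {}) \<union> Suc ` {k. k < n \<and> P (Suc k)}"
    by (auto simp: less_Suc_eq_0_disj)
  moreover have "card (Suc ` {k. k < n \<and> P (Suc k)}) = card {k. k < n \<and> P (Suc k)}"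
    by (rule card_image) simp
  ultimately show ?thesis by (auto simp: card_insert_if)
qed

lemma card_less_reverse: "card {k. k < n \<and> P (n - Suc k)} = card {k :: nat. k < n \<and> P k}"
proof (rule bij_betw_same_card)
  show "bij_betw (\<lambda>k. n - Suc k) {k. k < n \<and> P (n - Suc k)} {k. k < n \<and> P k}"
    by (rule bij_betw_byWitness[where f' = "\<lambda>k. n - Suc k"]) auto
qed

locale coxeter_group = group W for W :: "'w monoid" (structure) +
  fixes V :: "'x set" and m :: "'x \<Rightarrow> 'x \<Rightarrow> enat" and s :: "'x \<Rightarrow> 'w"
  assumes m: "coxeter_matrix V m"
    and presentation: "has_presentation W V s (mixed_relations V m V)"
begin

lemma s_Pi: "s \<in> V \<rightarrow> carrier W"
  by (rule has_presentationD(2)[OF presentation])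

lemma s_closed [simp]: "i \<in> V \<Longrightarrow> s i \<in> carrier W"
  using s_Pi by auto

lemma word_eval_W_closed [simp]: "w \<in> words V \<Longrightarrow> word_eval W s w \<in> carrier W"
  by (rule word_eval_closed[OF s_Pi])

lemma word_eval_W_append:
  "u \<in> words V \<Longrightarrow> v \<in> words V \<Longrightarrow> word_eval W s (u @ v) = word_eval W s u \<otimes> word_eval W s v"
  by (rule word_eval_append[OF s_Pi])

lemma relations_W: "relations_hold W V s (mixed_relations V m V)"
  by (rule has_presentation_relations_hold[OF presentation])

lemma s_square: "i \<in> V \<Longrightarrow> s i \<otimes> s i = \<one>"
  using relations_W relations_hold_square[OF s_Pi order.refl] by (simp add: mixed_relations_def)

lemma s_inv [simp]: "i \<in> V \<Longrightarrow> inv (s i) = s i"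
  by (simp add: inv_equality s_square)

lemma s_s_cancel [simp]: "i \<in> V \<Longrightarrow> g \<in> carrier W \<Longrightarrow> s i \<otimes> (s i \<otimes> g) = g"
  by (simp add: s_square flip: m_assoc)

lemma s_pow: "i \<in> V \<Longrightarrow> j \<in> V \<Longrightarrow> m i j = enat k \<Longrightarrow> (s i \<otimes> s j) [^] k = \<one>"
  using relations_W unfolding relations_hold_coxeter_iff[OF s_Pi m, symmetric]
    relations_hold_coxeter[OF s_Pi] by blast

lemma word_eval_W_Cons: "fst a \<in> V \<Longrightarrow> word_eval W s (a # w) = s (fst a) \<otimes> word_eval W s w"
  by simp

lemma conjugate_s: "i \<in> V \<Longrightarrow> t \<in> carrier W \<Longrightarrow> conjugate (s i) t = s i \<otimes> t \<otimes> s i"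
  by (simp add: conjugate_def)

lemma conjugate_s_eq_iff:
  "i \<in> V \<Longrightarrow> t \<in> carrier W \<Longrightarrow> u \<in> carrier W \<Longrightarrow> conjugate (s i) t = u \<longleftrightarrow> t = conjugate (s i) u"
  using conjugate_eq_iff[of "s i" t u] by simp

lemma conjugate_s_s [simp]: "i \<in> V \<Longrightarrow> conjugate (s i) (s i) = s i"
  by (simp add: conjugate_s s_square)

lemma carrier_W: "carrier W = word_eval W s ` words V"
  by (rule has_presentationD(3)[OF presentation])

lemma geometric_representation:
  obtains h where "\<And>w. w \<in> words V \<Longrightarrow>
    h (word_eval W s w) = word_eval bijections (simple_reflection m) w"
proof -
  have "simple_reflection m \<in> V \<rightarrow> carrier bijections"
    by (simp add: bij_simple_reflection[OF m])
  from has_presentation_hom[OF presentation group_bijections this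
      relations_hold_simple_reflection[OF m]]
  show ?thesis using that by blast
qed

section \<open>Standard subgroups of \<open>W\<close> and orders of products of two
  generators\<close>

definition parabolic :: "'x set \<Rightarrow> 'w set"
  where "parabolic J = generate W (s ` J)"

lemma parabolic_eq: "J \<subseteq> V \<Longrightarrow> parabolic J = word_eval W s ` words J"
  unfolding parabolic_def using s_Pi by (intro generate_eq_word_eval) auto

lemma subgroup_parabolic: "J \<subseteq> V \<Longrightarrow> subgroup (parabolic J) W"
  unfolding parabolic_def by (intro generate_is_subgroup) auto

lemma parabolic_closed:
  assumes "J \<subseteq> V"
  shows "g \<in> parabolic J \<Longrightarrow> g \<in> carrier W" "\<one> \<in> parabolic J" "j \<in> J \<Longrightarrow> s j \<in> parabolic J"
    "g \<in> parabolic J \<Longrightarrow> h \<in> parabolic J \<Longrightarrow> g \<otimes> h \<in> parabolic J"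
    "g \<in> parabolic J \<Longrightarrow> inv g \<in> parabolic J"
  using subgroup_parabolic[OF assms]
  by (auto simp: subgroup_def parabolic_def intro: generate.incl)

lemma parabolic_conjugate:
  "J \<subseteq> V \<Longrightarrow> g \<in> parabolic J \<Longrightarrow> t \<in> parabolic J \<Longrightarrow> conjugate g t \<in> parabolic J"
  by (simp add: conjugate_def parabolic_closed)

lemma s_notin_parabolic:
  assumes "i \<in> V" "J \<subseteq> V" "i \<notin> J"
  shows "s i \<notin> parabolic J"
proof
  obtain h where h: "\<And>w. w \<in> words V \<Longrightarrow>
      h (word_eval W s w) = word_eval bijections (simple_reflection m) w"
    using geometric_representation by blast
  assume "s i \<in> parabolic J"
  then obtain w where w: "w \<in> words J" "s i = word_eval W s w"
    unfolding parabolic_eq[OF assms(2)] by blast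
  have "w \<in> words V" using w(1) words_mono[OF assms(2)] by blast
  then have "word_eval bijections (simple_reflection m) w = h (s i)" using h w(2) by simp
  also have "\<dots> = word_eval bijections (simple_reflection m) [letter i]"
    using h[of "[letter i]"] assms(1) by simp
  finally have eq: "word_eval bijections (simple_reflection m) w = simple_reflection m i"
    by simp
  \<comment> \<open>This form vanishes on \<open>J\<close>, hence is fixed by
    \<open>parabolic J\<close>, whereas \<open>s i\<close> turns its value 1 at \<open>i\<close>
    into \<open>- 1\<close>.\<close>
  let ?f = "(\<lambda>_. 0)(i := 1) :: 'x \<Rightarrow> real"
  have "simple_reflection m i ?f = ?f"
    unfolding eq[symmetric] using assms(3)
    by (intro word_eval_simple_reflection_fixes[OF m w(1) assms(2)]) auto
  from fun_cong[OF this, of i] show False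
    by (simp add: simple_reflection_def coxeter_form_diag[OF m assms(1)])
qed

lemma s_in_parabolic_iff: "i \<in> V \<Longrightarrow> J \<subseteq> V \<Longrightarrow> s i \<in> parabolic J \<longleftrightarrow> i \<in> J"
  using s_notin_parabolic parabolic_closed(3) by blast

lemma inj_s: "i \<in> V \<Longrightarrow> j \<in> V \<Longrightarrow> s i = s j \<longleftrightarrow> i = j"
  using s_in_parabolic_iff[of i "{j}"] s_in_parabolic_iff[of j "{j}"] by auto

text \<open>The presentation only bounds the order of \<open>s i \<otimes> s j\<close> from above;
  the representation shows that no smaller exponent works. This makes labels recoverable from
  \<open>W\<close>.\<close>

lemma s_order:
  assumes ij: "i \<in> V" "j \<in> V" "i \<noteq> j" and n: "(s i \<otimes> s j) [^] n = \<one>" "n > 0"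
  shows "\<exists>k. m i j = enat k \<and> k dvd n"
proof -
  obtain h where h: "\<And>w. w \<in> words V \<Longrightarrow>
      h (word_eval W s w) = word_eval bijections (simple_reflection m) w"
    using geometric_representation by blast
  interpret B: group "bijections :: (('x \<Rightarrow> real) \<Rightarrow> 'x \<Rightarrow> real) monoid" by (rule group_bijections)
  let ?w = "concat (replicate n [letter i, letter j])"
  have "?w \<in> words V" using ij by (induction n) auto
  from h[OF this] have "word_eval bijections (simple_reflection m) ?w = h \<one>"
    using n(1) ij by (simp add: word_eval_replicate)
  also have "\<dots> = id" using h[of "[]"] by simp
  finally have "(simple_reflection m i \<circ> simple_reflection m j) ^^ n = id"
    using ij B.word_eval_replicate[of "simple_reflection m" i j n]
    by (simp add: bij_simple_reflection[OF m] bijections_pow)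
  then show ?thesis using simple_reflection_order_dvd[OF m ij] n(2) by blast
qed

text \<open>The reflection of the wall crossed at step \<open>k\<close>, counted from 0, by the
  gallery \<open>i, j, i, ...\<close> starting at 1.\<close>

definition dihedral_reflection :: "'x \<Rightarrow> 'x \<Rightarrow> nat \<Rightarrow> 'w"
  where "dihedral_reflection i j k = (s i \<otimes> s j) [^] k \<otimes> s i"

lemma dihedral_reflection_closed [simp]:
  "i \<in> V \<Longrightarrow> j \<in> V \<Longrightarrow> dihedral_reflection i j k \<in> carrier W"
  by (simp add: dihedral_reflection_def)

lemma dihedral_reflection_0 [simp]: "i \<in> V \<Longrightarrow> dihedral_reflection i j 0 = s i"
  by (simp add: dihedral_reflection_def)

lemma conjugate_dihedral_reflection:
  assumes "i \<in> V" "j \<in> V"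
  shows "conjugate (s i) (dihedral_reflection j i k) = dihedral_reflection i j (Suc k)"
proof (induction k)
  case 0
  then show ?case using assms by (simp add: dihedral_reflection_def conjugate_s m_assoc)
next
  case (Suc k)
  have "conjugate (s i) (dihedral_reflection j i (Suc k)) =
      s i \<otimes> (s j \<otimes> s i \<otimes> dihedral_reflection j i k) \<otimes> s i"
    using assms nat_pow_Suc2[of "s j \<otimes> s i" k]
    by (simp add: conjugate_s dihedral_reflection_def m_assoc del: nat_pow_Suc)
  also have "\<dots> = s i \<otimes> s j \<otimes> conjugate (s i) (dihedral_reflection j i k)"
    using assms by (simp add: conjugate_s m_assoc)
  also have "\<dots> = dihedral_reflection i j (Suc (Suc k))"
    unfolding Suc.IH using assms nat_pow_Suc2[of "s i \<otimes> s j" "Suc k"]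
    by (simp add: dihedral_reflection_def m_assoc del: nat_pow_Suc)
  finally show ?case .
qed

text \<open>The two galleries of length \<open>n\<close> around the dihedral residue join opposite
  chambers and cross the same walls in opposite order.\<close>

lemma dihedral_reflection_reverse:
  assumes ij: "i \<in> V" "j \<in> V" "m i j = enat n" and k: "k < n"
  shows "dihedral_reflection i j k = dihedral_reflection j i (n - Suc k)"
proof -
  let ?c = "s i \<otimes> s j"
  have step: "?c [^] Suc l \<otimes> dihedral_reflection j i l = s i" for l
  proof (induction l)
    case 0
    then show ?case using ij by (simp add: m_assoc s_square)
  next
    case (Suc l)
    have "?c [^] Suc (Suc l) \<otimes> dihedral_reflection j i (Suc l) =
        ?c [^] Suc l \<otimes> (?c \<otimes> (s j \<otimes> s i \<otimes> dihedral_reflection j i l))"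
      using ij nat_pow_Suc2[of "s j \<otimes> s i" l]
      by (simp add: dihedral_reflection_def m_assoc)
    also have "\<dots> = ?c [^] Suc l \<otimes> dihedral_reflection j i l"
      using ij by (simp add: m_assoc)
    finally show ?case using Suc.IH by simp
  qed
  have "dihedral_reflection i j k = ?c [^] k \<otimes> (?c [^] Suc (n - Suc k) \<otimes> dihedral_reflection j i (n - Suc k))"
    unfolding step by (simp add: dihedral_reflection_def)
  also have "\<dots> = ?c [^] (k + Suc (n - Suc k)) \<otimes> dihedral_reflection j i (n - Suc k)"
    using ij by (simp add: m_assoc del: nat_pow_Suc add_Suc_right flip: nat_pow_mult)
  also have "k + Suc (n - Suc k) = n" using k by simp
  finally show ?thesis using s_pow[OF ij] ij by simp
qed

text \<open>
  The reflections separating \<open>1\<close> from the end of the gallery \<open>w\<close>: those crossed an odd number of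
  times.
\<close>

primrec word_inversion :: "'x word \<Rightarrow> 'w \<Rightarrow> bool"
  where
    "word_inversion [] t \<longleftrightarrow> False"
  | "word_inversion (a # w) t \<longleftrightarrow> (t = s (fst a)) \<noteq> word_inversion w (conjugate (s (fst a)) t)"

lemma word_inversion_append:
  "u \<in> words V \<Longrightarrow> t \<in> carrier W \<Longrightarrow>
    word_inversion (u @ v) t \<longleftrightarrow> word_inversion u t \<noteq> word_inversion v (conjugate (word_eval W s u) t)"
proof (induction u arbitrary: t)
  case (Cons a u)
  have "word_eval W s (a # u) = s (fst a) \<otimes> word_eval W s u"
    using Cons.prems by simp
  then have "conjugate (word_eval W s (a # u)) t = conjugate (word_eval W s u) (conjugate (s (fst a)) t)"
    using Cons.prems by (simp add: conjugate_mult)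
  moreover have "word_inversion (u @ v) (conjugate (s (fst a)) t) \<longleftrightarrow>
      word_inversion u (conjugate (s (fst a)) t) \<noteq>
      word_inversion v (conjugate (word_eval W s u) (conjugate (s (fst a)) t))"
    using Cons by simp
  ultimately show ?case by (simp only: append_Cons word_inversion.simps) argo
qed simp

lemma word_inversion_alternating:
  "i \<in> V \<Longrightarrow> j \<in> V \<Longrightarrow> t \<in> carrier W \<Longrightarrow>
    word_inversion (alternating i j n) t \<longleftrightarrow> odd (card {k. k < n \<and> t = dihedral_reflection i j k})"
proof (induction n arbitrary: i j t)
  case (Suc n)
  have "conjugate (s i) t = dihedral_reflection j i k \<longleftrightarrow> t = dihedral_reflection i j (Suc k)" for k
    using Suc.prems by (simp add: conjugate_s_eq_iff conjugate_dihedral_reflection)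
  then show ?case
    using Suc by (simp add: card_less_Suc_shift)
qed simp

text \<open>The two sides of a braid relation cross the same walls in opposite order, and a square
  or a cancelling pair crosses one wall twice, so parities are preserved. Signs of letters may be
  ignored because the generators are involutions.\<close>

lemma word_inversion_word_cong:
  "(u, v) \<in> word_cong V (mixed_relations V m V) \<Longrightarrow> t \<in> carrier W \<Longrightarrow>
    word_inversion u t = word_inversion v t"
proof (induction arbitrary: t rule: word_cong.induct)
  case (append u u' v v')
  have "word_eval W s u = word_eval W s u'"
    using append.hyps(1) word_cong_words has_presentationD(4)[OF presentation] by blast
  moreover have "u \<in> words V" "u' \<in> words V" using append.hyps(1) word_cong_words by blast+
  ultimately show ?case using append by (simp add: word_inversion_append)
next
  case (cancel x e)
  then show ?case by (simp add: conjugate_s_eq_iff)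
next
  case (rel u v)
  then consider (braid) i j n where "i \<in> V" "j \<in> V" "m i j = enat n"
      "u = alternating i j n" "v = alternating j i n"
    | (square) i where "i \<in> V" "u = [letter i, letter i]" "v = []"
    unfolding mixed_relations_def artin_tits_relations_def square_relations_def by blast
  then show ?case
  proof cases
    case braid
    have "{k. k < n \<and> t = dihedral_reflection i j k} =
        {k. k < n \<and> t = dihedral_reflection j i (n - Suc k)}"
      using braid dihedral_reflection_reverse[of i j n] by auto
    then show ?thesis
      using braid rel.prems card_less_reverse[of n "\<lambda>k. t = dihedral_reflection j i k"]
      by (simp add: word_inversion_alternating)
  next
    case square
    then show ?thesis using rel.prems by (simp add: conjugate_s_eq_iff)
  qed
qed auto

section \<open>Inversions of group elements, exchange and descents\<close>

definition inversion :: "'w \<Rightarrow> 'w \<Rightarrow> bool"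
  where "inversion g t \<longleftrightarrow> (\<exists>w \<in> words V. word_eval W s w = g \<and> word_inversion w t)"

lemma inversion_word_eval:
  assumes "w \<in> words V" "t \<in> carrier W"
  shows "inversion (word_eval W s w) t \<longleftrightarrow> word_inversion w t"
proof
  assume "inversion (word_eval W s w) t"
  then obtain v where "v \<in> words V" "word_eval W s v = word_eval W s w" "word_inversion v t"
    by (auto simp: inversion_def)
  moreover from this have "(v, w) \<in> word_cong V (mixed_relations V m V)"
    using has_presentationD(4)[OF presentation] assms(1) by blast
  ultimately show "word_inversion w t" using word_inversion_word_cong assms(2) by blast
qed (use assms in \<open>auto simp: inversion_def\<close>)

lemma inversion_one: "t \<in> carrier W \<Longrightarrow> \<not> inversion \<one> t"
  using inversion_word_eval[of "[]" t] by simp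

lemma inversion_s: "i \<in> V \<Longrightarrow> t \<in> carrier W \<Longrightarrow> inversion (s i) t \<longleftrightarrow> t = s i"
  using inversion_word_eval[of "[letter i]" t] by simp

lemma inversion_mult:
  assumes "g \<in> carrier W" "h \<in> carrier W" "t \<in> carrier W"
  shows "inversion (g \<otimes> h) t \<longleftrightarrow> inversion g t \<noteq> inversion h (conjugate g t)"
proof -
  obtain u v where "u \<in> words V" "v \<in> words V" "g = word_eval W s u" "h = word_eval W s v"
    using assms carrier_W by auto
  moreover from this have "word_eval W s u \<otimes> word_eval W s v = word_eval W s (u @ v)"
    by (simp add: word_eval_W_append)
  ultimately show ?thesis
    using assms by (simp add: inversion_word_eval word_inversion_append)
qed

text \<open>A gallery with letters in \<open>J\<close> crosses only walls whose reflections are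
  conjugates of these letters by elements of \<open>parabolic J\<close>.\<close>

lemma inversion_in_parabolic:
  assumes J: "J \<subseteq> V" and g: "g \<in> parabolic J" and t: "t \<in> carrier W" "inversion g t"
  shows "t \<in> parabolic J"
proof -
  have "t \<in> parabolic J" if "w \<in> words J" "t \<in> carrier W" "word_inversion w t" for w t
    using that
  proof (induction w arbitrary: t)
    case (Cons a w)
    then have a: "fst a \<in> J" "fst a \<in> V" using J by auto
    show ?case
    proof (cases "t = s (fst a)")
      case True
      then show ?thesis using a J parabolic_closed by simp
    next
      case False
      then have "conjugate (s (fst a)) t \<in> parabolic J" using Cons a by simp
      then have "conjugate (s (fst a)) (conjugate (s (fst a)) t) \<in> parabolic J"
        using a J parabolic_closed parabolic_conjugate by simp
      then show ?thesis using a Cons.prems conjugate_conjugate_inv(1)[of "s (fst a)" t] by simp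
    qed
  qed simp
  moreover obtain w where "w \<in> words J" "g = word_eval W s w"
    using g parabolic_eq[OF J] by auto
  moreover from this have "w \<in> words V" using words_mono[OF J] by blast
  ultimately show ?thesis using t inversion_word_eval by blast
qed

text \<open>The strong exchange condition: multiplication by \<open>t\<close> folds the gallery at
  its first crossing of the wall of \<open>t\<close>, which amounts to deleting the letter that
  crosses it.\<close>

lemma word_inversion_deletion:
  assumes "J \<subseteq> V"
  shows "w \<in> words J \<Longrightarrow> t \<in> carrier W \<Longrightarrow> word_inversion w t \<Longrightarrow>
    \<exists>w' \<in> words J. word_eval W s w' = t \<otimes> word_eval W s w \<and> length w' < length w"
proof (induction w arbitrary: t)
  case (Cons a w)
  have a: "fst a \<in> J" "fst a \<in> V" and w: "w \<in> words J" "w \<in> words V"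
    using Cons.prems assms words_mono[OF assms] by auto
  have ev: "word_eval W s (a # w) = s (fst a) \<otimes> word_eval W s w" using a by simp
  show ?case
  proof (cases "t = s (fst a)")
    case True
    then show ?thesis using w a by (intro bexI[where x = w]) (auto simp: ev)
  next
    case False
    then have "word_inversion w (conjugate (s (fst a)) t)" using Cons.prems by simp
    with Cons.IH[OF w(1) _ this] obtain w' where w': "w' \<in> words J" "length w' < length w"
      "word_eval W s w' = conjugate (s (fst a)) t \<otimes> word_eval W s w"
      using a Cons.prems by auto
    have "word_eval W s (a # w') = t \<otimes> word_eval W s (a # w)"
      using a w(2) Cons.prems w'(3) by (simp add: ev conjugate_s m_assoc)
    then show ?thesis using w' a by (intro bexI[where x = "a # w'"]) auto
  qed
qed simp

text \<open>Only letters from \<open>J\<close> are counted, so that the shorter words produced by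
  deletion remain inside \<open>parabolic J\<close>.\<close>

definition parabolic_length :: "'x set \<Rightarrow> 'w \<Rightarrow> nat"
  where "parabolic_length J g = (LEAST n. \<exists>w \<in> words J. word_eval W s w = g \<and> length w = n)"

lemma parabolic_length_word:
  assumes "J \<subseteq> V" "g \<in> parabolic J"
  obtains w where "w \<in> words J" "word_eval W s w = g" "length w = parabolic_length J g"
proof -
  have "\<exists>n. \<exists>w \<in> words J. word_eval W s w = g \<and> length w = n"
    using assms parabolic_eq by auto
  from LeastI_ex[OF this] show ?thesis using that unfolding parabolic_length_def by blast
qed

lemma parabolic_length_le:
  "w \<in> words J \<Longrightarrow> parabolic_length J (word_eval W s w) \<le> length w"
  unfolding parabolic_length_def by (rule Least_le) blast

lemma inversion_decreases_length:
  assumes J: "J \<subseteq> V" and g: "g \<in> parabolic J" and t: "t \<in> carrier W" "inversion g t"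
  shows "parabolic_length J (t \<otimes> g) < parabolic_length J g"
proof -
  obtain w where w: "w \<in> words J" "word_eval W s w = g" "length w = parabolic_length J g"
    using parabolic_length_word[OF J g] .
  have "word_inversion w t"
    using t w words_mono[OF J] inversion_word_eval by blast
  then obtain w' where "w' \<in> words J" "word_eval W s w' = t \<otimes> g" "length w' < length w"
    using word_inversion_deletion[OF J w(1) t(1)] w(2) by blast
  then show ?thesis using parabolic_length_le[of w' J] w(3) by simp
qed

text \<open>The first letter of a shortest word works: if the rest crossed the same wall an odd
  number of times, deletion would turn the rest into a still shorter word for
  \<open>g\<close>.\<close>

lemma parabolic_descent:
  assumes J: "J \<subseteq> V" and g: "g \<in> parabolic J" "g \<noteq> \<one>"
  shows "\<exists>a\<in>J. inversion g (s a)"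
proof -
  obtain w where w: "w \<in> words J" "word_eval W s w = g" "length w = parabolic_length J g"
    using parabolic_length_word[OF J g(1)] .
  obtain a w0 where aw: "w = a # w0" using w(2) g(2) by (cases w) auto
  have a: "fst a \<in> J" "fst a \<in> V" and w0: "w0 \<in> words J" using w(1) aw J by auto
  have "\<not> word_inversion w0 (s (fst a))"
  proof
    assume "word_inversion w0 (s (fst a))"
    then obtain w' where "w' \<in> words J" "word_eval W s w' = s (fst a) \<otimes> word_eval W s w0"
      "length w' < length w0"
      using word_inversion_deletion[OF J w0, of "s (fst a)"] a by auto
    moreover have "s (fst a) \<otimes> word_eval W s w0 = g"
      using w(2) unfolding aw word_eval_W_Cons[OF a(2)] .
    ultimately show False using parabolic_length_le[of w' J] w(3) aw by simp
  qed
  then have "word_inversion w (s (fst a))" using aw a by simp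
  then have "inversion g (s (fst a))"
    using w a words_mono[OF J] inversion_word_eval[of w "s (fst a)"] by auto
  then show ?thesis using a by blast
qed

text \<open>A descent \<open>a \<in> J\<close> of \<open>g\<close> is an inversion of an element of
  \<open>parabolic K\<close>, so \<open>s a\<close> lies in \<open>parabolic K\<close> and
  \<open>a \<in> K\<close> by independence. Stripping it shortens \<open>g\<close>.\<close>

lemma parabolic_inter:
  assumes "J \<subseteq> V" "K \<subseteq> V"
  shows "g \<in> parabolic J \<Longrightarrow> g \<in> parabolic K \<Longrightarrow> g \<in> parabolic (J \<inter> K)"
proof (induction "parabolic_length J g" arbitrary: g rule: less_induct)
  case less
  show ?case
  proof (cases "g = \<one>")
    case True
    then show ?thesis using assms by (auto intro: parabolic_closed(2))
  next
    case False
    then obtain a where a: "a \<in> J" "inversion g (s a)"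
      using parabolic_descent[OF assms(1)] less.prems by blast
    have aV: "a \<in> V" using a assms by blast
    have g: "g \<in> carrier W" using less.prems assms parabolic_closed(1) by blast
    have "s a \<in> parabolic K"
      using inversion_in_parabolic[OF assms(2) less.prems(2) _ a(2)] aV by simp
    then have "a \<in> K" using s_in_parabolic_iff aV assms by blast
    have "s a \<otimes> g \<in> parabolic (J \<inter> K)"
      using less.hyps[OF inversion_decreases_length[OF assms(1) less.prems(1) _ a(2)]] aV
        less.prems a(1) \<open>a \<in> K\<close> assms parabolic_closed(3,4) by simp
    moreover have "J \<inter> K \<subseteq> V" "s a \<in> parabolic (J \<inter> K)"
      using assms a(1) \<open>a \<in> K\<close> by (auto intro: parabolic_closed(3))
    ultimately have "s a \<otimes> (s a \<otimes> g) \<in> parabolic (J \<inter> K)"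
      using parabolic_closed(4) by blast
    then show ?thesis using aV g by simp
  qed
qed

text \<open>Take a descent \<open>a\<close> of \<open>y\<close>. If \<open>z\<close> crosses the
  wall of \<open>s a\<close> back, reflecting the stretch in between gives the shorter pair
  \<open>s a \<otimes> y\<close> and \<open>conjugate y (s a) \<otimes> z\<close> with the same
  product. Otherwise \<open>s a\<close> remains an inversion of the product, so
  \<open>a \<in> J \<inter> K\<close> and it can be split off on the left.\<close>

proposition parabolic_inter_product:
  assumes JKL: "J \<subseteq> V" "K \<subseteq> V" "L \<subseteq> V"
  shows "y \<in> parabolic K \<Longrightarrow> z \<in> parabolic L \<Longrightarrow> y \<otimes> z \<in> parabolic J \<Longrightarrow>
    \<exists>a \<in> parabolic (J \<inter> K). \<exists>b \<in> parabolic (J \<inter> L). y \<otimes> z = a \<otimes> b"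
proof (induction "parabolic_length K y" arbitrary: y z rule: less_induct)
  case less
  have y: "y \<in> carrier W" and z: "z \<in> carrier W"
    using less.prems JKL parabolic_closed(1) by blast+
  have JK: "J \<inter> K \<subseteq> V" and JL: "J \<inter> L \<subseteq> V" using JKL by auto
  show ?case
  proof (cases "y = \<one>")
    case True
    then have "z \<in> parabolic (J \<inter> L)" using less.prems z JKL parabolic_inter by simp
    then show ?thesis using True z parabolic_closed(2)[OF JK] by blast
  next
    case False
    then obtain a where a: "a \<in> K" "inversion y (s a)"
      using parabolic_descent[OF JKL(2)] less.prems by blast
    have aV: "a \<in> V" using a JKL by blast
    have shorter: "parabolic_length K (s a \<otimes> y) < parabolic_length K y"
      using inversion_decreases_length[OF JKL(2) less.prems(1) _ a(2)] aV by simp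
    have ay: "s a \<otimes> y \<in> parabolic K" using parabolic_closed JKL(2) a(1) less.prems(1) by simp
    show ?thesis
    proof (cases "inversion z (conjugate y (s a))")
      case True
      then have c: "conjugate y (s a) \<in> parabolic L"
        using inversion_in_parabolic[OF JKL(3) less.prems(2)] y aV by simp
      have "s a \<otimes> y \<otimes> (conjugate y (s a) \<otimes> z) = s a \<otimes> (y \<otimes> conjugate y (s a)) \<otimes> z"
        using y z aV by (simp add: m_assoc)
      also have "\<dots> = y \<otimes> z" using y z aV by (simp add: mult_conjugate m_assoc)
      finally have eq: "s a \<otimes> y \<otimes> (conjugate y (s a) \<otimes> z) = y \<otimes> z" .
      show ?thesis
        using less.hyps[OF shorter ay, of "conjugate y (s a) \<otimes> z"] c less.prems JKL(3)
        by (simp add: eq parabolic_closed)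
    next
      case False
      then have "inversion (y \<otimes> z) (s a)" using a(2) y z aV by (simp add: inversion_mult)
      then have "s a \<in> parabolic J"
        using inversion_in_parabolic[OF JKL(1) less.prems(3)] aV by simp
      then have aJ: "a \<in> J" using s_in_parabolic_iff aV JKL(1) by blast
      have assoc: "s a \<otimes> y \<otimes> z = s a \<otimes> (y \<otimes> z)" using y z aV by (simp add: m_assoc)
      have "s a \<otimes> y \<otimes> z \<in> parabolic J"
        unfolding assoc using JKL(1) aJ less.prems(3) by (simp add: parabolic_closed)
      from less.hyps[OF shorter ay less.prems(2) this]
      obtain b c where bc: "b \<in> parabolic (J \<inter> K)" "c \<in> parabolic (J \<inter> L)" "s a \<otimes> y \<otimes> z = b \<otimes> c"
        by blast
      have cl: "b \<in> carrier W" "c \<in> carrier W"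
        using bc parabolic_closed(1)[OF JK] parabolic_closed(1)[OF JL] by auto
      have "y \<otimes> z = s a \<otimes> (s a \<otimes> y \<otimes> z)" using y z aV by (simp add: assoc)
      also have "\<dots> = (s a \<otimes> b) \<otimes> c" unfolding bc(3) using cl aV by (simp add: m_assoc)
      finally have "y \<otimes> z = (s a \<otimes> b) \<otimes> c" .
      moreover have "s a \<otimes> b \<in> parabolic (J \<inter> K)"
        using bc(1) aJ a(1) JK by (simp add: parabolic_closed)
      ultimately show ?thesis using bc(2) by blast
    qed
  qed
qed

end

section \<open>Retractions onto standard parabolic subgroups\<close>

text \<open>For even \<open>n\<close> both words contain each letter \<open>n div 2\<close> times.
  For odd \<open>n\<close> the counts of \<open>i\<close> and \<open>j\<close> are exchanged, which
  does no harm if both or neither are in \<open>Q\<close>.\<close>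

lemma odd_letters_alternating:
  assumes "odd n \<Longrightarrow> i \<in> Q \<longleftrightarrow> j \<in> Q"
  shows "odd (length (filter (\<lambda>a. fst a \<in> Q) (alternating i j n))) \<longleftrightarrow>
    odd (length (filter (\<lambda>a. fst a \<in> Q) (alternating j i n)))"
proof -
  have "length (filter (\<lambda>a. fst a \<in> Q) (alternating i j n)) =
      (if i \<in> Q then (n + 1) div 2 else 0) + (if j \<in> Q then n div 2 else 0)" for i j :: 'a
    by (induction n arbitrary: i j) auto
  then show ?thesis using assms by (cases "even n") (auto elim!: evenE)
qed

locale mixed_group = coxeter_group W V m s
  for W :: "'w monoid" (structure) and V :: "'x set" and m s +
  fixes P :: "'p monoid" and r :: "'x \<Rightarrow> 'p" and Q :: "'x set"
  assumes Q: "Q \<subseteq> V" "odd_closed V m Q"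
    and presentation_P: "has_presentation P V r (mixed_relations V m Q)"
begin

sublocale P: group P
  by (rule has_presentationD(1)[OF presentation_P])

lemma r_Pi: "r \<in> V \<rightarrow> carrier P"
  by (rule has_presentationD(2)[OF presentation_P])

lemma r_closed [simp]: "i \<in> V \<Longrightarrow> r i \<in> carrier P"
  using r_Pi by auto

lemma word_eval_P_closed [simp]: "w \<in> words V \<Longrightarrow> word_eval P r w \<in> carrier P"
  by (rule P.word_eval_closed[OF r_Pi])

lemma word_eval_P_append:
  "u \<in> words V \<Longrightarrow> v \<in> words V \<Longrightarrow>
    word_eval P r (u @ v) = word_eval P r u \<otimes>\<^bsub>P\<^esub> word_eval P r v"
  by (rule P.word_eval_append[OF r_Pi])

lemma word_eval_P_eq_iff:
  "u \<in> words V \<Longrightarrow> v \<in> words V \<Longrightarrow>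
    word_eval P r u = word_eval P r v \<longleftrightarrow> (u, v) \<in> word_cong V (mixed_relations V m Q)"
  by (rule has_presentationD(4)[OF presentation_P])

lemma word_eval_P_imp_W:
  assumes "u \<in> words V" "v \<in> words V" "word_eval P r u = word_eval P r v"
  shows "word_eval W s u = word_eval W s v"
proof -
  have "square_relations Q \<subseteq> square_relations V"
    using Q(1) unfolding square_relations_def by blast
  then have "relations_hold W V s (mixed_relations V m Q)"
    using relations_W unfolding mixed_relations_def relations_hold_def by blast
  then show ?thesis
    using word_eval_word_cong[OF s_Pi] assms word_eval_P_eq_iff by blast
qed

lemma r_square: "q \<in> Q \<Longrightarrow> r q \<otimes>\<^bsub>P\<^esub> r q = \<one>\<^bsub>P\<^esub>"
  using has_presentation_relations_hold[OF presentation_P] P.relations_hold_square[OF r_Pi Q(1)]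
  by (simp add: mixed_relations_def)

lemma word_eval_P_alternating:
  assumes "i \<in> V" "j \<in> V" "i \<noteq> j" "m i j = enat k"
  shows "word_eval P r (alternating i j k) = word_eval P r (alternating j i k)"
  using has_presentation_relations_hold[OF presentation_P] assms
  unfolding mixed_relations_def relations_hold_Un relations_hold_artin_tits by blast

text \<open>Conjugate generators of \<open>W\<close> agree on membership in \<open>Q\<close>, by counting letters modulo 2.\<close>

lemma conjugate_in_Q:
  assumes g: "g \<in> carrier W" and xi: "x \<in> V" "i \<in> V" "conjugate g (s x) = s i"
  shows "x \<in> Q \<longleftrightarrow> i \<in> Q"
proof -
  define N where "N w \<longleftrightarrow> odd (length (filter (\<lambda>a. fst a \<in> Q) w))" for w :: "'x word"
  have N: "N u = N v" if "(u, v) \<in> word_cong V (mixed_relations V m V)" for u v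
    using that
  proof (induction rule: word_cong.induct)
    case (rel u v)
    then consider (braid) i j n where "i \<in> V" "j \<in> V" "i \<noteq> j" "m i j = enat n"
        "u = alternating i j n" "v = alternating j i n"
      | (square) i where "i \<in> V" "u = [letter i, letter i]" "v = []"
      unfolding mixed_relations_def artin_tits_relations_def square_relations_def by blast
    then show ?case
    proof cases
      case braid
      then have "odd n \<Longrightarrow> i \<in> Q \<longleftrightarrow> j \<in> Q" using Q(2) unfolding odd_closed_def by blast
      from odd_letters_alternating[of n i Q j, OF this] show ?thesis using braid by (simp add: N_def)
    qed (simp add: N_def)
  qed (auto simp: N_def)
  obtain w where w: "w \<in> words V" "g = word_eval W s w" using g carrier_W by blast
  have "word_eval W s (letter x # w) = s x \<otimes> g" using w by simp
  also have "\<dots> = g \<otimes> s i" using mult_conjugate[of g "s x"] g xi by simp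
  also have "\<dots> = word_eval W s (w @ [letter i])" using w xi by (simp add: word_eval_W_append)
  finally have "(letter x # w, w @ [letter i]) \<in> word_cong V (mixed_relations V m V)"
    by (intro has_presentationD(4)[OF presentation, THEN iffD1]) (use w xi in simp_all)
  from N[OF this] show ?thesis by (auto simp: N_def split: if_splits)
qed

context
  fixes J :: "'x set"
  assumes J: "J \<subseteq> V"
begin

text \<open>
  The retraction of Blufstein and Paris onto the subgroup generated by \<open>J\<close>. A word is read as a
  gallery in \<open>W\<close> which is not allowed to cross the walls of \<open>J\<close>: a letter that would cross the wall
  of \<open>x \<in> J\<close> is blocked and produces the output letter \<open>x\<close> instead.
\<close>

definition blocked :: "'w \<Rightarrow> 'x \<Rightarrow> bool"
  where "blocked g i \<longleftrightarrow> (\<exists>x\<in>J. conjugate g (s x) = s i)"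

definition wall :: "'w \<Rightarrow> 'x \<Rightarrow> 'x"
  where "wall g i = (SOME x. x \<in> J \<and> conjugate g (s x) = s i)"

primrec walk :: "'x word \<Rightarrow> 'w \<Rightarrow> 'w"
  where
    "walk [] g = g"
  | "walk (a # w) g = walk w (if blocked g (fst a) then g else g \<otimes> s (fst a))"

primrec trace :: "'x word \<Rightarrow> 'w \<Rightarrow> 'x word"
  where
    "trace [] g = []"
  | "trace (a # w) g = (if blocked g (fst a) then (wall g (fst a), snd a) # trace w g
      else trace w (g \<otimes> s (fst a)))"

text \<open>No wall of \<open>J\<close> separates 1 from \<open>g\<close>: these are the shortest
  representatives of the cosets of \<open>parabolic J\<close> of the form
  \<open>parabolic J g\<close>.\<close>

definition reduced :: "'w \<Rightarrow> bool"
  where "reduced g \<longleftrightarrow> g \<in> carrier W \<and> (\<forall>x\<in>J. \<not> inversion g (s x))"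

section \<open>Walls, walks and outputs of the retraction\<close>

lemma J_in_V: "x \<in> J \<Longrightarrow> x \<in> V"
  using J by blast

lemma wall:
  assumes "blocked g i"
  shows "wall g i \<in> J" "conjugate g (s (wall g i)) = s i"
  using assms someI_ex[of "\<lambda>x. x \<in> J \<and> conjugate g (s x) = s i"]
  unfolding blocked_def wall_def by blast+

lemma wall_unique:
  assumes "g \<in> carrier W" "i \<in> V" "x \<in> J" "conjugate g (s x) = s i"
  shows "blocked g i" "wall g i = x"
proof -
  show b: "blocked g i" using assms by (auto simp: blocked_def)
  have "s (wall g i) = s x"
    using wall[OF b] assms J_in_V by (metis conjugate_eq_iff s_closed)
  then show "wall g i = x" using inj_s J_in_V wall(1)[OF b] assms(3) by blast
qed

lemma reduced_closed: "reduced g \<Longrightarrow> g \<in> carrier W"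
  by (simp add: reduced_def)

lemma reduced_one: "reduced \<one>"
  using inversion_one J_in_V by (auto simp: reduced_def)

text \<open>By the cocycle rule, the step to \<open>g \<otimes> s i\<close> crosses only the wall
  \<open>t\<close> with \<open>conjugate g t = s i\<close>; that the letter is not blocked means
  that it is no wall of \<open>J\<close>.\<close>

lemma reduced_step:
  assumes "reduced g" "i \<in> V" "\<not> blocked g i"
  shows "reduced (g \<otimes> s i)"
proof -
  have "\<not> inversion (g \<otimes> s i) (s x)" if "x \<in> J" for x
    using assms that J_in_V[OF that]
    by (auto simp: reduced_def inversion_mult inversion_s blocked_def)
  then show ?thesis using assms by (simp add: reduced_def)
qed

lemma reduced_parabolic:
  assumes "reduced g" "g \<in> parabolic J"
  shows "g = \<one>"
  using parabolic_descent[OF J assms(2)] assms(1) by (auto simp: reduced_def)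

lemma walk_append: "walk (u @ v) g = walk v (walk u g)"
  by (induction u arbitrary: g) auto

lemma trace_append: "trace (u @ v) g = trace u g @ trace v (walk u g)"
  by (induction u arbitrary: g) auto

lemma walk_closed: "u \<in> words V \<Longrightarrow> g \<in> carrier W \<Longrightarrow> walk u g \<in> carrier W"
  by (induction u arbitrary: g) auto

lemma walk_reduced: "u \<in> words V \<Longrightarrow> reduced g \<Longrightarrow> reduced (walk u g)"
  by (induction u arbitrary: g) (auto simp: reduced_step)

lemma trace_in_words: "trace u g \<in> words J"
  by (induction u arbitrary: g) (auto simp: wall)

lemma trace_in_words_V: "trace u g \<in> words V"
  using trace_in_words words_mono[OF J] by blast

text \<open>While the walk stays in \<open>parabolic K\<close>, the reflection of a blocking wall is
  a conjugate of a generator from \<open>K\<close> by an element of \<open>parabolic K\<close>.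
  Being also a generator, it comes from \<open>K\<close> by independence.\<close>

lemma trace_in_parabolic:
  assumes K: "K \<subseteq> V"
  shows "u \<in> words K \<Longrightarrow> g \<in> parabolic K \<Longrightarrow> trace u g \<in> words (J \<inter> K)"
proof (induction u arbitrary: g)
  case (Cons a u)
  then have a: "fst a \<in> K" "fst a \<in> V" using K by auto
  have g: "g \<in> carrier W" using Cons.prems K parabolic_closed(1) by blast
  show ?case
  proof (cases "blocked g (fst a)")
    case True
    note x = wall[OF True]
    have "s (wall g (fst a)) = conjugate (inv g) (s (fst a))"
      using x g a J_in_V by (simp flip: x(2))
    also have "\<dots> \<in> parabolic K"
      using parabolic_conjugate[OF K parabolic_closed(5)[OF K]] Cons.prems a K parabolic_closed(3)
      by simp
    finally have "wall g (fst a) \<in> K" using s_in_parabolic_iff K x(1) J_in_V by blast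
    then show ?thesis using True x Cons by simp
  next
    case False
    then show ?thesis using Cons a K by (simp add: parabolic_closed)
  qed
qed simp

text \<open>At a blocked letter \<open>g \<otimes> s i = s x \<otimes> g\<close>, so the output
  letter \<open>x\<close> is precisely what passes to the left of the walk. From a reduced start
  this is the factorisation into an element of \<open>parabolic J\<close> and a reduced one.\<close>

lemma walk_trace:
  "u \<in> words V \<Longrightarrow> g \<in> carrier W \<Longrightarrow>
    g \<otimes> word_eval W s u = word_eval W s (trace u g) \<otimes> walk u g"
proof (induction u arbitrary: g)
  case (Cons a u)
  then have a: "fst a \<in> V" and u: "u \<in> words V" by auto
  show ?case
  proof (cases "blocked g (fst a)")
    case True
    note x = wall[OF True]
    let ?x = "wall g (fst a)"
    have xV: "?x \<in> V" using x J_in_V by blast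
    have "g \<otimes> word_eval W s (a # u) = (g \<otimes> s (fst a)) \<otimes> word_eval W s u"
      using a u Cons.prems by (simp add: m_assoc)
    also have "g \<otimes> s (fst a) = s ?x \<otimes> g"
      using mult_conjugate[of g "s ?x"] x xV Cons.prems by simp
    also have "(s ?x \<otimes> g) \<otimes> word_eval W s u = s ?x \<otimes> (g \<otimes> word_eval W s u)"
      using xV u Cons.prems by (simp add: m_assoc)
    also have "\<dots> = s ?x \<otimes> (word_eval W s (trace u g) \<otimes> walk u g)"
      using Cons u by simp
    also have "\<dots> = word_eval W s (trace (a # u) g) \<otimes> walk (a # u) g"
      using True xV u Cons.prems by (simp add: m_assoc trace_in_words_V walk_closed)
    finally show ?thesis .
  next
    case False
    have "g \<otimes> word_eval W s (a # u) = (g \<otimes> s (fst a)) \<otimes> word_eval W s u"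
      using a u Cons.prems by (simp add: m_assoc)
    also have "\<dots> = word_eval W s (trace (a # u) g) \<otimes> walk (a # u) g"
      using False Cons.IH[of "g \<otimes> s (fst a)"] u a Cons.prems by simp
    finally show ?thesis .
  qed
qed simp

lemma walk_eq: "u \<in> words V \<Longrightarrow> g \<in> carrier W \<Longrightarrow>
    walk u g = inv (word_eval W s (trace u g)) \<otimes> (g \<otimes> word_eval W s u)"
  using walk_trace[of u g] by (simp add: trace_in_words_V walk_closed inv_solve_left)

text \<open>At the chamber 1 every letter of \<open>J\<close> is blocked by its own wall, so the
  walk never leaves 1.\<close>

lemma trace_J: "u \<in> words J \<Longrightarrow> trace u \<one> = u"
proof (induction u)
  case (Cons a u)
  then have a: "fst a \<in> J" "fst a \<in> V" using J_in_V by auto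
  have "blocked \<one> (fst a)" "wall \<one> (fst a) = fst a"
    using wall_unique[of \<one> "fst a" "fst a"] a by auto
  then show ?case using Cons by simp
qed simp

text \<open>The chambers \<open>g\<close> and \<open>g \<otimes> s i\<close> share the wall between
  them, so either both letters are blocked by the same wall or the second step undoes the
  first.\<close>

lemma cancelling_letters:
  assumes i: "i \<in> V" and g: "g \<in> carrier W"
  shows "walk [(i, e), (i, e')] g = g"
    and "trace [(i, e), (i, e')] g =
      (if blocked g i then [(wall g i, e), (wall g i, e')] else [])"
proof -
  have "conjugate (g \<otimes> s i) (s x) = s i \<longleftrightarrow> conjugate g (s x) = s i" if "x \<in> J" for x
    using i g J_in_V[OF that] by (simp add: conjugate_mult conjugate_s_eq_iff)
  then have "blocked (g \<otimes> s i) i \<longleftrightarrow> blocked g i"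
    by (simp add: blocked_def)
  then show "walk [(i, e), (i, e')] g = g" "trace [(i, e), (i, e')] g =
      (if blocked g i then [(wall g i, e), (wall g i, e')] else [])"
    using i g by (auto simp: m_assoc s_square)
qed

text \<open>Being stopped at a wall replaces the rest of the gallery by its mirror image, and the
  mirror fixes its own wall. So \<open>x\<close> is output as often as the unobstructed gallery
  would cross the wall of \<open>x\<close>. The test \<open>x \<in> J\<close> in the count lets any
  \<open>x\<close> serve when the residue contains no wall of \<open>J\<close>.\<close>

lemma trace_alternating_one_wall:
  assumes "i \<in> V" "j \<in> V" "g \<in> carrier W"
    and "\<And>y. y \<in> J \<Longrightarrow> conjugate g (s y) \<in> parabolic {i, j} \<Longrightarrow> y = x"
  shows "trace (alternating i j n) g =
    replicate (card {k. k < n \<and> x \<in> J \<and> conjugate g (s x) = dihedral_reflection i j k}) (letter x)"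
  using assms
proof (induction n arbitrary: i j g)
  case (Suc n)
  have ij: "{i, j} \<subseteq> V" "{j, i} = {i, j}" using Suc.prems by auto
  have si: "s i \<in> parabolic {i, j}" using parabolic_closed(3)[OF ij(1)] by simp
  show ?case
  proof (cases "blocked g i")
    case True
    note w = wall[OF True]
    have wx: "wall g i = x" using Suc.prems(4)[OF w(1)] w(2) si by simp
    \<comment> \<open>The walk continues with \<open>j\<close> at \<open>g\<close>, the count
      continues behind the wall; conjugation by \<open>s i\<close> exchanges these views and fixes
      \<open>s i\<close>.\<close>
    have "s i = dihedral_reflection i j (Suc k) \<longleftrightarrow> s i = dihedral_reflection j i k" for k
    proof -
      have "conjugate (s i) (dihedral_reflection j i k) = s i \<longleftrightarrow> dihedral_reflection j i k = s i"
        using Suc.prems(1,2) by (simp add: conjugate_s_eq_iff)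
      then show ?thesis
        unfolding conjugate_dihedral_reflection[OF Suc.prems(1,2)] by metis
    qed
    moreover have "trace (alternating j i n) g = replicate
        (card {k. k < n \<and> x \<in> J \<and> conjugate g (s x) = dihedral_reflection j i k}) (letter x)"
      by (rule Suc.IH[OF Suc.prems(2,1,3)]) (metis Suc.prems(4) ij(2))
    ultimately show ?thesis
      using True w wx Suc.prems(1,2) by (simp add: card_less_Suc_shift)
  next
    case False
    have conj: "conjugate (g \<otimes> s i) (s y) = conjugate (s i) (conjugate g (s y))" if "y \<in> J" for y
      using Suc.prems(1-3) J_in_V[OF that] by (simp add: conjugate_mult)
    have one: "y = x" if "y \<in> J" "conjugate (g \<otimes> s i) (s y) \<in> parabolic {i, j}" for y
    proof -
      have "conjugate (s i) (conjugate (s i) (conjugate g (s y))) \<in> parabolic {i, j}"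
        using that parabolic_conjugate[OF ij(1) si] by (simp add: conj)
      then have "conjugate g (s y) \<in> parabolic {i, j}"
        using Suc.prems(1-3) J_in_V[OF that(1)] conjugate_conjugate_inv(1)[of "s i" "conjugate g (s y)"]
        by simp
      then show ?thesis using Suc.prems(4) that(1) by blast
    qed
    have "trace (alternating j i n) (g \<otimes> s i) = replicate
        (card {k. k < n \<and> x \<in> J \<and> conjugate (g \<otimes> s i) (s x) = dihedral_reflection j i k}) (letter x)"
      by (rule Suc.IH[OF Suc.prems(2,1)]) (use Suc.prems(1,3) one ij(2) in \<open>simp, metis\<close>)
    moreover have "x \<in> J \<and> conjugate (g \<otimes> s i) (s x) = dihedral_reflection j i k \<longleftrightarrow>
        x \<in> J \<and> conjugate g (s x) = dihedral_reflection i j (Suc k)" for k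
      using Suc.prems(1-3) J_in_V
      by (auto simp: conj conjugate_s_eq_iff conjugate_dihedral_reflection)
    moreover have "\<not> (x \<in> J \<and> conjugate g (s x) = s i)" using False by (auto simp: blocked_def)
    ultimately show ?thesis
      using False Suc.prems(1,2) by (auto simp: card_less_Suc_shift)
  qed
qed simp

text \<open>
  The element \<open>p\<close> below is the projection of \<open>1\<close> to the residue of type \<open>{i, j}\<close> through \<open>g\<close>. A wall
  of \<open>J\<close> that crosses this residue has to be a wall of \<open>p\<close>.
\<close>

lemma two_walls:
  assumes ij: "i \<in> V" "j \<in> V" "i \<noteq> j" and g: "reduced g"
    and xy: "x \<in> J" "y \<in> J" "x \<noteq> y"
      "conjugate g (s x) \<in> parabolic {i, j}" "conjugate g (s y) \<in> parabolic {i, j}"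
  shows "conjugate g (s x) = s i \<and> conjugate g (s y) = s j \<or>
    conjugate g (s x) = s j \<and> conjugate g (s y) = s i"
proof -
  let ?D = "parabolic {i, j}"
  have sub: "{i, j} \<subseteq> V" using ij by simp
  note D = parabolic_closed[OF sub]
  have gW: "g \<in> carrier W" using g reduced_closed by blast
  have V: "parabolic V = carrier W" using parabolic_eq[of V] carrier_W by simp
  obtain d where d: "d \<in> ?D"
    and min: "\<And>d'. d' \<in> ?D \<Longrightarrow> parabolic_length V (g \<otimes> d) \<le> parabolic_length V (g \<otimes> d')"
    using ex_has_least_nat[of "\<lambda>d. d \<in> ?D" \<one> "\<lambda>d. parabolic_length V (g \<otimes> d)"] D(2) by blast
  define p where "p = g \<otimes> d"
  have dW: "d \<in> carrier W" using d D(1) by blast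
  have p: "p \<in> carrier W" using gW dW by (simp add: p_def)
  \<comment> \<open>Reflecting \<open>p\<close> in a wall of the residue stays within the residue
    and, for an inversion of \<open>p\<close>, contradicts the choice of \<open>d\<close>.\<close>
  have no_inv: "\<not> inversion p t" if t: "t \<in> carrier W" "conjugate p t \<in> ?D" for t
  proof
    assume "inversion p t"
    then have "parabolic_length V (t \<otimes> p) < parabolic_length V p"
      using inversion_decreases_length[of V p t] p t V by simp
    also have "t \<otimes> p = g \<otimes> (d \<otimes> conjugate p t)"
      using mult_conjugate[OF p t(1)] gW dW p t by (simp add: p_def m_assoc)
    finally show False using min[of "d \<otimes> conjugate p t"] D(4)[OF d t(2)] by (simp add: p_def)
  qed
  have wall_p: "\<exists>a\<in>{i, j}. conjugate p (s z) = s a"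
    if z: "z \<in> J" "conjugate g (s z) \<in> ?D" for z
  proof -
    have zV: "z \<in> V" using z J_in_V by blast
    define \<rho> where "\<rho> = conjugate p (s z)"
    have \<rho>D: "\<rho> \<in> ?D"
      using parabolic_conjugate[OF sub d z(2)] gW dW zV by (simp add: \<rho>_def p_def conjugate_mult)
    have \<rho>: "\<rho> \<in> carrier W" using \<rho>D D(1) by blast
    have "s z \<noteq> \<one>" using s_in_parabolic_iff[of z "{}"] zV parabolic_closed(2)[of "{}"] by auto
    moreover have "s z = conjugate (inv p) \<rho>" using p zV by (simp add: \<rho>_def)
    ultimately have "\<rho> \<noteq> \<one>" using p by (auto simp: conjugate_def)
    then obtain a where a: "a \<in> {i, j}" "inversion \<rho> (s a)"
      using parabolic_descent[OF sub \<rho>D] by blast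
    have aV: "a \<in> V" using a ij by blast
    \<comment> \<open>The wall \<open>\<tau>\<close> of \<open>p\<close> is an inversion of
      \<open>s z \<otimes> p = p \<otimes> \<rho>\<close>. By the cocycle rule it is either
      \<open>s z\<close> itself or becomes an inversion of \<open>p\<close> after conjugation by
      \<open>s z\<close>; that conjugate is again a wall of the residue, so \<open>no_inv\<close>
      excludes it.\<close>
    define \<tau> where "\<tau> = conjugate (inv p) (s a)"
    have \<tau>: "\<tau> \<in> carrier W" "conjugate p \<tau> = s a" using p aV by (simp_all add: \<tau>_def)
    have eq: "s z \<otimes> p = p \<otimes> \<rho>" using mult_conjugate[of p "s z"] p zV by (simp add: \<rho>_def)
    have "\<not> inversion p \<tau>" using no_inv[OF \<tau>(1)] D(3) a(1) \<tau>(2) by simp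
    then have "inversion (s z \<otimes> p) \<tau>"
      unfolding eq using p \<rho> \<tau> a by (simp add: inversion_mult)
    moreover have "\<not> inversion p (conjugate (s z) \<tau>)"
    proof (rule no_inv)
      have "conjugate p (conjugate (s z) \<tau>) = conjugate \<rho> (s a)"
        using conjugate_mult[of "s z" p \<tau>] conjugate_mult[of p \<rho> \<tau>] p \<rho> \<tau> zV eq by simp
      then show "conjugate p (conjugate (s z) \<tau>) \<in> ?D"
        using parabolic_conjugate[OF sub \<rho>D] D(3) a(1) by simp
    qed (use \<tau> zV in simp)
    ultimately have "\<tau> = s z" using p \<tau> zV by (simp add: inversion_mult inversion_s)
    then show ?thesis using \<tau>(2) a(1) by blast
  qed
  obtain a b where ab: "a \<in> {i, j}" "b \<in> {i, j}" "conjugate p (s x) = s a" "conjugate p (s y) = s b"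
    using wall_p xy by metis
  have "a \<noteq> b"
  proof
    assume "a = b"
    then have "s x = s y"
      using ab p xy J_in_V ij by (metis conjugate_conjugate_inv(2) s_closed)
    then show False using inj_s xy J_in_V by blast
  qed
  \<comment> \<open>Both walls of the residue at \<open>p\<close> are walls of \<open>J\<close>. A
    gallery from \<open>p\<close> to a different chamber \<open>g\<close> of the residue could begin
    only by crossing one of them, which would make it an inversion of the reduced
    \<open>g\<close>.\<close>
  have "inv d = \<one>"
  proof (rule ccontr)
    assume "inv d \<noteq> \<one>"
    then obtain c where c: "c \<in> {i, j}" "inversion (inv d) (s c)"
      using parabolic_descent[OF sub D(5)[OF d]] by blast
    then obtain z where z: "z \<in> J" "conjugate p (s z) = s c"
      using ab xy \<open>a \<noteq> b\<close> by auto
    have "g = p \<otimes> inv d" using gW dW by (simp add: p_def m_assoc)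
    moreover have "\<not> inversion p (s z)" using no_inv[of "s z"] z D(3) c(1) J_in_V by simp
    ultimately have "inversion g (s z)"
      using p dW c z J_in_V by (simp add: inversion_mult)
    then show False using g z(1) by (simp add: reduced_def)
  qed
  then have "d = \<one>" using dW by (metis inv_inv inv_one)
  then have "p = g" using gW by (simp add: p_def)
  then show ?thesis using ab \<open>a \<noteq> b\<close> by auto
qed

text \<open>Every letter is blocked, so \<open>g\<close> never moves and the letters are merely
  renamed.\<close>

lemma trace_alternating_two_walls:
  assumes "i \<in> V" "j \<in> V" "g \<in> carrier W" "x \<in> J" "y \<in> J"
    and "conjugate g (s x) = s i" "conjugate g (s y) = s j"
  shows "trace (alternating i j n) g = alternating x y n"
  using assms
proof (induction n arbitrary: i j x y)
  case (Suc n)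
  then show ?case using wall_unique[of g i x] by simp
qed simp

text \<open>Conjugation by \<open>g\<close> takes \<open>s x \<otimes> s y\<close> to
  \<open>s i \<otimes> s j\<close>, so both have the same order, and the orders are exactly the
  labels. This supplies in \<open>P\<close> the braid relation for \<open>x\<close> and
  \<open>y\<close>.\<close>

lemma label_conjugate:
  assumes ij: "i \<in> V" "j \<in> V" "i \<noteq> j" and g: "g \<in> carrier W" and xy: "x \<in> V" "y \<in> V"
    and c: "conjugate g (s x) = s i" "conjugate g (s y) = s j" and k: "m i j = enat k"
  shows "x \<noteq> y" "m x y = enat k"
proof -
  show "x \<noteq> y" using c ij inj_s by auto
  have "2 \<le> m i j" using m ij unfolding coxeter_matrix_def by blast
  have prod: "conjugate g (s x \<otimes> s y) = s i \<otimes> s j"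
    using c g xy by (simp add: conjugate_def m_assoc flip: c) (simp flip: m_assoc)
  have pow: "conjugate g ((s x \<otimes> s y) [^] n) = (s i \<otimes> s j) [^] n" for n :: nat
    using prod g xy by (simp add: conjugate_pow)
  have iff: "(s x \<otimes> s y) [^] n = \<one> \<longleftrightarrow> (s i \<otimes> s j) [^] n = \<one>" for n :: nat
    using pow[of n] g xy conjugate_eq_iff[of g "(s x \<otimes> s y) [^] n" \<one>]
    by (auto simp: conjugate_def)
  have "k > 0" using \<open>2 \<le> m i j\<close> k by (cases k) (auto simp: zero_enat_def[symmetric])
  then obtain l where l: "m x y = enat l" "l dvd k"
    using s_order[OF xy \<open>x \<noteq> y\<close>, of k] iff s_pow[OF ij(1,2) k] by blast
  have "l > 0" using \<open>k > 0\<close> l(2) by (cases l) auto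
  then have "k dvd l"
    using s_order[OF ij, of l] iff s_pow[OF xy l(1)] k by auto
  then show "m x y = enat k" using l dvd_antisym by blast
qed

text \<open>With at most one wall of \<open>J\<close> in the residue both sides output the same
  power of one letter, since the galleries cross the same walls in opposite order. With two walls
  they output the two sides of a braid relation over \<open>J\<close>.\<close>

lemma braid_invariance:
  assumes ij: "i \<in> V" "j \<in> V" "i \<noteq> j" and k: "m i j = enat k" and g: "reduced g"
  shows "word_eval P r (trace (alternating i j k) g) = word_eval P r (trace (alternating j i k) g)"
    and "walk (alternating i j k) g = walk (alternating j i k) g"
proof -
  have gW: "g \<in> carrier W" using g reduced_closed by blast
  define B where "B = {x \<in> J. conjugate g (s x) \<in> parabolic {i, j}}"
  have ji: "{j, i} = {i, j}" by auto
  have evW: "word_eval W s (alternating i j k) = word_eval W s (alternating j i k)"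
    using relations_W ij k
    unfolding mixed_relations_def relations_hold_Un relations_hold_artin_tits by blast
  \<comment> \<open>The equality in \<open>W\<close> is carried along because the end of the walk is
    computed from the value of the output in \<open>W\<close>.\<close>
  have "word_eval P r (trace (alternating i j k) g) = word_eval P r (trace (alternating j i k) g) \<and>
    word_eval W s (trace (alternating i j k) g) = word_eval W s (trace (alternating j i k) g)"
  proof (cases "\<exists>x. B \<subseteq> {x}")
    case True
    then obtain x where x: "B \<subseteq> {x}" by blast
    have "{l. l < k \<and> x \<in> J \<and> conjugate g (s x) = dihedral_reflection i j l} =
        {l. l < k \<and> x \<in> J \<and> conjugate g (s x) = dihedral_reflection j i (k - Suc l)}"
      using dihedral_reflection_reverse[OF ij(1,2) k] by auto
    then have "card {l. l < k \<and> x \<in> J \<and> conjugate g (s x) = dihedral_reflection i j l} =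
        card {l. l < k \<and> x \<in> J \<and> conjugate g (s x) = dihedral_reflection j i l}"
      using card_less_reverse[of k "\<lambda>l. x \<in> J \<and> conjugate g (s x) = dihedral_reflection j i l"]
      by simp
    moreover have "trace (alternating i j k) g = replicate
        (card {l. l < k \<and> x \<in> J \<and> conjugate g (s x) = dihedral_reflection i j l}) (letter x)"
      using x ij gW by (intro trace_alternating_one_wall) (auto simp: B_def)
    moreover have "trace (alternating j i k) g = replicate
        (card {l. l < k \<and> x \<in> J \<and> conjugate g (s x) = dihedral_reflection j i l}) (letter x)"
      using x ij gW by (intro trace_alternating_one_wall) (auto simp: B_def ji)
    ultimately show ?thesis by simp
  next
    case False
    then obtain x0 y0 where "x0 \<in> B" "y0 \<in> B" "x0 \<noteq> y0" by blast
    then have "x0 \<in> J" "y0 \<in> J" "conjugate g (s x0) = s i \<and> conjugate g (s y0) = s j \<or>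
        conjugate g (s x0) = s j \<and> conjugate g (s y0) = s i"
      using two_walls[OF ij g, of x0 y0] by (auto simp: B_def)
    then obtain x y where xy: "x \<in> J" "y \<in> J" "conjugate g (s x) = s i" "conjugate g (s y) = s j"
      by blast
    have xyV: "x \<in> V" "y \<in> V" using xy J_in_V by auto
    have "x \<noteq> y" "m x y = enat k" using label_conjugate[OF ij gW xyV xy(3,4) k] by auto
    then have "word_eval P r (alternating x y k) = word_eval P r (alternating y x k)"
      using word_eval_P_alternating xyV by blast
    moreover from this have "word_eval W s (alternating x y k) = word_eval W s (alternating y x k)"
      using word_eval_P_imp_W xyV by simp
    ultimately show ?thesis
      using trace_alternating_two_walls[of i j g x y k] trace_alternating_two_walls[of j i g y x k]
        ij gW xy by simp
  qed
  then show "word_eval P r (trace (alternating i j k) g) = word_eval P r (trace (alternating j i k) g)"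
    "walk (alternating i j k) g = walk (alternating j i k) g"
    using ij gW evW by (simp_all add: walk_eq)
qed

text \<open>Well-definedness of the retraction on \<open>P\<close>. Cancelling pairs output
  cancelling pairs or nothing. For a square relation the output letter is conjugate in
  \<open>W\<close> to one in \<open>Q\<close>, hence lies in \<open>Q\<close> itself and also
  squares to 1 in \<open>P\<close>.\<close>

lemma trace_word_cong:
  assumes "(u, v) \<in> word_cong V (mixed_relations V m Q)"
  shows "reduced g \<Longrightarrow> walk u g = walk v g \<and> word_eval P r (trace u g) = word_eval P r (trace v g)"
  using assms
proof (induction arbitrary: g rule: word_cong.induct)
  case (append u u' v v')
  have "u' \<in> words V" using append.hyps(1) word_cong_words by blast
  then have "reduced (walk u' g)" using walk_reduced append.prems by blast
  then show ?case
    using append.IH append.prems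
    by (simp add: walk_append trace_append word_eval_P_append trace_in_words_V)
next
  case (cancel i e)
  then have g: "g \<in> carrier W" using reduced_closed by blast
  show ?case
    using cancelling_letters[OF cancel.hyps(1) g] wall(1)[of g i] J_in_V
    by (cases "blocked g i"; cases e) (simp_all del: walk.simps(2) trace.simps(2))
next
  case (rel u v)
  then have g: "g \<in> carrier W" using reduced_closed by blast
  from rel consider (braid) i j n where "i \<in> V" "j \<in> V" "i \<noteq> j" "m i j = enat n"
      "u = alternating i j n" "v = alternating j i n"
    | (square) i where "i \<in> Q" "u = [letter i, letter i]" "v = []"
    unfolding mixed_relations_def artin_tits_relations_def square_relations_def by blast
  then show ?case
  proof cases
    case braid
    then show ?thesis using braid_invariance rel.prems by blast
  next
    case square
    then have iV: "i \<in> V" using Q(1) by blast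
    have "r (wall g i) \<otimes>\<^bsub>P\<^esub> r (wall g i) = \<one>\<^bsub>P\<^esub>" if "blocked g i"
      using wall[OF that] conjugate_in_Q[OF g _ iV] square(1) J_in_V r_square by blast
    then show ?thesis
      using square cancelling_letters[OF iV g] wall(1)[of g i] J_in_V
      by (cases "blocked g i") (simp_all del: walk.simps(2) trace.simps(2))
  qed
qed auto

end

section \<open>Standard subgroups of \<open>P\<close>\<close>

definition parabolic_P :: "'x set \<Rightarrow> 'p set"
  where "parabolic_P J = generate P (r ` J)"

lemma parabolic_P_eq: "J \<subseteq> V \<Longrightarrow> parabolic_P J = word_eval P r ` words J"
  unfolding parabolic_P_def using r_Pi by (intro P.generate_eq_word_eval) auto

lemma r_notin_parabolic_P:
  assumes "i \<in> V" "J \<subseteq> V" "i \<notin> J"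
  shows "r i \<notin> parabolic_P J"
proof
  assume "r i \<in> parabolic_P J"
  then obtain w where w: "w \<in> words J" "r i = word_eval P r w"
    unfolding parabolic_P_eq[OF assms(2)] by blast
  then have "word_eval W s [letter i] = word_eval W s w"
    using words_mono[OF assms(2)] assms(1) by (intro word_eval_P_imp_W) auto
  then have "s i \<in> parabolic J" using w(1) assms(1,2) parabolic_eq by auto
  then show False using s_notin_parabolic assms by blast
qed

text \<open>
  The corresponding property of \<open>W\<close> reduces the claim to factors with trivial image in \<open>W\<close>; reading
  those does not move the gallery of the retraction, so the retraction is multiplicative on them.
\<close>

proposition parabolic_P_inter_product:
  assumes JKL: "J \<subseteq> V" "K \<subseteq> V" "L \<subseteq> V"
    and yz: "y \<in> parabolic_P K" "z \<in> parabolic_P L" "y \<otimes>\<^bsub>P\<^esub> z \<in> parabolic_P J"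
  shows "\<exists>a \<in> parabolic_P (J \<inter> K). \<exists>b \<in> parabolic_P (J \<inter> L). y \<otimes>\<^bsub>P\<^esub> z = a \<otimes>\<^bsub>P\<^esub> b"
proof -
  let ?e = "word_eval W s" and ?f = "word_eval P r"
  have inW: "?e (inverse_word w) = inv (?e w)" and inP: "?f (inverse_word w) = inv\<^bsub>P\<^esub> (?f w)"
    if "w \<in> words V" for w
    using that word_eval_inverse_word[OF s_Pi] P.word_eval_inverse_word[OF r_Pi] by auto
  have mono: "w \<in> words V" if "w \<in> words J \<or> w \<in> words K \<or> w \<in> words L" for w
    using that JKL words_mono by blast
  obtain uy where uy: "uy \<in> words K" "y = ?f uy" using yz(1) parabolic_P_eq[OF JKL(2)] by blast
  obtain uz where uz: "uz \<in> words L" "z = ?f uz" using yz(2) parabolic_P_eq[OF JKL(3)] by blast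
  obtain ux where ux: "ux \<in> words J" "y \<otimes>\<^bsub>P\<^esub> z = ?f ux" using yz(3) parabolic_P_eq[OF JKL(1)] by blast
  have V: "uy \<in> words V" "uz \<in> words V" "ux \<in> words V" using uy uz ux mono by auto
  have fux: "?f ux = ?f uy \<otimes>\<^bsub>P\<^esub> ?f uz" using ux uy uz by simp
  then have "?f ux = ?f (uy @ uz)" using V by (simp add: word_eval_P_append)
  then have eux: "?e ux = ?e uy \<otimes> ?e uz"
    using word_eval_P_imp_W[of ux "uy @ uz"] V by (simp add: word_eval_W_append)
  have "?e uy \<in> parabolic K" "?e uz \<in> parabolic L" "?e uy \<otimes> ?e uz \<in> parabolic J"
    using uy uz ux JKL parabolic_eq by (auto simp flip: eux)
  from parabolic_inter_product[OF JKL this] obtain a b where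
    "a \<in> parabolic (J \<inter> K)" "b \<in> parabolic (J \<inter> L)" "?e uy \<otimes> ?e uz = a \<otimes> b" by blast
  moreover have sub: "J \<inter> K \<subseteq> V" "J \<inter> L \<subseteq> V" "K \<inter> L \<subseteq> V" using JKL by auto
  ultimately obtain \<alpha> \<beta> where \<alpha>: "\<alpha> \<in> words (J \<inter> K)" and \<beta>: "\<beta> \<in> words (J \<inter> L)"
    and eq: "?e uy \<otimes> ?e uz = ?e \<alpha> \<otimes> ?e \<beta>"
    using parabolic_eq by auto
  have \<alpha>\<beta>: "\<alpha> \<in> words J" "\<alpha> \<in> words K" "\<beta> \<in> words J" "\<beta> \<in> words L" "\<alpha> \<in> words V" "\<beta> \<in> words V"
    using \<alpha> \<beta> mono by (auto simp: words_Int)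
  \<comment> \<open>The image of \<open>y\<close> differs from its factor by an element lying over
    both \<open>K\<close> and \<open>L\<close>. A word \<open>\<gamma>\<close> over
    \<open>K \<inter> L\<close> can lift it, and inserting \<open>\<gamma>\<close> between
    \<open>y\<close> and \<open>z\<close> changes neither membership.\<close>
  have c: "inv (?e \<alpha>) \<otimes> ?e uy = ?e \<beta> \<otimes> inv (?e uz)"
  proof -
    have "inv (?e \<alpha>) \<otimes> ?e uy = inv (?e \<alpha>) \<otimes> (?e uy \<otimes> ?e uz) \<otimes> inv (?e uz)"
      using V \<alpha>\<beta> by (simp add: m_assoc)
    also have "\<dots> = ?e \<beta> \<otimes> inv (?e uz)"
      unfolding eq using V \<alpha>\<beta> by (simp add: m_assoc flip: m_assoc[of "inv (?e \<alpha>)" "?e \<alpha>"])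
    finally show ?thesis .
  qed
  have "inv (?e \<alpha>) \<otimes> ?e uy \<in> parabolic K"
    using JKL \<alpha>\<beta> uy parabolic_eq by (intro parabolic_closed(4,5)) auto
  moreover have "inv (?e \<alpha>) \<otimes> ?e uy \<in> parabolic L"
    unfolding c using JKL \<alpha>\<beta> uz parabolic_eq by (intro parabolic_closed(4,5)) auto
  ultimately have "inv (?e \<alpha>) \<otimes> ?e uy \<in> parabolic (K \<inter> L)"
    by (rule parabolic_inter[OF JKL(2,3)])
  then obtain \<gamma> where \<gamma>: "\<gamma> \<in> words (K \<inter> L)" "?e \<gamma> = inv (?e \<alpha>) \<otimes> ?e uy"
    unfolding parabolic_eq[OF sub(3)] by (metis imageE)
  have \<gamma>KL: "\<gamma> \<in> words K" "\<gamma> \<in> words L" "\<gamma> \<in> words V" using \<gamma>(1) mono by (auto simp: words_Int)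
  \<comment> \<open>Chosen so that \<open>x' = y' z'\<close> holds in \<open>P\<close> while
    \<open>y'\<close> and \<open>z'\<close> have trivial image in \<open>W\<close> and remain words
    over \<open>K\<close> and \<open>L\<close>.\<close>
  define y' where "y' = inverse_word \<alpha> @ uy @ inverse_word \<gamma>"
  define z' where "z' = \<gamma> @ uz @ inverse_word \<beta>"
  define x' where "x' = inverse_word \<alpha> @ ux @ inverse_word \<beta>"
  have in_words: "y' \<in> words K" "z' \<in> words L" "x' \<in> words J"
    using \<alpha>\<beta> \<gamma>KL uy uz ux by (simp_all add: y'_def z'_def x'_def)
  then have in_V: "y' \<in> words V" "z' \<in> words V" "x' \<in> words V" using mono by auto
  have ey': "?e y' = \<one>"
    using V \<alpha>\<beta> \<gamma>KL by (simp add: y'_def word_eval_W_append inW \<gamma>(2) r_inv flip: m_assoc)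
  have "?f x' = ?f (y' @ z')"
  proof -
    have "?f (y' @ z') =
        inv\<^bsub>P\<^esub> (?f \<alpha>) \<otimes>\<^bsub>P\<^esub> (?f uy \<otimes>\<^bsub>P\<^esub> (inv\<^bsub>P\<^esub> (?f \<gamma>) \<otimes>\<^bsub>P\<^esub> (?f \<gamma> \<otimes>\<^bsub>P\<^esub> (?f uz \<otimes>\<^bsub>P\<^esub> inv\<^bsub>P\<^esub> (?f \<beta>)))))"
      using V \<alpha>\<beta> \<gamma>KL by (simp add: y'_def z'_def word_eval_P_append inP P.m_assoc)
    also have "\<dots> = inv\<^bsub>P\<^esub> (?f \<alpha>) \<otimes>\<^bsub>P\<^esub> (?f uy \<otimes>\<^bsub>P\<^esub> (?f uz \<otimes>\<^bsub>P\<^esub> inv\<^bsub>P\<^esub> (?f \<beta>)))"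
      using V \<alpha>\<beta> \<gamma>KL by (simp flip: P.m_assoc[of "inv\<^bsub>P\<^esub> (?f \<gamma>)" "?f \<gamma>"])
    also have "\<dots> = ?f x'"
      using V \<alpha>\<beta> by (simp add: x'_def word_eval_P_append inP fux P.m_assoc)
    finally show ?thesis by simp
  qed
  then have "(x', y' @ z') \<in> word_cong V (mixed_relations V m Q)"
    using word_eval_P_eq_iff in_V by simp
  from trace_word_cong[OF JKL(1) this reduced_one[OF JKL(1)]]
  have trace: "?f (trace J x' \<one>) = ?f (trace J y' \<one> @ trace J z' (walk J y' \<one>))"
    by (simp add: trace_append[OF JKL(1)])
  have "walk J y' \<one> = \<one>"
  proof (rule reduced_parabolic[OF JKL(1)])
    show "reduced J (walk J y' \<one>)"
      by (rule walk_reduced[OF JKL(1) in_V(1) reduced_one[OF JKL(1)]])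
    have "walk J y' \<one> = inv (?e (trace J y' \<one>))"
      using walk_eq[OF JKL(1) in_V(1) one_closed] ey' trace_in_words_V[OF JKL(1)] by simp
    then show "walk J y' \<one> \<in> parabolic J"
      using trace_in_words[OF JKL(1)] parabolic_eq[OF JKL(1)] parabolic_closed(5)[OF JKL(1)] by simp
  qed
  then have fx': "?f x' = ?f (trace J y' \<one>) \<otimes>\<^bsub>P\<^esub> ?f (trace J z' \<one>)"
    using trace trace_J[OF JKL(1) in_words(3)] trace_in_words_V[OF JKL(1)]
    by (simp add: word_eval_P_append)
  have tr: "trace J y' \<one> \<in> words (J \<inter> K)" "trace J z' \<one> \<in> words (J \<inter> L)"
    using trace_in_parabolic[OF JKL(1,2) in_words(1)] trace_in_parabolic[OF JKL(1,3) in_words(2)]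
      parabolic_closed(2) JKL by auto
  then have trV: "trace J y' \<one> \<in> words V" "trace J z' \<one> \<in> words V"
    using words_mono[OF sub(1)] words_mono[OF sub(2)] by auto
  \<comment> \<open>Undoes the corrections. The lifts \<open>\<alpha>\<close> and
    \<open>\<beta>\<close> join the outputs of \<open>y'\<close> and \<open>z'\<close>, whose
    letters already lie in \<open>J \<inter> K\<close> and \<open>J \<inter> L\<close>.\<close>
  have "y \<otimes>\<^bsub>P\<^esub> z = ?f \<alpha> \<otimes>\<^bsub>P\<^esub> ?f x' \<otimes>\<^bsub>P\<^esub> ?f \<beta>"
  proof -
    have "?f \<alpha> \<otimes>\<^bsub>P\<^esub> ?f x' \<otimes>\<^bsub>P\<^esub> ?f \<beta> =
        ?f \<alpha> \<otimes>\<^bsub>P\<^esub> (inv\<^bsub>P\<^esub> (?f \<alpha>) \<otimes>\<^bsub>P\<^esub> (?f ux \<otimes>\<^bsub>P\<^esub> (inv\<^bsub>P\<^esub> (?f \<beta>) \<otimes>\<^bsub>P\<^esub> ?f \<beta>)))"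
      using V \<alpha>\<beta> by (simp add: x'_def word_eval_P_append inP P.m_assoc)
    also have "\<dots> = ?f ux"
      using V \<alpha>\<beta> by (simp flip: P.m_assoc[of "?f \<alpha>" "inv\<^bsub>P\<^esub> (?f \<alpha>)"])
    finally show ?thesis using ux by simp
  qed
  also have "\<dots> = ?f (\<alpha> @ trace J y' \<one>) \<otimes>\<^bsub>P\<^esub> ?f (trace J z' \<one> @ \<beta>)"
    using \<alpha>\<beta> trV by (simp add: fx' word_eval_P_append P.m_assoc)
  finally show ?thesis
    using tr \<alpha> \<beta> parabolic_P_eq[OF sub(1)] parabolic_P_eq[OF sub(2)]
    by (intro bexI[where x = "?f (\<alpha> @ trace J y' \<one>)"] bexI[where x = "?f (trace J z' \<one> @ \<beta>)"])
      auto
qed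

end

section \<open>Coset geometries of independent generating families\<close>

lemma (in group) mult_inv_cancel:
  assumes "x \<in> carrier G" "y \<in> carrier G"
  shows "x \<otimes> (inv x \<otimes> y) = y" "inv x \<otimes> (x \<otimes> y) = y"
  using assms by (simp_all flip: m_assoc)

locale independent_generators = group G for G :: "'g monoid" (structure) +
  fixes I :: "'i set" and r :: "'i \<Rightarrow> 'g"
  assumes finite_I: "finite I"
    and r_Pi: "r \<in> I \<rightarrow> carrier G"
    and generate_I: "generate G (r ` I) = carrier G"
    and inter_product: "J \<subseteq> I \<Longrightarrow> K \<subseteq> I \<Longrightarrow> L \<subseteq> I \<Longrightarrow>
      y \<in> generate G (r ` K) \<Longrightarrow> z \<in> generate G (r ` L) \<Longrightarrow> y \<otimes> z \<in> generate G (r ` J) \<Longrightarrow>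
      \<exists>a \<in> generate G (r ` (J \<inter> K)). \<exists>b \<in> generate G (r ` (J \<inter> L)). y \<otimes> z = a \<otimes> b"
    and independent: "i \<in> I \<Longrightarrow> r i \<notin> generate G (r ` (I - {i}))"
begin

abbreviation gen :: "'i set \<Rightarrow> 'g set"
  where "gen J \<equiv> generate G (r ` J)"

abbreviation \<Gamma> :: "('i \<times> 'g set, 'i) incidence_structure"
  where "\<Gamma> \<equiv> standard_coset_system G I r"

definition coset :: "'i \<Rightarrow> 'g \<Rightarrow> 'i \<times> 'g set"
  where "coset i g = (i, g <# gen (I - {i}))"

section \<open>Cosets and incidence\<close>

lemma subgroup_gen: "J \<subseteq> I \<Longrightarrow> subgroup (gen J) G"
  using r_Pi by (intro generate_is_subgroup) auto

lemma gen_closed: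
  assumes "J \<subseteq> I"
  shows "x \<in> gen J \<Longrightarrow> x \<in> carrier G" "\<one> \<in> gen J" "x \<in> gen J \<Longrightarrow> y \<in> gen J \<Longrightarrow> x \<otimes> y \<in> gen J"
    "x \<in> gen J \<Longrightarrow> inv x \<in> gen J"
  using subgroup_gen[OF assms] by (auto simp: subgroup_def)

lemma gen_mono: "J \<subseteq> K \<Longrightarrow> gen J \<subseteq> gen K"
  by (rule mono_generate) auto

lemma r_gen: "j \<in> J \<Longrightarrow> r j \<in> gen J"
  by (auto intro: generate.incl)

lemma mem_lcoset:
  assumes "g \<in> carrier G" "J \<subseteq> I"
  shows "x \<in> g <# gen J \<longleftrightarrow> x \<in> carrier G \<and> inv g \<otimes> x \<in> gen J"
proof
  assume "x \<in> g <# gen J"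
  then obtain h where "h \<in> gen J" "x = g \<otimes> h" by (auto simp: l_coset_def)
  then show "x \<in> carrier G \<and> inv g \<otimes> x \<in> gen J"
    using assms gen_closed(1)[OF assms(2)] by (simp add: mult_inv_cancel)
next
  assume x: "x \<in> carrier G \<and> inv g \<otimes> x \<in> gen J"
  then have "x = g \<otimes> (inv g \<otimes> x)" using assms by (simp add: mult_inv_cancel)
  then show "x \<in> g <# gen J" using x by (auto simp: l_coset_def)
qed

lemma self_in_coset: "g \<in> carrier G \<Longrightarrow> g \<in> snd (coset i g)"
  by (simp add: coset_def mem_lcoset gen_closed(2))

lemma coset_eq:
  assumes g: "g \<in> carrier G" and x: "x \<in> snd (coset i g)"
  shows "coset i g = coset i x"
proof -
  have D: "I - {i} \<subseteq> I" by auto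
  have x': "x \<in> carrier G" "inv g \<otimes> x \<in> gen (I - {i})"
    using x g by (auto simp: coset_def mem_lcoset)
  have "inv g \<otimes> y \<in> gen (I - {i}) \<longleftrightarrow> inv x \<otimes> y \<in> gen (I - {i})" if y: "y \<in> carrier G" for y
  proof
    have "inv x \<otimes> y = inv (inv g \<otimes> x) \<otimes> (inv g \<otimes> y)"
      using g x' y by (simp add: inv_mult_group m_assoc mult_inv_cancel)
    then show "inv x \<otimes> y \<in> gen (I - {i})" if "inv g \<otimes> y \<in> gen (I - {i})"
      using that x'(2) gen_closed[OF D] by simp
    have "inv g \<otimes> y = (inv g \<otimes> x) \<otimes> (inv x \<otimes> y)"
      using g x' y by (simp add: m_assoc mult_inv_cancel)
    then show "inv g \<otimes> y \<in> gen (I - {i})" if "inv x \<otimes> y \<in> gen (I - {i})"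
      using that x'(2) gen_closed[OF D] by simp
  qed
  then have "g <# gen (I - {i}) = x <# gen (I - {i})"
    using g x' D by (intro Set.set_eqI) (auto simp: mem_lcoset)
  then show ?thesis by (simp add: coset_def)
qed

lemma coset_eq_iff:
  assumes "g \<in> carrier G" "h \<in> carrier G"
  shows "coset i g = coset i h \<longleftrightarrow> inv g \<otimes> h \<in> gen (I - {i})"
proof
  assume "coset i g = coset i h"
  then show "inv g \<otimes> h \<in> gen (I - {i})"
    using self_in_coset[OF assms(2), of i] assms by (auto simp: coset_def mem_lcoset)
next
  assume "inv g \<otimes> h \<in> gen (I - {i})"
  then have "h \<in> snd (coset i g)" using assms by (simp add: coset_def mem_lcoset)
  then show "coset i g = coset i h" by (rule coset_eq[OF assms(1)])
qed

lemma fst_coset [simp]: "fst (coset i g) = i"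
  by (simp add: coset_def)

lemma Gamma_simps:
  "elements \<Gamma> = {coset i g | i g. i \<in> I \<and> g \<in> carrier G}"
  "incident \<Gamma> x y \<longleftrightarrow> snd x \<inter> snd y \<noteq> {}"
  "type_of \<Gamma> = fst" "types \<Gamma> = I"
  by (auto simp: standard_coset_system_def coset_incidence_system_def coset_def)

lemma element_coset:
  assumes "e \<in> elements \<Gamma>" "x \<in> snd e"
  shows "x \<in> carrier G" "e = coset (fst e) x" "fst e \<in> I"
proof -
  obtain i g where e: "e = coset i g" "i \<in> I" "g \<in> carrier G" using assms(1) by (auto simp: Gamma_simps)
  show "x \<in> carrier G" using assms(2) e by (auto simp: coset_def mem_lcoset)
  show "e = coset (fst e) x" "fst e \<in> I" using coset_eq[OF e(3), of x i] assms(2) e by auto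
qed

lemma incident_same_type:
  assumes "x \<in> elements \<Gamma>" "y \<in> elements \<Gamma>" "incident \<Gamma> x y" "fst x = fst y"
  shows "x = y"
proof -
  obtain z where "z \<in> snd x" "z \<in> snd y" using assms by (auto simp: Gamma_simps)
  then show ?thesis using element_coset(2)[of x z] element_coset(2)[of y z] assms by simp
qed

lemma incidence_system_Gamma: "incidence_system \<Gamma>"
  unfolding incidence_system_def
proof (intro conjI ballI impI)
  show "type_of \<Gamma> ` elements \<Gamma> \<subseteq> types \<Gamma>"
    by (auto simp: Gamma_simps(1,3,4))
  show "incident \<Gamma> x x" if "x \<in> elements \<Gamma>" for x
    using that self_in_coset by (auto simp: Gamma_simps(1,2))
  show "incident \<Gamma> y x" if "incident \<Gamma> x y" for x y
    using that by (simp add: Gamma_simps(2) Int_commute)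
  show "x = y" if "x \<in> elements \<Gamma>" "y \<in> elements \<Gamma>"
    "incident \<Gamma> x y \<and> type_of \<Gamma> x = type_of \<Gamma> y" for x y
    using incident_same_type that by (simp add: Gamma_simps(3))
qed

text \<open>A Helly property, gained by adding one type \<open>j\<close> at a time: the product
  property splits off from a common element \<open>k\<close> for \<open>K\<close> a right factor in
  \<open>gen (I - {i})\<close>, which does not change the coset of \<open>h\<close>, and leaves an
  element of \<open>gen (I - insert j K)\<close>.\<close>

lemma coset_meets_intersection:
  assumes h: "h \<in> carrier G" and "K \<subseteq> I"
    and "\<And>j. j \<in> K \<Longrightarrow> (h <# gen (I - {i})) \<inter> gen (I - {j}) \<noteq> {}"
  shows "(h <# gen (I - {i})) \<inter> gen (I - K) \<noteq> {}"
proof -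
  have "finite K" using assms(2) finite_I finite_subset by blast
  then show ?thesis
    using assms(2,3)
  proof (induction K rule: finite_induct)
    case empty
    have "h \<in> h <# gen (I - {i})" using self_in_coset[OF h, of i] by (simp add: coset_def)
    then have "h \<in> (h <# gen (I - {i})) \<inter> gen (I - {})" using h by (simp add: generate_I)
    then show ?case by blast
  next
    case (insert j K)
    have sub: "I - {i} \<subseteq> I" "I - {j} \<subseteq> I" "I - K \<subseteq> I" by auto
    obtain k where "k \<in> h <# gen (I - {i})" and k: "k \<in> gen (I - K)"
      using insert.IH insert.prems by (metis Int_emptyI insert_subset insertCI)
    then have kc: "k \<in> carrier G" "inv h \<otimes> k \<in> gen (I - {i})"
      using h by (auto simp: mem_lcoset)
    obtain l where "l \<in> h <# gen (I - {i})" and l: "l \<in> gen (I - {j})"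
      using insert.prems(2)[of j] by blast
    then have lc: "l \<in> carrier G" "inv h \<otimes> l \<in> gen (I - {i})"
      using h by (auto simp: mem_lcoset)
    \<comment> \<open>Both \<open>k\<close> and \<open>l\<close> lie in the same coset of
      \<open>gen (I - {i})\<close>, so \<open>k = l \<otimes> (inv l \<otimes> k)\<close> is a
      product to which \<open>inter_product\<close> applies.\<close>
    have lk: "inv l \<otimes> k = inv (inv h \<otimes> l) \<otimes> (inv h \<otimes> k)"
      using h kc lc by (simp add: inv_mult_group m_assoc mult_inv_cancel)
    have "inv l \<otimes> k \<in> gen (I - {i})"
      unfolding lk using kc lc gen_closed[OF sub(1)] by simp
    moreover have "l \<otimes> (inv l \<otimes> k) = k" using kc lc by (simp add: mult_inv_cancel)
    ultimately obtain a b where a: "a \<in> gen ((I - K) \<inter> (I - {j}))"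
      and b: "b \<in> gen ((I - K) \<inter> (I - {i}))" and "k = a \<otimes> b"
      using inter_product[OF sub(3,2,1) l, of "inv l \<otimes> k"] k by auto
    have b': "b \<in> gen (I - {i})" using b gen_mono[of "(I - K) \<inter> (I - {i})" "I - {i}"] by blast
    have ac: "a \<in> carrier G" using a gen_closed(1)[of "(I - K) \<inter> (I - {j})"] by blast
    have bc: "b \<in> carrier G" using b' gen_closed(1)[OF sub(1)] by blast
    have "inv h \<otimes> a = (inv h \<otimes> k) \<otimes> inv b"
      using \<open>k = a \<otimes> b\<close> ac bc h by (simp add: m_assoc)
    also have "\<dots> \<in> gen (I - {i})" using kc b' gen_closed[OF sub(1)] by simp
    finally have "a \<in> h <# gen (I - {i})" using ac h by (simp add: mem_lcoset)
    moreover have "(I - K) \<inter> (I - {j}) = I - insert j K" by auto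
    ultimately show ?case using a by auto
  qed
qed

text \<open>The case \<open>L = {}\<close>, \<open>z = \<one>\<close> of the product property: the
  second factor is trivial, which turns the property into one about intersections of two
  subgroups.\<close>

lemma gen_Inter:
  assumes "K \<subseteq> I" "x \<in> carrier G" "\<And>j. j \<in> K \<Longrightarrow> x \<in> gen (I - {j})"
  shows "x \<in> gen (I - K)"
proof -
  have "finite K" using assms(1) finite_I finite_subset by blast
  then show ?thesis
    using assms(1,3)
  proof (induction K rule: finite_induct)
    case empty
    then show ?case using assms(2) by (simp add: generate_I)
  next
    case (insert j K)
    have "x \<in> gen (I - {j})" "x \<in> gen (I - K)" using insert by auto
    then obtain a b where ab: "a \<in> gen ((I - K) \<inter> (I - {j}))" "b \<in> gen ((I - K) \<inter> {})" "x = a \<otimes> b"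
      using inter_product[of "I - K" "I - {j}" "{}" x \<one>] assms(2) gen_closed(2)[of "{}"] by auto
    have "a \<in> carrier G" using ab(1) gen_closed(1)[of "(I - K) \<inter> (I - {j})"] by blast
    moreover have "b = \<one>" using ab(2) generate_empty by simp
    ultimately have "x = a" using ab(3) by simp
    moreover have "(I - K) \<inter> (I - {j}) = I - insert j K" by auto
    ultimately show ?case using ab(1) by simp
  qed
qed

section \<open>Flags and the group elements that describe them\<close>

lemma flag_inj_on:
  assumes "flag \<Gamma> F"
  shows "inj_on fst F" "fst ` F \<subseteq> I" "finite F"
proof -
  show "inj_on fst F"
    using assms by (intro inj_onI incident_same_type) (auto simp: flag_def)
  show "fst ` F \<subseteq> I"
    using assms by (auto simp: flag_def Gamma_simps)
  with \<open>inj_on fst F\<close> show "finite F" using finite_I by (metis finite_imageD finite_subset)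
qed

lemma flag_common_element:
  assumes "flag \<Gamma> F"
  obtains g where "g \<in> carrier G" "F = (\<lambda>i. coset i g) ` (fst ` F)"
proof -
  have "\<exists>g\<in>carrier G. \<forall>e\<in>F. g \<in> snd e"
    using flag_inj_on(3)[OF assms] flag_inj_on(1)[OF assms] assms
  proof (induction F rule: finite_induct)
    case (insert e F)
    have flagF: "flag \<Gamma> F" using insert.prems(2) by (simp add: flag_def)
    obtain g where g: "g \<in> carrier G" "\<forall>e\<in>F. g \<in> snd e"
      using insert.IH insert.prems(1) flagF by auto
    obtain i h where e: "e = coset i h" "i \<in> I" "h \<in> carrier G"
      using insert.prems(2) by (auto simp: flag_def Gamma_simps)
    let ?K = "fst ` F"
    have K: "?K \<subseteq> I" by (rule flag_inj_on(2)[OF flagF])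
    \<comment> \<open>Translation by \<open>inv g\<close> turns the elements of the smaller flag,
      which all contain \<open>g\<close>, into the subgroups \<open>gen (I - {j})\<close>
      themselves.\<close>
    define h' where "h' = inv g \<otimes> h"
    have h': "h' \<in> carrier G" using e(3) g(1) by (simp add: h'_def)
    have "(h' <# gen (I - {i})) \<inter> gen (I - {j}) \<noteq> {}" if j: "j \<in> ?K" for j
    proof -
      obtain e' where e': "e' \<in> F" "j = fst e'" using j by blast
      have "e' \<in> elements \<Gamma>" using flagF e' by (auto simp: flag_def)
      from element_coset(2)[OF this, of g] have e'_eq: "e' = coset j g" using g(2) e' by simp
      have "incident \<Gamma> e e'" using insert.prems(2) e' by (simp add: flag_def)
      then have "snd e \<inter> snd e' \<noteq> {}" by (simp add: Gamma_simps(2))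
      then obtain x where x: "x \<in> snd (coset i h)" "x \<in> snd (coset j g)"
        unfolding e(1) e'_eq by blast
      then have x': "x \<in> carrier G" "inv h \<otimes> x \<in> gen (I - {i})" "inv g \<otimes> x \<in> gen (I - {j})"
        using e(3) g(1) by (auto simp: coset_def mem_lcoset)
      have "inv h' \<otimes> (inv g \<otimes> x) = inv h \<otimes> x"
        using e(3) g(1) x' by (simp add: h'_def inv_mult_group m_assoc mult_inv_cancel)
      then have "inv g \<otimes> x \<in> h' <# gen (I - {i})" using h' g(1) x' by (simp add: mem_lcoset)
      with x'(3) show ?thesis by (metis IntI empty_iff)
    qed
    from coset_meets_intersection[OF h' K this] obtain x
      where x: "x \<in> h' <# gen (I - {i})" "x \<in> gen (I - ?K)" by blast
    have xc: "x \<in> carrier G" "inv h' \<otimes> x \<in> gen (I - {i})" using x h' by (auto simp: mem_lcoset)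
    have gx: "g \<otimes> x \<in> carrier G" using g(1) xc by simp
    have "inv h \<otimes> (g \<otimes> x) = inv h' \<otimes> x"
      using e(3) g(1) xc by (simp add: h'_def inv_mult_group m_assoc)
    then have "g \<otimes> x \<in> snd e" unfolding e(1) using e(3) xc gx by (simp add: coset_def mem_lcoset)
    moreover have "g \<otimes> x \<in> snd e'" if e': "e' \<in> F" for e'
    proof -
      have "e' \<in> elements \<Gamma>" using flagF e' by (auto simp: flag_def)
      from element_coset(2)[OF this, of g] have e'_eq: "e' = coset (fst e') g" using g(2) e' by blast
      have "gen (I - ?K) \<subseteq> gen (I - {fst e'})" using e' by (intro gen_mono) auto
      then have "inv g \<otimes> (g \<otimes> x) \<in> gen (I - {fst e'})" using x(2) g(1) xc by (auto simp: mult_inv_cancel)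
      then have "g \<otimes> x \<in> snd (coset (fst e') g)" using g(1) gx by (simp add: coset_def mem_lcoset)
      with e'_eq show ?thesis by (rule ssubst[where P = "\<lambda>e. g \<otimes> x \<in> snd e"])
    qed
    ultimately show ?case using gx by (intro bexI[where x = "g \<otimes> x"]) simp_all
  qed auto
  then obtain g where g: "g \<in> carrier G" "\<forall>e\<in>F. g \<in> snd e" by blast
  have "coset (fst e) g = e" if "e \<in> F" for e
  proof -
    have "e \<in> elements \<Gamma>" using assms that unfolding flag_def by blast
    then show ?thesis using element_coset(2)[of e g, symmetric] g(2) that by blast
  qed
  then have "F = (\<lambda>i. coset i g) ` (fst ` F)" by (auto simp: image_image)
  then show ?thesis using that g(1) by blast
qed

lemma flag_cosets:
  assumes "g \<in> carrier G" "K \<subseteq> I"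
  shows "flag \<Gamma> ((\<lambda>i. coset i g) ` K)"
proof -
  have "incident \<Gamma> (coset i g) (coset j g)" for i j
    using self_in_coset[OF assms(1)] unfolding Gamma_simps(2) by blast
  then show ?thesis using assms by (fastforce simp: flag_def Gamma_simps(1))
qed

text \<open>The cosets of all types through a common element of the flag form a chamber containing
  it.\<close>

lemma geometry_Gamma: "geometry \<Gamma>"
  unfolding geometry_def
proof (intro conjI incidence_system_Gamma allI impI)
  fix F assume max: "maximal_flag \<Gamma> F"
  then have F: "flag \<Gamma> F" by (simp add: maximal_flag_def)
  obtain g where g: "g \<in> carrier G" "F = (\<lambda>i. coset i g) ` (fst ` F)"
    using flag_common_element[OF F] .
  have "F \<subseteq> (\<lambda>i. coset i g) ` I" using g(2) flag_inj_on(2)[OF F] by blast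
  then have "F = (\<lambda>i. coset i g) ` I"
    using max flag_cosets[OF g(1) order.refl] unfolding maximal_flag_def by blast
  then show "chamber \<Gamma> F"
    using F by (simp add: chamber_def flag_type_def Gamma_simps image_image)
qed

lemma flags_of_type_Gamma:
  assumes "J \<subseteq> I"
  shows "flags_of_type \<Gamma> J = {(\<lambda>i. coset i g) ` J | g. g \<in> carrier G}"
proof (intro subset_antisym subsetI)
  fix F assume "F \<in> flags_of_type \<Gamma> J"
  then have F: "flag \<Gamma> F" "fst ` F = J" by (auto simp: flags_of_type_def flag_type_def Gamma_simps)
  obtain g where "g \<in> carrier G" "F = (\<lambda>i. coset i g) ` (fst ` F)"
    using flag_common_element[OF F(1)] .
  then show "F \<in> {(\<lambda>i. coset i g) ` J | g. g \<in> carrier G}"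
    unfolding F(2) by blast
next
  fix F assume "F \<in> {(\<lambda>i. coset i g) ` J | g. g \<in> carrier G}"
  then show "F \<in> flags_of_type \<Gamma> J"
    using flag_cosets assms by (auto simp: flags_of_type_def flag_type_def Gamma_simps image_image)
qed

lemma left_multiplication_coset:
  assumes "g \<in> carrier G" "h \<in> carrier G"
  shows "left_multiplication G h (coset i g) = coset i (h \<otimes> g)"
proof -
  have "gen (I - {i}) \<subseteq> carrier G" using gen_closed(1)[of "I - {i}"] by blast
  then show ?thesis
    using assms by (simp add: left_multiplication_def coset_def lcos_m_assoc)
qed

lemma flag_transitive_Gamma: "flag_transitive G (left_multiplication G) \<Gamma>"
  unfolding flag_transitive_def
proof (intro allI impI)
  fix J assume "J \<subseteq> types \<Gamma>"
  then have J: "J \<subseteq> I" by (simp add: Gamma_simps)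
  define E where "E = flags_of_type \<Gamma> J"
  define fl where "fl g = (\<lambda>i. coset i g) ` J" for g
  have E: "E = {fl g | g. g \<in> carrier G}"
    unfolding E_def fl_def by (rule flags_of_type_Gamma[OF J])
  define act where "act = (\<lambda>g. \<lambda>F \<in> E. left_multiplication G g ` F)"
  have act: "act h (fl g) = fl (h \<otimes> g)" if "g \<in> carrier G" "h \<in> carrier G" for g h
  proof -
    have "fl g \<in> E" using that E by blast
    moreover have "left_multiplication G h ` fl g = fl (h \<otimes> g)"
      using that by (simp add: fl_def image_image left_multiplication_coset)
    ultimately show ?thesis by (simp add: act_def)
  qed
  have act_E: "act h F \<in> E" if "F \<in> E" "h \<in> carrier G" for h F
    using that act by (auto simp: E)
  have act_act: "act h (act k F) = act (h \<otimes> k) F"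
    if "F \<in> E" "h \<in> carrier G" "k \<in> carrier G" for h k F
    using that act by (auto simp: E m_assoc)
  have act_one: "act \<one> F = F" if "F \<in> E" for F
    using that act by (auto simp: E)
  have bij: "act h \<in> Bij E" if h: "h \<in> carrier G" for h
  proof -
    have "bij_betw (act h) E E"
      using h act_E act_act act_one
      by (intro bij_betw_byWitness[where f' = "act (inv h)"]) auto
    then show ?thesis by (simp add: Bij_def act_def)
  qed
  have "act \<in> hom G (BijGroup E)"
  proof (rule homI)
    fix h k assume hk: "h \<in> carrier G" "k \<in> carrier G"
    have "act (h \<otimes> k) = compose E (act h) (act k)"
    proof (rule extensionalityI[of _ E])
      show "act (h \<otimes> k) \<in> extensional E" by (simp add: act_def)
    qed (use hk act_act in \<open>simp_all add: compose_def\<close>)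
    then show "act (h \<otimes> k) = act h \<otimes>\<^bsub>BijGroup E\<^esub> act k"
      using hk bij by (simp add: BijGroup_def)
  qed (simp add: BijGroup_def bij)
  then have "group_hom G (BijGroup E) act"
    by (simp add: group_hom_def group_hom_axioms_def group_BijGroup)
  moreover have "\<exists>h\<in>carrier G. act h F = F'" if FF': "F \<in> E" "F' \<in> E" for F F'
  proof -
    obtain g g' where g: "g \<in> carrier G" "g' \<in> carrier G" "F = fl g" "F' = fl g'"
      using FF' E by blast
    then have "act (g' \<otimes> inv g) F = F'" by (simp add: act m_assoc)
    then show ?thesis using g by blast
  qed
  ultimately have "transitive_action G E act"
    by (simp add: transitive_action_def group_action_def transitive_action_axioms_def)
  then show "transitive_action G (flags_of_type \<Gamma> J)
      (\<lambda>g. \<lambda>F \<in> flags_of_type \<Gamma> J. left_multiplication G g ` F)"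
    by (simp add: E_def act_def)
qed

text \<open>Adding an element of the residue gives a flag with a common element \<open>h\<close>,
  and \<open>inv g \<otimes> h\<close> lies in all \<open>gen (I - {j})\<close>, hence in their
  intersection. So the residue is parametrised by a translate of \<open>gen (I - K)\<close>, which
  turns connectedness and firmness into statements about this subgroup.\<close>

lemma residue_Gamma:
  assumes g: "g \<in> carrier G" and K: "K \<subseteq> I"
  shows "residue \<Gamma> ((\<lambda>i. coset i g) ` K) =
    {coset i (g \<otimes> x) | i x. i \<in> I - K \<and> x \<in> gen (I - K)}" (is "residue \<Gamma> ?F = ?R")
proof (intro subset_antisym subsetI)
  fix e assume e: "e \<in> residue \<Gamma> ?F"
  have el: "e \<in> elements \<Gamma>" "e \<notin> ?F" "\<And>f. f \<in> ?F \<Longrightarrow> incident \<Gamma> e f"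
    using e by (auto simp: residue_def)
  have "incident \<Gamma> e e" using el(1) incidence_system_Gamma by (simp add: incidence_system_def)
  then have "flag \<Gamma> (insert e ?F)"
  proof -
    have "incident \<Gamma> f e" if "f \<in> ?F" for f
      using el(3)[OF that] incidence_system_Gamma by (simp add: Gamma_simps(2) Int_commute)
    then show ?thesis
      using el \<open>incident \<Gamma> e e\<close> flag_cosets[OF g K] by (simp add: flag_def)
  qed
  then obtain h where h: "h \<in> carrier G"
    "insert e ?F = (\<lambda>i. coset i h) ` (fst ` insert e ?F)"
    using flag_common_element by blast
  have fst_e: "fst e \<notin> K"
  proof
    assume "fst e \<in> K"
    then have "coset (fst e) g \<in> ?F" by blast
    moreover from this have "e = coset (fst e) g"
      by (intro inj_onD[OF flag_inj_on(1)[OF \<open>flag \<Gamma> (insert e ?F)\<close>]]) simp_all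
    ultimately show False using el(2) by simp
  qed
  have "fst e \<in> I" using el(1) by (auto simp: Gamma_simps)
  have through_h: "coset (fst e') h = e'" if e': "e' \<in> insert e ?F" for e'
  proof -
    obtain i where "e' = coset i h"
      using subsetD[OF equalityD1[OF h(2)] e'] by blast
    then show ?thesis by simp
  qed
  have "inv g \<otimes> h \<in> gen (I - {j})" if "j \<in> K" for j
    using through_h[of "coset j g"] that g h(1) by (simp flip: coset_eq_iff)
  then have "inv g \<otimes> h \<in> gen (I - K)"
    using gen_Inter[OF K] g h(1) by simp
  moreover have "coset (fst e) (g \<otimes> (inv g \<otimes> h)) = e"
    using through_h[of e] g h(1) by (simp add: mult_inv_cancel)
  ultimately show "e \<in> ?R" using fst_e \<open>fst e \<in> I\<close> by force
next
  fix e assume "e \<in> ?R"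
  then obtain i x where e: "e = coset i (g \<otimes> x)" "i \<in> I" "i \<notin> K" "x \<in> gen (I - K)" by blast
  have x: "x \<in> carrier G" using e(4) gen_closed(1)[of "I - K"] by blast
  have "coset j g = coset j (g \<otimes> x)" if "j \<in> K" for j
  proof -
    have "gen (I - K) \<subseteq> gen (I - {j})" using that by (intro gen_mono) auto
    then have "inv g \<otimes> (g \<otimes> x) \<in> gen (I - {j})" using g x e(4) by (auto simp: mult_inv_cancel)
    then show ?thesis using g x coset_eq_iff by simp
  qed
  then have through: "g \<otimes> x \<in> snd f" if "f \<in> ?F" for f
    using that self_in_coset[of "g \<otimes> x"] g x by auto
  have "incident \<Gamma> e f" if "f \<in> ?F" for f
    using through[OF that] self_in_coset[of "g \<otimes> x" i] g x e(1) unfolding Gamma_simps(2) by auto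
  moreover have "e \<notin> ?F" using e(1,3) by (auto dest: arg_cong[where f = fst])
  ultimately show "e \<in> residue \<Gamma> ?F"
    using e g x by (auto simp: residue_def Gamma_simps(1))
qed

lemma flag_corank:
  assumes "flag \<Gamma> F"
  shows "corank \<Gamma> F = card (I - fst ` F)"
proof -
  have "card F = card (fst ` F)" using flag_inj_on(1)[OF assms] by (simp add: card_image)
  then show ?thesis
    using flag_inj_on(2)[OF assms] finite_I
    by (simp add: corank_def Gamma_simps card_Diff_subset finite_subset)
qed

text \<open>A word over the remaining types \<open>L\<close> leads from any chamber of the residue
  to any other one. Each letter changes only the coset of its own type, and a second type in
  \<open>L\<close> bridges that change.\<close>

lemma residually_connected_Gamma: "residually_connected \<Gamma>"
  unfolding residually_connected_def
proof (intro allI impI)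
  fix F assume F: "flag \<Gamma> F \<and> 2 \<le> corank \<Gamma> F"
  obtain g where g: "g \<in> carrier G" "F = (\<lambda>i. coset i g) ` (fst ` F)"
    using flag_common_element F by blast
  define L where "L = I - fst ` F"
  have K: "fst ` F \<subseteq> I" using flag_inj_on(2) F by blast
  have L: "L \<subseteq> I" by (auto simp: L_def)
  have "2 \<le> card L" using F flag_corank[of F] by (simp add: L_def)
  then obtain l where l: "l \<in> L" by fastforce
  have other: "\<exists>k\<in>L. k \<noteq> i" for i
  proof (rule ccontr)
    assume "\<not> (\<exists>k\<in>L. k \<noteq> i)"
    then have "L \<subseteq> {i}" by blast
    then have "card L \<le> 1" using card_mono[of "{i}" L] by simp
    then show False using \<open>2 \<le> card L\<close> by simp
  qed
  define S where "S = residue \<Gamma> F"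
  have S: "S = {coset i (g \<otimes> x) | i x. i \<in> L \<and> x \<in> gen L}"
    unfolding S_def L_def by (subst g(2)) (rule residue_Gamma[OF g(1) K])
  define T where "T = {(u, v). u \<in> S \<and> v \<in> S \<and> incident \<Gamma> u v}"
  have "sym T" by (auto simp: T_def Gamma_simps(2) sym_def)
  have Lc: "x \<in> carrier G" if "x \<in> gen L" for x using that gen_closed(1)[OF L] by blast
  have step: "(coset i (g \<otimes> x), coset j (g \<otimes> x)) \<in> T" if "i \<in> L" "j \<in> L" "x \<in> gen L" for i j x
  proof -
    have "g \<otimes> x \<in> snd (coset i (g \<otimes> x))" "g \<otimes> x \<in> snd (coset j (g \<otimes> x))"
      using self_in_coset g Lc that by auto
    then show ?thesis using that by (auto simp: T_def S Gamma_simps(2))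
  qed
  have gallery: "(coset l (g \<otimes> x), coset l (g \<otimes> (x \<otimes> word_eval G r w))) \<in> T\<^sup>*"
    if "w \<in> words L" "x \<in> gen L" for w x
    using that
  proof (induction w arbitrary: x)
    case Nil
    then show ?case using Lc by simp
  next
    case (Cons a w)
    define b where "b = (if snd a then r (fst a) else inv (r (fst a)))"
    have a: "fst a \<in> L" "w \<in> words L" using Cons.prems by auto
    have b: "b \<in> gen {fst a}" using a L by (auto simp: b_def intro: generate.intros)
    have bL: "b \<in> gen L" using b gen_mono[of "{fst a}" L] a by blast
    have xb: "x \<otimes> b \<in> gen L" using Cons.prems(2) bL gen_closed(3)[OF L] by blast
    have same: "coset i (g \<otimes> x) = coset i (g \<otimes> (x \<otimes> b))" if "i \<in> I" "i \<noteq> fst a" for i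
    proof -
      have "{fst a} \<subseteq> I - {i}" using that a L by auto
      then have "b \<in> gen (I - {i})" using b gen_mono by blast
      moreover have "inv (g \<otimes> x) \<otimes> (g \<otimes> (x \<otimes> b)) = b"
        using g Lc[OF Cons.prems(2)] Lc[OF bL]
        by (simp add: inv_mult_group m_assoc mult_inv_cancel)
      ultimately show ?thesis
        using g Lc[OF Cons.prems(2)] Lc[OF bL] by (simp add: coset_eq_iff)
    qed
    have first: "(coset l (g \<otimes> x), coset l (g \<otimes> (x \<otimes> b))) \<in> T\<^sup>*"
    proof (cases "l = fst a")
      case False
      then show ?thesis using same[of l] l L by auto
    next
      case True
      \<comment> \<open>A generator of type \<open>l\<close> moves the coset of type
        \<open>l\<close> but fixes that of type \<open>k\<close>, which is incident to both.\<close>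
      obtain k where k: "k \<in> L" "k \<noteq> fst a" using other by blast
      have "(coset l (g \<otimes> x), coset k (g \<otimes> x)) \<in> T"
        using step l k Cons.prems by blast
      moreover have "coset k (g \<otimes> x) = coset k (g \<otimes> (x \<otimes> b))" using same k L by blast
      moreover have "(coset k (g \<otimes> (x \<otimes> b)), coset l (g \<otimes> (x \<otimes> b))) \<in> T"
        using step l k xb by blast
      ultimately show ?thesis by (metis converse_rtrancl_into_rtrancl r_into_rtrancl)
    qed
    have wL: "word_eval G r w \<in> carrier G"
      by (rule word_eval_closed[of r L]) (use a r_Pi L in auto)
    have "x \<otimes> word_eval G r (a # w) = x \<otimes> b \<otimes> word_eval G r w"
      using Lc[OF Cons.prems(2)] Lc[OF bL] wL by (simp add: b_def m_assoc)
    then show ?case using Cons.IH[OF a(2) xb] first by (metis rtrancl_trans)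
  qed
  have base: "(coset l g, u) \<in> T\<^sup>*" if u: "u \<in> S" for u
  proof -
    obtain i x where x: "u = coset i (g \<otimes> x)" "i \<in> L" "x \<in> gen L" using u S by blast
    have "gen L = word_eval G r ` words L" using r_Pi L by (intro generate_eq_word_eval) auto
    then obtain w where w: "w \<in> words L" "x = word_eval G r w" using x(3) by blast
    have "(coset l g, coset l (g \<otimes> x)) \<in> T\<^sup>*"
      using gallery[OF w(1) gen_closed(2)[OF L]] w(2) g Lc[OF x(3)] by simp
    then show ?thesis using step[OF l x(2,3)] x(1) by simp
  qed
  have "sym (T\<^sup>*)" using \<open>sym T\<close> by (rule sym_rtrancl)
  then have "(u, v) \<in> T\<^sup>*" if "u \<in> S" "v \<in> S" for u v
    using base[OF that(1)] base[OF that(2)] by (meson rtrancl_trans symD)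
  then show "connected_incidence_graph \<Gamma> (residue \<Gamma> F)"
    unfolding connected_incidence_graph_def S_def[symmetric] T_def[symmetric] by blast
qed

text \<open>The only missing type is \<open>i\<close>, and the cosets of \<open>g\<close> and
  \<open>g \<otimes> r i\<close> differ by independence.\<close>

lemma firm_Gamma: "firm \<Gamma>"
  unfolding firm_def
proof (intro allI impI)
  fix F assume F: "flag \<Gamma> F \<and> corank \<Gamma> F = 1"
  obtain g where g: "g \<in> carrier G" "F = (\<lambda>i. coset i g) ` (fst ` F)"
    using flag_common_element F by blast
  have K: "fst ` F \<subseteq> I" using flag_inj_on(2) F by blast
  have "card (I - fst ` F) = 1" using F flag_corank[of F] by simp
  then obtain i where i: "I - fst ` F = {i}" by (auto simp: card_1_singleton_iff)
  have iI: "i \<in> I" using i by blast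
  have R: "residue \<Gamma> F = {coset j (g \<otimes> x) | j x. j \<in> {i} \<and> x \<in> gen {i}}"
    unfolding i[symmetric] by (subst g(2)) (rule residue_Gamma[OF g(1) K])
  have ri: "r i \<in> carrier G" using r_Pi iI by auto
  have "coset i (g \<otimes> \<one>) \<noteq> coset i (g \<otimes> r i)"
    using g ri independent[OF iI] by (simp add: coset_eq_iff flip: m_assoc)
  moreover have "\<one> \<in> gen {i}" by (rule gen_closed(2)) (use iI in simp)
  moreover have "r i \<in> gen {i}" by (rule r_gen) simp
  ultimately show "\<exists>x \<in> residue \<Gamma> F. \<exists>y \<in> residue \<Gamma> F. x \<noteq> y"
    unfolding R by blast
qed

end

lemma (in mixed_group) independent_generators:
  assumes "finite V"
  shows "independent_generators P V r"
proof
  show "r \<in> V \<rightarrow> carrier P" by (rule r_Pi)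
  show "generate P (r ` V) = carrier P"
    unfolding P.generate_eq_word_eval[OF r_Pi] using has_presentationD(3)[OF presentation_P] by simp
  show "\<exists>a \<in> generate P (r ` (J \<inter> K)). \<exists>b \<in> generate P (r ` (J \<inter> L)). y \<otimes>\<^bsub>P\<^esub> z = a \<otimes>\<^bsub>P\<^esub> b"
    if "J \<subseteq> V" "K \<subseteq> V" "L \<subseteq> V" "y \<in> generate P (r ` K)" "z \<in> generate P (r ` L)"
      "y \<otimes>\<^bsub>P\<^esub> z \<in> generate P (r ` J)" for J K L y z
    using parabolic_P_inter_product that unfolding parabolic_P_def by blast
  show "r i \<notin> generate P (r ` (V - {i}))" if "i \<in> V" for i
    using r_notin_parabolic_P[of i "V - {i}"] that unfolding parabolic_P_def by auto
qed (use assms in auto)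

theorem theorem5p4:
  fixes A :: "'g monoid" and B :: "'h monoid"
    and X :: "'a set" and Y :: "'b set"
    and s :: "'a \<Rightarrow> 'g" and t :: "'b \<Rightarrow> 'h"
    and G :: "('g + 'h) word set monoid"
    and I :: "('a + 'b) set"
    and r :: "'a + 'b \<Rightarrow> ('g + 'h) word set"
    and \<Gamma> :: "(('a + 'b) \<times> ('g + 'h) word set set, 'a + 'b) incidence_structure"
  assumes "is_artin_tits_group A X s \<or> is_coxeter_group A X s"
    and "is_artin_tits_group B Y t \<or> is_coxeter_group B Y t"
    and "G = free_product A B"
    and "I = X <+> Y"
    and "r = free_product_family A B s t"
    and "\<Gamma> = standard_coset_system G I r"
  shows "is_shephard_group G I r \<and>
    geometry \<Gamma> \<and>
    flag_transitive G (left_multiplication G) \<Gamma> \<and>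
    residually_connected \<Gamma> \<and>
    firm \<Gamma>"
proof -
  obtain m Q where X: "finite X" "coxeter_matrix X m" "Q \<subseteq> X" "odd_closed X m Q"
    and A: "has_presentation A X s (mixed_relations X m Q)"
    using artin_tits_or_coxeter_mixed[OF assms(1)] .
  obtain n Q' where Y: "finite Y" "coxeter_matrix Y n" "Q' \<subseteq> Y" "odd_closed Y n Q'"
    and B: "has_presentation B Y t (mixed_relations Y n Q')"
    using artin_tits_or_coxeter_mixed[OF assms(2)] .
  define M where "M = sum_matrix m n"
  define N where "N = Q <+> Q'"
  have I: "finite I" "coxeter_matrix I M" "N \<subseteq> I" "odd_closed I M N"
    using X Y coxeter_matrix_sum odd_closed_sum by (auto simp: assms(4) M_def N_def)
  have G: "has_presentation G I r (mixed_relations I M N)"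
    using has_presentation_free_product[OF A B]
    by (simp add: assms(3-5) map_relations_mixed M_def N_def)
  \<comment> \<open>The Coxeter group with the labels of \<open>G\<close>: the same braid relations,
    with the square relations extended from \<open>N\<close> to all of \<open>I\<close>.\<close>
  define W where "W = presented_group I (mixed_relations I M I)"
  define c where "c i = word_class I (mixed_relations I M I) [letter i]" for i
  have W: "has_presentation W I c (mixed_relations I M I)"
    unfolding W_def c_def by (rule has_presentation_presented_group)
  interpret mixed_group W I M c G r N
    using W G I by (simp add: mixed_group_def mixed_group_axioms_def coxeter_group_def
        coxeter_group_axioms_def has_presentationD(1)[OF W])
  interpret independent_generators G I r
    by (rule independent_generators[OF I(1)])
  show ?thesis
    using is_shephard_group_mixed[OF I G] geometry_Gamma flag_transitive_Gamma
      residually_connected_Gamma firm_Gamma unfolding assms(6) by blast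
qed

end
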